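(* Let $G$ be a locally convex Lie group, let $\overline{\rho}\colon G\to\mathrm{PU}(\mathcal{H})$ be a smooth projective unitary representation with associated unitary representation $\rho$ of $G^\sharp$, let $[\psi]\in\mathbb{P}(\mathcal{H}^\infty)$, and let $\mu_{[\psi]}(\xi)=\langle\psi,i\,d\rho(\xi)\psi\rangle/\langle\psi,\psi\rangle$ for $\xi\in\mathfrak{g}^\sharp$. Then the restriction of $-i\mu_{[\psi]}\colon\mathfrak{g}^\sharp\to i\mathbb{R}$ to $$\mathfrak{g}^\sharp_{[\psi]}=\{\xi\in\mathfrak{g}^\sharp: d\rho(\xi)\psi\in i\mathbb{R}\psi\}$$ is a Lie algebra character. It integrates to a group character on any Lie subgroup of $$G^\sharp_{[\psi]}=\{g\in G^\sharp:[\rho(g)\psi]=[\psi]\}.$$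
   Context: Conventions: locally convex Lie groups are modelled on Hausdorff locally convex spaces, with smoothness in the sense of Michal–Bastiani. Scalar products are antilinear in the first and linear in the second argument. Projective representation: $\mathrm{PU}(\mathcal{H})=\mathrm{U}(\mathcal{H})/\mathrm{U}(1)\mathbf{1}$ for a complex Hilbert space $\mathcal{H}$. A projective unitary representation $\overline{\rho}\colon G\to \mathrm{PU}(\mathcal{H})$ is smooth if the set $\mathbb{P}(\mathcal{H})^\infty$ of rays $[\psi]$ with smooth orbit map $G\to\mathbb{P}(\mathcal{H})$, $g\mapsto\overline{\rho}(g)[\psi]$, is dense in $\mathbb{P}(\mathcal{H})$. Set $G^\sharp=\{(g,U)\in G\times \mathrm{U}(\mathcal{H}): \overline{\rho}(g)=[U]\}$ and $\rho(g,U)=U$. It is known that $G^\sharp$ is a locally convex Lie group (Lie algebra $\mathfrak{g}^\sharp$), that $G^\sharp\to G$ is a homomorphism of Lie groups and a principal $\mathrm{U}(1)$-bundle, that $\rho(z)=z\mathbf{1}$ for $z\in \mathrm{U}(1)$, and that the space $\mathcal{H}^\infty$ of smooth vectors (those $\psi$ for which $g\mapsto\rho(g)\psi$ is smooth into $\mathcal{H}$) is dense, with $\mathbb{P}(\mathcal{H}^\infty)=\mathbb{P}(\mathcal{H})^\infty$. The derived representation $d\rho(\xi)\psi$ is the derivative at the identity of $g\mapsto \rho(g)\psi$ in direction $\xi\in\mathfrak{g}^\sharp$. A Lie algebra character is a Lie algebra homomorphism into the abelian Lie algebra $i\mathbb{R}$. That $-i\mu_{[\psi]}$ integrates to a group character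 on a Lie subgroup $H\subseteq G^\sharp$ contained in $G^\sharp_{[\psi]}$ means that there is a smooth group homomorphism $H\to\mathrm{U}(1)$ whose derivative at the identity is $-i\mu_{[\psi]}|_{\mathrm{Lie}(H)}$. *)

theory Defs
  imports "HOL-Analysis.Analysis" "HOL-Algebra.Coset"
begin

section \<open>Hausdorff locally convex spaces and Michal--Bastiani smoothness\<close>

class locally_convex_space = real_vector + t2_space + topological_ab_group_add +
  assumes tendsto_scaleR_Pair:
    "LIM x (nhds r \<times>\<^sub>F nhds a). fst x *\<^sub>R snd x :> nhds (r *\<^sub>R a)"
  and locally_convex:
    "open U \<Longrightarrow> x \<in> U \<Longrightarrow> \<exists>V. open V \<and> x \<in> V \<and> V \<subseteq> U \<and>
       (\<forall>a\<in>V. \<forall>b\<in>V. \<forall>s\<ge>0. \<forall>t\<ge>0. s + t = 1 \<longrightarrow> s *\<^sub>R a + t *\<^sub>R b \<in> V)"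

lemma locally_convex_convex:
  fixes U :: "'a::locally_convex_space set"
  assumes "open U" "x \<in> U"
  shows "\<exists>V. open V \<and> convex V \<and> x \<in> V \<and> V \<subseteq> U"
  using locally_convex[OF assms] unfolding convex_def by blast

instance real_normed_vector \<subseteq> locally_convex_space
proof
  fix r :: real and a :: 'a
  show "LIM x (nhds r \<times>\<^sub>F nhds a). fst x *\<^sub>R snd x :> nhds (r *\<^sub>R a)"
    by (intro tendsto_scaleR filterlim_fst filterlim_snd)
next
  fix U :: "'a set" and x assume "open U" "x \<in> U"
  then obtain e where "e > 0" "ball x e \<subseteq> U"
    using open_contains_ball by blast
  moreover have "convex (ball x e)"
    by (rule convex_ball)
  ultimately show "\<exists>V. open V \<and> x \<in> V \<and> V \<subseteq> U \<and>
      (\<forall>a\<in>V. \<forall>b\<in>V. \<forall>s\<ge>0. \<forall>t\<ge>0. s + t = 1 \<longrightarrow> s *\<^sub>R a + t *\<^sub>R b \<in> V)"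
    by (intro exI[of _ "ball x e"]) (auto simp: convex_def)
qed

instance prod :: (topological_monoid_add, topological_monoid_add) topological_monoid_add
proof
  fix a b :: "'a \<times> 'b"
  show "LIM x (nhds a \<times>\<^sub>F nhds b). fst x + snd x :> nhds (a + b)"
    unfolding plus_prod_def
    by (intro tendsto_Pair tendsto_add tendsto_fst tendsto_snd filterlim_fst filterlim_snd)
qed

instance prod :: (topological_group_add, topological_group_add) topological_group_add
proof
  fix a :: "'a \<times> 'b"
  show "(uminus \<longlongrightarrow> - a) (nhds a)"
    unfolding uminus_prod_def
    by (intro tendsto_Pair tendsto_minus tendsto_fst tendsto_snd filterlim_ident)
qed

instance prod :: (topological_ab_group_add, topological_ab_group_add) topological_ab_group_add ..

instance prod :: (locally_convex_space, locally_convex_space) locally_convex_space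
proof
  fix r :: real and a :: "'a \<times> 'b"
  have scale: "((\<lambda>x. f x *\<^sub>R g x) \<longlongrightarrow> s *\<^sub>R c) F"
    if "(f \<longlongrightarrow> s) F" "(g \<longlongrightarrow> c) F"
    for f and g :: "'x \<Rightarrow> 'c::locally_convex_space" and s c F
    using filterlim_compose[OF tendsto_scaleR_Pair filterlim_Pair[OF that]] by simp
  show "LIM x (nhds r \<times>\<^sub>F nhds a). fst x *\<^sub>R snd x :> nhds (r *\<^sub>R a)"
    unfolding scaleR_prod_def
    by (intro tendsto_Pair scale tendsto_fst tendsto_snd filterlim_fst filterlim_snd)
next
  fix U :: "('a \<times> 'b) set" and x assume "open U" "x \<in> U"
  then obtain A B where AB: "open A" "open B" "x \<in> A \<times> B" "A \<times> B \<subseteq> U"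
    by (elim open_prod_elim) blast
  obtain A' where A': "open A'" "convex A'" "fst x \<in> A'" "A' \<subseteq> A"
    using locally_convex_convex[OF AB(1), of "fst x"] AB(3) by auto
  obtain B' where B': "open B'" "convex B'" "snd x \<in> B'" "B' \<subseteq> B"
    using locally_convex_convex[OF AB(2), of "snd x"] AB(3) by auto
  have "convex (A' \<times> B')"
    using A'(2) B'(2) by (rule convex_Times)
  moreover have "open (A' \<times> B')" "x \<in> A' \<times> B'" "A' \<times> B' \<subseteq> U"
    using A' B' AB by (auto simp: open_Times mem_Times_iff)
  ultimately show "\<exists>V. open V \<and> x \<in> V \<and> V \<subseteq> U \<and>
      (\<forall>a\<in>V. \<forall>b\<in>V. \<forall>s\<ge>0. \<forall>t\<ge>0. s + t = 1 \<longrightarrow> s *\<^sub>R a + t *\<^sub>R b \<in> V)"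
    unfolding convex_def by blast
qed

definition has_dir_deriv ::
    "('e::locally_convex_space \<Rightarrow> 'f::locally_convex_space) \<Rightarrow> 'e \<Rightarrow> 'e \<Rightarrow> 'f \<Rightarrow> bool" where
  "has_dir_deriv f x v w \<longleftrightarrow> ((\<lambda>t::real. (f (x + t *\<^sub>R v) - f x) /\<^sub>R t) \<longlongrightarrow> w) (at 0)"

definition dir_deriv ::
    "('e::locally_convex_space \<Rightarrow> 'f::locally_convex_space) \<Rightarrow> 'e \<Rightarrow> 'e \<Rightarrow> 'f" where
  "dir_deriv f x v = (THE w. has_dir_deriv f x v w)"

text \<open>\<open>iter_deriv k f v x\<close> is the iterated directional derivative of \<open>f\<close> at \<open>x\<close>, first in
  direction \<open>v 0\<close>, then \<open>v 1\<close>, and so on up to \<open>v (k - 1)\<close>. It ignores the remaining values of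
  \<open>v\<close>, so its joint continuity in \<open>(x, v)\<close> for the product topology on \<open>nat \<Rightarrow> 'e\<close> is joint
  continuity on \<open>S \<times> E^k\<close>.\<close>

primrec iter_deriv ::
    "nat \<Rightarrow> ('e::locally_convex_space \<Rightarrow> 'f::locally_convex_space) \<Rightarrow> (nat \<Rightarrow> 'e) \<Rightarrow> 'e \<Rightarrow> 'f" where
  "iter_deriv 0 f v = f"
| "iter_deriv (Suc k) f v = (\<lambda>x. dir_deriv (iter_deriv k f v) x (v k))"

text \<open>Michal--Bastiani smoothness; meant for open \<open>S\<close>.\<close>

definition mb_smooth_on ::
    "'e::locally_convex_space set \<Rightarrow> ('e \<Rightarrow> 'f::locally_convex_space) \<Rightarrow> bool" where
  "mb_smooth_on S f \<longleftrightarrow>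
     (\<forall>k. (\<forall>x\<in>S. \<forall>v. \<exists>w. has_dir_deriv (iter_deriv k f v) x (v k) w) \<and>
          continuous_on (S \<times> UNIV) (\<lambda>(x, v). iter_deriv k f v x))"


section \<open>Manifolds modelled on locally convex spaces\<close>

type_synonym ('a, 'e) chart = "'a set \<times> ('a \<Rightarrow> 'e)"

record ('a, 'e) mfd =
  mtop :: "'a topology"
  atlas :: "('a, 'e) chart set"

definition chart_inv :: "('a, 'e) chart \<Rightarrow> 'e \<Rightarrow> 'a" where
  "chart_inv c = inv_into (fst c) (snd c)"

definition is_chart :: "'a topology \<Rightarrow> ('a, 'e::locally_convex_space) chart \<Rightarrow> bool" where
  "is_chart X c \<longleftrightarrow> openin X (fst c) \<and> open (snd c ` fst c) \<and>
     homeomorphic_map (subtopology X (fst c)) (top_of_set (snd c ` fst c)) (snd c)"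

locale lc_manifold =
  fixes M :: "('a, 'e::locally_convex_space) mfd"
  assumes hausdorff: "Hausdorff_space (mtop M)"
    and charts: "c \<in> atlas M \<Longrightarrow> is_chart (mtop M) c"
    and cover: "(\<Union>c\<in>atlas M. fst c) = topspace (mtop M)"
    and compatible: "c \<in> atlas M \<Longrightarrow> d \<in> atlas M \<Longrightarrow>
      mb_smooth_on (snd c ` (fst c \<inter> fst d)) (snd d \<circ> chart_inv c)"

definition smooth_map ::
    "('a, 'e::locally_convex_space) mfd \<Rightarrow> ('b, 'f::locally_convex_space) mfd \<Rightarrow> ('a \<Rightarrow> 'b) \<Rightarrow> bool" where
  "smooth_map M N f \<longleftrightarrow> continuous_map (mtop M) (mtop N) f \<and>
     (\<forall>c\<in>atlas M. \<forall>d\<in>atlas N.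
        mb_smooth_on (snd c ` {x \<in> fst c. f x \<in> fst d}) (snd d \<circ> f \<circ> chart_inv c))"

definition diffeomorphism ::
    "('a, 'e::locally_convex_space) mfd \<Rightarrow> ('b, 'f::locally_convex_space) mfd \<Rightarrow> ('a \<Rightarrow> 'b) \<Rightarrow> bool" where
  "diffeomorphism M N f \<longleftrightarrow>
     bij_betw f (topspace (mtop M)) (topspace (mtop N)) \<and>
     smooth_map M N f \<and> smooth_map N M (inv_into (topspace (mtop M)) f)"

definition vector_mfd :: "('e::locally_convex_space, 'e) mfd" where
  "vector_mfd = \<lparr>mtop = euclidean, atlas = {(UNIV, id)}\<rparr>"

definition prod_mfd ::
    "('a, 'e::locally_convex_space) mfd \<Rightarrow> ('b, 'f::locally_convex_space) mfd \<Rightarrow>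
     ('a \<times> 'b, 'e \<times> 'f) mfd" where
  "prod_mfd M N = \<lparr>mtop = prod_topology (mtop M) (mtop N),
     atlas = {(fst c \<times> fst d, map_prod (snd c) (snd d)) | c d. c \<in> atlas M \<and> d \<in> atlas N}\<rparr>"

definition open_submfd :: "('a, 'e::locally_convex_space) mfd \<Rightarrow> 'a set \<Rightarrow> ('a, 'e) mfd" where
  "open_submfd M W = \<lparr>mtop = subtopology (mtop M) W,
     atlas = {(fst c \<inter> W, snd c) | c. c \<in> atlas M}\<rparr>"

definition circle_mfd :: "(complex, real) mfd" where
  "circle_mfd = \<lparr>mtop = top_of_set (sphere 0 1),
     atlas = {(sphere 0 1 - {- w}, \<lambda>z. Arg (z / w)) | w. w \<in> sphere 0 1}\<rparr>"


section \<open>Tangent vectors\<close>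

definition charts_at :: "('a, 'e) mfd \<Rightarrow> 'a \<Rightarrow> ('a, 'e) chart set" where
  "charts_at M p = {c \<in> atlas M. p \<in> fst c}"

text \<open>A tangent vector at \<open>p\<close> is given by its components \<open>\<xi> c\<close> in all charts \<open>c\<close> around \<open>p\<close>,
  related by the derivatives of the coordinate changes; it is \<open>0\<close> on all other arguments, so
  that equality of functions is equality of tangent vectors.\<close>

definition tangent_space ::
    "('a, 'e::locally_convex_space) mfd \<Rightarrow> 'a \<Rightarrow> (('a, 'e) chart \<Rightarrow> 'e) set" where
  "tangent_space M p = {\<xi>.
     (\<forall>c\<in>charts_at M p. \<forall>d\<in>charts_at M p.
        \<xi> d = dir_deriv (snd d \<circ> chart_inv c) (snd c p) (\<xi> c)) \<and>
     (\<forall>c. c \<notin> charts_at M p \<longrightarrow> \<xi> c = 0)}"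

text \<open>The derivative at \<open>p\<close> in direction \<open>\<xi>\<close> of a vector-valued function defined near \<open>p\<close>,
  computed in any chart around \<open>p\<close>.\<close>

definition tangent_deriv ::
    "('a, 'e::locally_convex_space) mfd \<Rightarrow> ('a \<Rightarrow> 'f::locally_convex_space) \<Rightarrow> 'a \<Rightarrow>
     (('a, 'e) chart \<Rightarrow> 'e) \<Rightarrow> 'f" where
  "tangent_deriv M f p \<xi> =
     (THE w. \<forall>c\<in>charts_at M p. w = dir_deriv (f \<circ> chart_inv c) (snd c p) (\<xi> c))"

definition tangent_map ::
    "('a, 'e::locally_convex_space) mfd \<Rightarrow> ('b, 'f::locally_convex_space) mfd \<Rightarrow> ('a \<Rightarrow> 'b) \<Rightarrow> 'a \<Rightarrow>
     (('a, 'e) chart \<Rightarrow> 'e) \<Rightarrow> (('b, 'f) chart \<Rightarrow> 'f)" where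
  "tangent_map M N f p \<xi> =
     (\<lambda>d. if d \<in> charts_at N (f p) then tangent_deriv M (snd d \<circ> f) p \<xi> else 0)"


section \<open>Lie groups and their Lie algebras\<close>

locale lie_group = group G + lc_manifold M
  for G :: "'a monoid" (structure) and M :: "('a, 'e::locally_convex_space) mfd" +
  assumes topspace_carrier: "topspace (mtop M) = carrier G"
    and smooth_mult: "smooth_map (prod_mfd M M) M (\<lambda>(x, y). x \<otimes> y)"
    and smooth_inv: "smooth_map M M (\<lambda>x. inv x)"

definition lie_group_hom ::
    "'a monoid \<Rightarrow> ('a, 'e::locally_convex_space) mfd \<Rightarrow>
     'b monoid \<Rightarrow> ('b, 'f::locally_convex_space) mfd \<Rightarrow> ('a \<Rightarrow> 'b) \<Rightarrow> bool" where
  "lie_group_hom G M K N f \<longleftrightarrow> f \<in> hom G K \<and> smooth_map M N f"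

definition circle_group :: "complex monoid" where
  "circle_group = \<lparr>carrier = sphere 0 1, mult = (*), one = 1\<rparr>"

text \<open>A subgroup with a Lie group structure for which the inclusion is smooth with injective
  tangent map; its topology may be finer than the subspace topology. Embedded Lie subgroups
  are included. \<open>Lie(H)\<close> is \<open>T\<^sub>1 H\<close>, identified with a subspace of \<open>Lie(G)\<close> by this
  tangent map.\<close>

definition lie_subgroup ::
    "'a monoid \<Rightarrow> ('a, 'e::locally_convex_space) mfd \<Rightarrow> 'a set \<Rightarrow>
     ('a, 'k::locally_convex_space) mfd \<Rightarrow> bool" where
  "lie_subgroup G M H N \<longleftrightarrow> subgroup H G \<and> lie_group (G\<lparr>carrier := H\<rparr>) N \<and>
     smooth_map N M id \<and>
     inj_on (tangent_map N M id \<one>\<^bsub>G\<^esub>) (tangent_space N \<one>\<^bsub>G\<^esub>)"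

record 'v lie_alg =
  lcarrier :: "'v set"
  ladd :: "'v \<Rightarrow> 'v \<Rightarrow> 'v"
  lscale :: "real \<Rightarrow> 'v \<Rightarrow> 'v"
  lbracket :: "'v \<Rightarrow> 'v \<Rightarrow> 'v"

definition left_inv_field ::
    "'a monoid \<Rightarrow> ('a, 'e::locally_convex_space) mfd \<Rightarrow> (('a, 'e) chart \<Rightarrow> 'e) \<Rightarrow>
     'a \<Rightarrow> (('a, 'e) chart \<Rightarrow> 'e)" where
  "left_inv_field G M \<xi> g = tangent_map M M (\<lambda>h. g \<otimes>\<^bsub>G\<^esub> h) \<one>\<^bsub>G\<^esub> \<xi>"

text \<open>The commutator of vector fields, in coordinates \<open>[X, Y] = dY(X) - dX(Y)\<close>.\<close>

definition field_bracket ::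
    "('a, 'e::locally_convex_space) mfd \<Rightarrow> ('a \<Rightarrow> (('a, 'e) chart \<Rightarrow> 'e)) \<Rightarrow>
     ('a \<Rightarrow> (('a, 'e) chart \<Rightarrow> 'e)) \<Rightarrow> 'a \<Rightarrow> (('a, 'e) chart \<Rightarrow> 'e)" where
  "field_bracket M X Y p = (\<lambda>c. if c \<in> charts_at M p then
       dir_deriv (\<lambda>y. Y (chart_inv c y) c) (snd c p) (X p c) -
       dir_deriv (\<lambda>y. X (chart_inv c y) c) (snd c p) (Y p c)
     else 0)"

definition lie_algebra ::
    "'a monoid \<Rightarrow> ('a, 'e::locally_convex_space) mfd \<Rightarrow> (('a, 'e) chart \<Rightarrow> 'e) lie_alg" where
  "lie_algebra G M = \<lparr>lcarrier = tangent_space M \<one>\<^bsub>G\<^esub>,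
     ladd = (\<lambda>\<xi> \<eta> c. \<xi> c + \<eta> c),
     lscale = (\<lambda>r \<xi> c. r *\<^sub>R \<xi> c),
     lbracket = (\<lambda>\<xi> \<eta>. field_bracket M (left_inv_field G M \<xi>) (left_inv_field G M \<eta>) \<one>\<^bsub>G\<^esub>)\<rparr>"

definition lie_subalgebra :: "'v set \<Rightarrow> 'v lie_alg \<Rightarrow> bool" where
  "lie_subalgebra K L \<longleftrightarrow> K \<subseteq> lcarrier L \<and> K \<noteq> {} \<and>
     (\<forall>\<xi>\<in>K. \<forall>\<eta>\<in>K. ladd L \<xi> \<eta> \<in> K \<and> lbracket L \<xi> \<eta> \<in> K) \<and>
     (\<forall>r. \<forall>\<xi>\<in>K. lscale L r \<xi> \<in> K)"

definition lie_algebra_hom :: "'v lie_alg \<Rightarrow> 'w lie_alg \<Rightarrow> ('v \<Rightarrow> 'w) \<Rightarrow> bool" where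
  "lie_algebra_hom L L' f \<longleftrightarrow> f \<in> lcarrier L \<rightarrow> lcarrier L' \<and>
     (\<forall>\<xi>\<in>lcarrier L. \<forall>\<eta>\<in>lcarrier L.
        f (ladd L \<xi> \<eta>) = ladd L' (f \<xi>) (f \<eta>) \<and>
        f (lbracket L \<xi> \<eta>) = lbracket L' (f \<xi>) (f \<eta>)) \<and>
     (\<forall>r. \<forall>\<xi>\<in>lcarrier L. f (lscale L r \<xi>) = lscale L' r (f \<xi>))"

definition imaginary_lie_algebra :: "complex lie_alg" where
  "imaginary_lie_algebra = \<lparr>lcarrier = {z. Re z = 0}, ladd = (+),
     lscale = (*\<^sub>R), lbracket = (\<lambda>_ _. 0)\<rparr>"

definition lie_algebra_character :: "'v lie_alg \<Rightarrow> ('v \<Rightarrow> complex) \<Rightarrow> bool" where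
  "lie_algebra_character L f \<longleftrightarrow> lie_algebra_hom L imaginary_lie_algebra f"


section \<open>Complex Hilbert spaces and their projective spaces\<close>

class complex_hilbert = banach +
  fixes scaleC :: "complex \<Rightarrow> 'a \<Rightarrow> 'a"
    and cinner :: "'a \<Rightarrow> 'a \<Rightarrow> complex"
  assumes scaleC_add_right: "scaleC a (x + y) = scaleC a x + scaleC a y"
    and scaleC_add_left: "scaleC (a + b) x = scaleC a x + scaleC b x"
    and scaleC_scaleC: "scaleC a (scaleC b x) = scaleC (a * b) x"
    and scaleC_of_real: "scaleC (complex_of_real r) x = r *\<^sub>R x"
    and cinner_commute: "cinner x y = cnj (cinner y x)"
    and cinner_add_right: "cinner x (y + z) = cinner x y + cinner x z"
    and cinner_scaleC_right: "cinner x (scaleC a y) = a * cinner x y"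
    and cinner_self: "cinner x x = complex_of_real ((norm x)\<^sup>2)"

definition ray :: "'h::complex_hilbert \<Rightarrow> 'h set" where
  "ray v = range (\<lambda>a. scaleC a v)"

definition projectivization :: "'h::complex_hilbert set \<Rightarrow> 'h set set" where
  "projectivization D = ray ` (D - {0})"

definition proj_topology :: "'h::complex_hilbert set topology" where
  "proj_topology = topology (\<lambda>T. T \<subseteq> projectivization UNIV \<and> open {v. v \<noteq> 0 \<and> ray v \<in> T})"

lemma openin_proj_topology:
  "openin proj_topology T \<longleftrightarrow>
     T \<subseteq> projectivization UNIV \<and> open {v::'h::complex_hilbert. v \<noteq> 0 \<and> ray v \<in> T}"
proof -
  let ?P = "\<lambda>T. T \<subseteq> projectivization UNIV \<and> open {v::'h. v \<noteq> 0 \<and> ray v \<in> T}"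
  have "istopology ?P"
    unfolding istopology_def
  proof (intro conjI allI impI)
    fix S T :: "'h set set" assume "?P S" "?P T"
    moreover have "{v. v \<noteq> 0 \<and> ray v \<in> S \<inter> T} =
        {v. v \<noteq> 0 \<and> ray v \<in> S} \<inter> {v. v \<noteq> 0 \<and> ray v \<in> T}" by auto
    ultimately show "S \<inter> T \<subseteq> projectivization UNIV" "open {v. v \<noteq> 0 \<and> ray v \<in> S \<inter> T}"
      by (auto simp: open_Int)
  next
    fix K :: "'h set set set" assume K: "\<forall>T\<in>K. ?P T"
    have "{v. v \<noteq> 0 \<and> ray v \<in> \<Union>K} = (\<Union>T\<in>K. {v. v \<noteq> 0 \<and> ray v \<in> T})" by auto
    with K show "\<Union>K \<subseteq> projectivization UNIV" "open {v. v \<noteq> 0 \<and> ray v \<in> \<Union>K}"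
      by auto
  qed
  then show ?thesis
    unfolding proj_topology_def by (simp add: topology_inverse')
qed

text \<open>For \<open>\<phi> \<noteq> 0\<close> the affine chart of projective space around \<open>\<phi>\<close> sends a ray that is not
  orthogonal to \<open>\<phi>\<close> to its unique element \<open>v\<close> with \<open>\<langle>\<phi>, v\<rangle> = 1\<close>. It takes values in a closed
  affine hyperplane, a translate of the orthogonal complement of \<open>\<phi>\<close>; a map into it is smooth
  iff it is smooth as a map into the whole Hilbert space.\<close>

definition proj_chart_dom :: "'h::complex_hilbert \<Rightarrow> 'h set set" where
  "proj_chart_dom \<phi> = ray ` {v. cinner \<phi> v \<noteq> 0}"

definition proj_chart :: "'h::complex_hilbert \<Rightarrow> 'h set \<Rightarrow> 'h" where
  "proj_chart \<phi> L = (THE v. v \<in> L \<and> cinner \<phi> v = 1)"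

definition smooth_into_proj ::
    "('a, 'e::locally_convex_space) mfd \<Rightarrow> ('a \<Rightarrow> 'h::complex_hilbert set) \<Rightarrow> bool" where
  "smooth_into_proj M f \<longleftrightarrow> continuous_map (mtop M) proj_topology f \<and>
     (\<forall>c\<in>atlas M. \<forall>\<phi>. \<phi> \<noteq> 0 \<longrightarrow>
        mb_smooth_on (snd c ` {x \<in> fst c. f x \<in> proj_chart_dom \<phi>})
          (proj_chart \<phi> \<circ> f \<circ> chart_inv c))"


section \<open>Projective unitary representations\<close>

definition unitary :: "('h::complex_hilbert \<Rightarrow> 'h) \<Rightarrow> bool" where
  "unitary U \<longleftrightarrow> (\<forall>x y. U (x + y) = U x + U y) \<and> (\<forall>a x. U (scaleC a x) = scaleC a (U x)) \<and>
     (\<forall>x y. cinner (U x) (U y) = cinner x y) \<and> surj U"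

definition unitary_group :: "('h::complex_hilbert \<Rightarrow> 'h) monoid" where
  "unitary_group = \<lparr>carrier = Collect unitary, mult = (\<circ>), one = id\<rparr>"

definition phases :: "('h::complex_hilbert \<Rightarrow> 'h) set" where
  "phases = {scaleC z | z. cmod z = 1}"

definition projective_unitary_group :: "('h::complex_hilbert \<Rightarrow> 'h) set monoid" where
  "projective_unitary_group = unitary_group Mod phases"

definition proj_act :: "('h \<Rightarrow> 'h) set \<Rightarrow> 'h set \<Rightarrow> 'h set" where
  "proj_act C L = (\<Union>U\<in>C. U ` L)"

definition smooth_rays ::
    "('g, 'e::locally_convex_space) mfd \<Rightarrow> ('g \<Rightarrow> ('h::complex_hilbert \<Rightarrow> 'h) set) \<Rightarrow> 'h set set" where
  "smooth_rays M \<rho> =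
     {L \<in> projectivization UNIV. smooth_into_proj M (\<lambda>g. proj_act (\<rho> g) L)}"

definition smooth_projective_rep ::
    "'g monoid \<Rightarrow> ('g, 'e::locally_convex_space) mfd \<Rightarrow>
     ('g \<Rightarrow> ('h::complex_hilbert \<Rightarrow> 'h) set) \<Rightarrow> bool" where
  "smooth_projective_rep G M \<rho> \<longleftrightarrow> \<rho> \<in> hom G projective_unitary_group \<and>
     proj_topology closure_of smooth_rays M \<rho> = topspace proj_topology"


section \<open>The central extension\<close>

text \<open>Elements are pairs \<open>(g, U)\<close>; the associated unitary representation is \<open>snd\<close>.\<close>

definition sharp_group ::
    "'g monoid \<Rightarrow> ('g \<Rightarrow> ('h::complex_hilbert \<Rightarrow> 'h) set) \<Rightarrow> ('g \<times> ('h \<Rightarrow> 'h)) monoid" where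
  "sharp_group G \<rho> = (G \<times>\<times> unitary_group)\<lparr>carrier :=
     {(g, U). g \<in> carrier G \<and> U \<in> carrier unitary_group \<and> \<rho> g = phases #>\<^bsub>unitary_group\<^esub> U}\<rparr>"

definition smooth_vectors ::
    "('g \<times> ('h::complex_hilbert \<Rightarrow> 'h), 'f::locally_convex_space) mfd \<Rightarrow> 'h set" where
  "smooth_vectors S = {\<psi>. smooth_map S vector_mfd (\<lambda>x. snd x \<psi>)}"

definition principal_circle_bundle ::
    "('p, 'f::locally_convex_space) mfd \<Rightarrow> ('b, 'e::locally_convex_space) mfd \<Rightarrow>
     ('p \<Rightarrow> 'b) \<Rightarrow> (complex \<Rightarrow> 'p \<Rightarrow> 'p) \<Rightarrow> bool" where
  "principal_circle_bundle P M \<pi> act \<longleftrightarrow>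
     smooth_map P M \<pi> \<and>
     smooth_map (prod_mfd circle_mfd P) P (\<lambda>(z, x). act z x) \<and>
     (\<forall>x\<in>topspace (mtop P). act 1 x = x \<and>
        (\<forall>z\<in>sphere 0 1. \<pi> (act z x) = \<pi> x \<and>
           (\<forall>w\<in>sphere 0 1. act (z * w) x = act z (act w x)))) \<and>
     (\<forall>m\<in>topspace (mtop M). \<exists>V \<theta>. openin (mtop M) V \<and> m \<in> V \<and>
        diffeomorphism (open_submfd P {x \<in> topspace (mtop P). \<pi> x \<in> V})
          (prod_mfd (open_submfd M V) circle_mfd) (\<lambda>x. (\<pi> x, \<theta> x)) \<and>
        (\<forall>z\<in>sphere 0 1. \<forall>x\<in>topspace (mtop P). \<pi> x \<in> V \<longrightarrow> \<theta> (act z x) = z * \<theta> x))"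

text \<open>The canonical Lie group structure of the central extension, given by its known properties.
  These determine it uniquely: for a smooth vector \<open>\<psi>\<close> the phase of \<open>\<langle>\<psi>, U \<psi>\<rangle>\<close> is smooth and
  equivariant where \<open>\<langle>\<psi>, U \<psi>\<rangle> \<noteq> 0\<close>, and thus gives a local trivialization of the bundle.\<close>

definition sharp_structure ::
    "'g monoid \<Rightarrow> ('g, 'e::locally_convex_space) mfd \<Rightarrow>
     ('g \<Rightarrow> ('h::complex_hilbert \<Rightarrow> 'h) set) \<Rightarrow>
     ('g \<times> ('h \<Rightarrow> 'h), 'f::locally_convex_space) mfd \<Rightarrow> bool" where
  "sharp_structure G M \<rho> S \<longleftrightarrow>
     lie_group (sharp_group G \<rho>) S \<and>
     lie_group_hom (sharp_group G \<rho>) S G M fst \<and>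
     principal_circle_bundle S M fst (\<lambda>z (g, U). (g, scaleC z \<circ> U)) \<and>
     closure (smooth_vectors S) = UNIV \<and>
     projectivization (smooth_vectors S) = smooth_rays M \<rho>"

definition derived_rep ::
    "'g monoid \<Rightarrow> ('g \<Rightarrow> ('h::complex_hilbert \<Rightarrow> 'h) set) \<Rightarrow>
     ('g \<times> ('h \<Rightarrow> 'h), 'f::locally_convex_space) mfd \<Rightarrow>
     (('g \<times> ('h \<Rightarrow> 'h), 'f) chart \<Rightarrow> 'f) \<Rightarrow> 'h \<Rightarrow> 'h" where
  "derived_rep G \<rho> S \<xi> \<psi> = tangent_deriv S (\<lambda>x. snd x \<psi>) \<one>\<^bsub>sharp_group G \<rho>\<^esub> \<xi>"

definition momentum ::
    "'g monoid \<Rightarrow> ('g \<Rightarrow> ('h::complex_hilbert \<Rightarrow> 'h) set) \<Rightarrow>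
     ('g \<times> ('h \<Rightarrow> 'h), 'f::locally_convex_space) mfd \<Rightarrow> 'h \<Rightarrow>
     (('g \<times> ('h \<Rightarrow> 'h), 'f) chart \<Rightarrow> 'f) \<Rightarrow> complex" where
  "momentum G \<rho> S \<psi> \<xi> = cinner \<psi> (scaleC \<i> (derived_rep G \<rho> S \<xi> \<psi>)) / cinner \<psi> \<psi>"

definition stabilizer_algebra ::
    "'g monoid \<Rightarrow> ('g \<Rightarrow> ('h::complex_hilbert \<Rightarrow> 'h) set) \<Rightarrow>
     ('g \<times> ('h \<Rightarrow> 'h), 'f::locally_convex_space) mfd \<Rightarrow> 'h \<Rightarrow>
     (('g \<times> ('h \<Rightarrow> 'h), 'f) chart \<Rightarrow> 'f) set" where
  "stabilizer_algebra G \<rho> S \<psi> = {\<xi> \<in> lcarrier (lie_algebra (sharp_group G \<rho>) S).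
     \<exists>r::real. derived_rep G \<rho> S \<xi> \<psi> = scaleC (\<i> * complex_of_real r) \<psi>}"

definition stabilizer_group ::
    "'g monoid \<Rightarrow> ('g \<Rightarrow> ('h::complex_hilbert \<Rightarrow> 'h) set) \<Rightarrow> 'h \<Rightarrow> ('g \<times> ('h \<Rightarrow> 'h)) set" where
  "stabilizer_group G \<rho> \<psi> = {x \<in> carrier (sharp_group G \<rho>). ray (snd x \<psi>) = ray \<psi>}"

text \<open>The tangent space of the unit circle at \<open>1\<close> is identified with the imaginary axis by
  differentiating characters as complex-valued functions.\<close>

definition integrates_to_character ::
    "'a monoid \<Rightarrow> ('a, 'e::locally_convex_space) mfd \<Rightarrow> ((('a, 'e) chart \<Rightarrow> 'e) \<Rightarrow> complex) \<Rightarrow>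
     'a set \<Rightarrow> ('a, 'k::locally_convex_space) mfd \<Rightarrow> bool" where
  "integrates_to_character G M f H N \<longleftrightarrow>
     (\<exists>\<kappa>. lie_group_hom (G\<lparr>carrier := H\<rparr>) N circle_group circle_mfd \<kappa> \<and>
        (\<forall>\<xi>\<in>tangent_space N \<one>\<^bsub>G\<^esub>.
           tangent_deriv N \<kappa> \<one>\<^bsub>G\<^esub> \<xi> = f (tangent_map N M id \<one>\<^bsub>G\<^esub> \<xi>)))"

end

theory Submission
  imports Defs
begin

text \<open>
  Write \<open>F(g) = \<rho>(g)\<psi>\<close>, a smooth map into the Hilbert space. Since \<open>\<rho>\<close> is a homomorphism, the
  left-invariant field \<open>X\<^sub>\<xi>\<close> satisfies \<open>dF(X\<^sub>\<xi>)(g) = \<rho>(g) d\<rho>(\<xi>)\<psi>\<close>. If \<open>d\<rho>(\<xi>)\<psi> = a\<psi>\<close> and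
  \<open>d\<rho>(\<eta>)\<psi> = b\<psi>\<close>, then \<open>F\<close> is an eigenfunction of both fields, so by the symmetry of second
  derivatives \<open>d\<rho>([\<xi>, \<eta>])\<psi> = (ba - ab)\<psi> = 0\<close>. Unitarity makes \<open>\<langle>\<psi>, d\<rho>(\<xi>)\<psi>\<rangle>\<close> imaginary. On a
  subgroup \<open>H\<close> of the stabilizer, \<open>\<rho>(h)\<psi> = \<kappa>(h)\<psi>\<close> with \<open>\<kappa>(h) = \<langle>\<psi>, \<rho>(h)\<psi>\<rangle> / \<langle>\<psi>, \<psi>\<rangle>\<close>, and
  \<open>\<kappa>\<close> is the required character.

  The Michal--Bastiani calculus in locally convex spaces needs no Hahn--Banach theorem: everything
  rests on the mean value theorem that a difference quotient of a curve lies in every open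
  convex set containing all its derivatives.
\<close>

section \<open>Calculus in locally convex spaces\<close>

text \<open>The two factors of \<i> in \<open>- \<i> * momentum G \<rho> S \<psi> \<xi>\<close>
  cancel, leaving L applied to the derived vector, where L v = <\<psi>, v> / <\<psi>, \<psi>> is
  bounded linear with L \<psi> = 1. The infinitesimal character is L after the derived
  representation, the group character is L after the orbit map, and differentiation commutes with L.
  The obstacle is analytic. The model spaces carry no norm, so there is no operator norm and no
  uniform remainder estimate; a k-th derivative is only a jointly continuous function of a point and
  k directions. Chain rule and symmetry come from difference quotients whose base point and
  directions move with t (\<open>iter_deriv_slope\<close>). Compositions must be smooth to all
  orders, because the character is smooth on H only through the inclusion and reaches the charts of
  the circle only through \<open>Arg\<close>. Brackets are defined chart by chart, so closure of the
  stabilizer algebra also requires that a bracket is a tangent vector. One identity,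
  \<open>dir_deriv_commutator\<close>, serves twice: with a chart change it gives this, with the
  orbit map it gives the vanishing of the derived bracket.\<close>

lemma lc_tendsto_scaleR:
  fixes g :: "'x \<Rightarrow> 'c::locally_convex_space"
  assumes "(f \<longlongrightarrow> s) F" "(g \<longlongrightarrow> c) F"
  shows "((\<lambda>x. f x *\<^sub>R g x) \<longlongrightarrow> s *\<^sub>R c) F"
  using filterlim_compose[OF tendsto_scaleR_Pair filterlim_Pair[OF assms]] by simp

text \<open>Sequences of directions carry the product topology; this splits joint continuity in them
  into limits of the single directions.\<close>

lemma tendsto_fun_iff:
  fixes f :: "'x \<Rightarrow> 'i \<Rightarrow> 'c::topological_space"
  shows "(f \<longlongrightarrow> l) F \<longleftrightarrow> (\<forall>i. ((\<lambda>x. f x i) \<longlongrightarrow> l i) F)"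
  using limitin_componentwise[of "\<lambda>_. euclidean" "UNIV :: 'i set" f l F]
  by (auto simp: euclidean_product_topology[symmetric] simp flip: limitin_canonical_iff)

text \<open>The point where local convexity enters: convex neighbourhoods suffice for testing a
  limit, and those are the sets to which the mean value theorem applies.\<close>

lemma tendsto_locally_convexI:
  fixes f :: "'x \<Rightarrow> 'c::locally_convex_space"
  assumes "\<And>W. open W \<Longrightarrow> convex W \<Longrightarrow> l \<in> W \<Longrightarrow> eventually (\<lambda>x. f x \<in> W) F"
  shows "(f \<longlongrightarrow> l) F"
proof (rule topological_tendstoI)
  fix U assume "open U" "l \<in> U"
  then obtain W where "open W" "convex W" "l \<in> W" "W \<subseteq> U"
    using locally_convex_convex by blast
  then show "eventually (\<lambda>x. f x \<in> U) F"
    using assms[of W] by (auto elim: eventually_mono)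
qed

section \<open>Elementary rules for directional derivatives\<close>

lemma has_dir_deriv_unique:
  assumes "has_dir_deriv f x v w" "has_dir_deriv f x v w'"
  shows "w = w'"
  using assms tendsto_unique[of "at (0::real)"] unfolding has_dir_deriv_def by fastforce

lemma dir_deriv_eqI: "has_dir_deriv f x v w \<Longrightarrow> dir_deriv f x v = w"
  unfolding dir_deriv_def using has_dir_deriv_unique by blast

lemma eventually_line:
  fixes x :: "'e::locally_convex_space"
  assumes "open S" "x \<in> S"
  shows "eventually (\<lambda>t::real. x + t *\<^sub>R v \<in> S) (at 0)"
proof -
  have "((\<lambda>t::real. x + t *\<^sub>R v) \<longlongrightarrow> x + 0 *\<^sub>R v) (at 0)"
    by (intro tendsto_add tendsto_const lc_tendsto_scaleR tendsto_ident_at)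
  then show ?thesis using assms by (auto dest: topological_tendstoD)
qed

lemma has_dir_deriv_cong:
  assumes "open S" "x \<in> S" "\<And>y. y \<in> S \<Longrightarrow> f y = g y"
  shows "has_dir_deriv f x v w \<longleftrightarrow> has_dir_deriv g x v w"
  unfolding has_dir_deriv_def
proof (rule filterlim_cong[OF refl refl])
  show "\<forall>\<^sub>F t::real in at 0. (f (x + t *\<^sub>R v) - f x) /\<^sub>R t = (g (x + t *\<^sub>R v) - g x) /\<^sub>R t"
    using eventually_line[OF assms(1,2), of v] by eventually_elim (use assms in simp)
qed

lemma dir_deriv_cong:
  assumes "open S" "x \<in> S" "\<And>y. y \<in> S \<Longrightarrow> f y = g y"
  shows "dir_deriv f x v = dir_deriv g x v"
proof -
  have "has_dir_deriv f x v = has_dir_deriv g x v"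
    by (intro ext has_dir_deriv_cong[OF assms])
  then show ?thesis by (simp add: dir_deriv_def)
qed

lemma iter_deriv_cong:
  assumes "open S" "\<And>y. y \<in> S \<Longrightarrow> f y = g y" "x \<in> S"
  shows "iter_deriv k f v x = iter_deriv k g v x"
  using assms(3) by (induction k arbitrary: x) (auto simp: assms(2) intro!: dir_deriv_cong[OF assms(1)])

lemma iter_deriv_cong_dirs:
  assumes "\<And>i. i < k \<Longrightarrow> v i = w i"
  shows "iter_deriv k f v = iter_deriv k f w"
  using assms by (induction k) auto

lemma has_dir_deriv_zero: "has_dir_deriv f x 0 0"
  unfolding has_dir_deriv_def by simp

lemma has_dir_deriv_const: "has_dir_deriv (\<lambda>_. c) x v 0"
  unfolding has_dir_deriv_def by simp

lemma has_dir_deriv_add: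
  assumes "has_dir_deriv f x v a" "has_dir_deriv g x v b"
  shows "has_dir_deriv (\<lambda>x. f x + g x) x v (a + b)"
  using tendsto_add[OF assms[unfolded has_dir_deriv_def]]
  unfolding has_dir_deriv_def by (simp add: algebra_simps)

lemma has_dir_deriv_sum_list:
  assumes "\<And>a. a \<in> set L \<Longrightarrow> has_dir_deriv (f a) x v (f' a)"
  shows "has_dir_deriv (\<lambda>x. \<Sum>a\<leftarrow>L. f a x) x v (\<Sum>a\<leftarrow>L. f' a)"
  using assms
proof (induction L)
  case Nil then show ?case by (simp add: has_dir_deriv_const)
next
  case (Cons a L)
  then show ?case using has_dir_deriv_add[of "f a" x v "f' a"] by simp
qed

lemma has_dir_deriv_scaleR_dir:
  assumes "has_dir_deriv f x v w"
  shows "has_dir_deriv f x (c *\<^sub>R v) (c *\<^sub>R w)"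
proof (cases "c = 0")
  case True then show ?thesis by (simp add: has_dir_deriv_zero)
next
  case False
  have "filterlim (\<lambda>t::real. t * c) (at 0) (at 0)"
    using False by (auto simp: filterlim_at eventually_at_filter intro!: tendsto_eq_intros)
  from filterlim_compose[OF assms[unfolded has_dir_deriv_def] this]
  have "((\<lambda>t. c *\<^sub>R ((f (x + (t * c) *\<^sub>R v) - f x) /\<^sub>R (t * c))) \<longlongrightarrow> c *\<^sub>R w) (at 0)"
    by (intro lc_tendsto_scaleR tendsto_const)
  then show ?thesis
    unfolding has_dir_deriv_def using False by (simp add: field_simps)
qed

lemma has_dir_deriv_compose_linear:
  fixes L :: "'f::real_normed_vector \<Rightarrow> 'h::real_normed_vector"
  assumes "bounded_linear L" "has_dir_deriv f x v w"
  shows "has_dir_deriv (\<lambda>x. L (f x)) x v (L w)"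
proof -
  interpret bounded_linear L by fact
  show ?thesis
    using tendsto[OF assms(2)[unfolded has_dir_deriv_def]]
    unfolding has_dir_deriv_def by (simp add: scaleR diff)
qed

lemma tendsto_of_slope:
  assumes "((\<lambda>t::real. (c t - y) /\<^sub>R t) \<longlongrightarrow> w) (at 0)"
  shows "(c \<longlongrightarrow> (y::'f::locally_convex_space)) (at 0)"
proof -
  have "((\<lambda>t. y + t *\<^sub>R ((c t - y) /\<^sub>R t)) \<longlongrightarrow> y + 0 *\<^sub>R w) (at 0)"
    by (intro tendsto_add tendsto_const lc_tendsto_scaleR tendsto_ident_at assms)
  moreover have "\<forall>\<^sub>F t::real in at 0. y + t *\<^sub>R ((c t - y) /\<^sub>R t) = c t"
    by (auto simp: eventually_at_filter)
  ultimately show ?thesis using filterlim_cong[OF refl refl] by fastforce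
qed

lemma has_dir_deriv_tendsto:
  "has_dir_deriv f x v w \<Longrightarrow> ((\<lambda>t. f (x + t *\<^sub>R v)) \<longlongrightarrow> f x) (at 0)"
  unfolding has_dir_deriv_def by (rule tendsto_of_slope)

section \<open>Mean value theorem and uniform limits of difference quotients\<close>

text \<open>The slope over [a, d] is the convex combination of the slopes over [a, b] and [b, d]
  weighted by the lengths of the two intervals.\<close>

lemma convex_slope_trans:
  fixes c :: "real \<Rightarrow> 'f::real_vector"
  assumes "convex W" "a < b" "b < d" "(c b - c a) /\<^sub>R (b - a) \<in> W" "(c d - c b) /\<^sub>R (d - b) \<in> W"
  shows "(c d - c a) /\<^sub>R (d - a) \<in> W"
proof -
  have "((b - a) / (d - a)) *\<^sub>R ((c b - c a) /\<^sub>R (b - a)) +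
        ((d - b) / (d - a)) *\<^sub>R ((c d - c b) /\<^sub>R (d - b)) \<in> W"
    using assms by (intro convexD[OF assms(1)]) (auto simp: divide_simps)
  also have "((b - a) / (d - a)) *\<^sub>R ((c b - c a) /\<^sub>R (b - a)) +
        ((d - b) / (d - a)) *\<^sub>R ((c d - c b) /\<^sub>R (d - b)) =
        (c b - c a) /\<^sub>R (d - a) + (c d - c b) /\<^sub>R (d - a)"
    using assms(2,3) by (simp add: field_simps)
  also have "\<dots> = (c d - c a) /\<^sub>R (d - a)"
    by (simp flip: scaleR_add_right)
  finally show ?thesis .
qed

text \<open>Bisection: having a slope in W is inherited by concatenated intervals, by convexity, and
  holds on all short intervals around a point s, because W is open and contains the derivative at s.
  An interval around s is split at s, so that only slopes with one endpoint s occur.\<close>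

lemma mean_value_convex:
  fixes c :: "real \<Rightarrow> 'f::locally_convex_space"
  assumes W: "open W" "convex W" and "a < b"
    and D: "\<And>s. a \<le> s \<Longrightarrow> s \<le> b \<Longrightarrow> ((\<lambda>t. (c t - c s) /\<^sub>R (t - s)) \<longlongrightarrow> D s) (at s) \<and> D s \<in> W"
  shows "(c b - c a) /\<^sub>R (b - a) \<in> W"
proof -
  have swap: "(c p - c q) /\<^sub>R (p - q) = (c q - c p) /\<^sub>R (q - p)" for p q
  proof -
    have "inverse (p - q) = - inverse (q - p)"
      by (metis inverse_minus_eq minus_diff_eq)
    then show ?thesis by (simp add: scaleR_diff_right)
  qed
  have "a \<le> b" using \<open>a < b\<close> by simp
  then have "a < b \<longrightarrow> (c b - c a) /\<^sub>R (b - a) \<in> W"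
  proof (induction rule: Bolzano)
    case (trans p q r)
    then show ?case using convex_slope_trans[OF W(2), of p q r c] by (cases "p = q \<or> q = r") auto
  next
    case (local s)
    then have "\<forall>\<^sub>F t in at s. (c t - c s) /\<^sub>R (t - s) \<in> W"
      using D[of s] W(1) by (auto dest: topological_tendstoD)
    then obtain d where d: "d > 0" "\<And>t. t \<noteq> s \<Longrightarrow> dist t s < d \<Longrightarrow> (c t - c s) /\<^sub>R (t - s) \<in> W"
      by (auto simp: eventually_at)
    show ?case
    proof (intro exI[of _ d] conjI d(1) allI impI)
      fix p q assume *: "p \<le> s \<and> s \<le> q \<and> q - p < d" "p < q"
      have 1: "(c s - c p) /\<^sub>R (s - p) \<in> W" if "p \<noteq> s"
        using d(2)[of p] that * swap[of s p] by (auto simp: dist_real_def)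
      have 2: "(c q - c s) /\<^sub>R (q - s) \<in> W" if "q \<noteq> s"
        using d(2)[of q] that * by (auto simp: dist_real_def)
      show "(c q - c p) /\<^sub>R (q - p) \<in> W"
        using 1 2 * convex_slope_trans[OF W(2), of p s q c] by (cases "p = s"; cases "q = s") auto
    qed
  qed
  then show ?thesis using \<open>a < b\<close> by simp
qed

text \<open>Asking for the derivative on the symmetric segment |s| \<le> |t| lets one statement
  cover both signs of t.\<close>

lemma mean_value_dir:
  fixes g :: "'e::locally_convex_space \<Rightarrow> 'f::locally_convex_space"
  assumes W: "open W" "convex W" and "t \<noteq> 0"
    and D: "\<And>s. \<bar>s\<bar> \<le> \<bar>t\<bar> \<Longrightarrow> has_dir_deriv g (y + s *\<^sub>R q) q (D s) \<and> D s \<in> W"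
  shows "(g (y + t *\<^sub>R q) - g y) /\<^sub>R t \<in> W"
proof -
  define c where "c s = g (y + s *\<^sub>R q)" for s
  have lim: "((\<lambda>r. (c r - c s) /\<^sub>R (r - s)) \<longlongrightarrow> D s) (at s) \<and> D s \<in> W" if s: "\<bar>s\<bar> \<le> \<bar>t\<bar>" for s
  proof -
    have "filterlim (\<lambda>r. r - s) (at 0) (at s)"
      by (auto simp: filterlim_at eventually_at_filter intro!: tendsto_eq_intros)
    from filterlim_compose[OF D[OF s, THEN conjunct1, unfolded has_dir_deriv_def] this]
    have "((\<lambda>r. (g (y + s *\<^sub>R q + (r - s) *\<^sub>R q) - g (y + s *\<^sub>R q)) /\<^sub>R (r - s)) \<longlongrightarrow> D s) (at s)" .
    then show ?thesis using D[OF s] by (simp add: c_def algebra_simps)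
  qed
  show ?thesis
  proof (cases "t > 0")
    case True
    have "(c t - c 0) /\<^sub>R (t - 0) \<in> W"
      by (rule mean_value_convex[OF W True lim]) auto
    then show ?thesis by (simp add: c_def)
  next
    case False
    then have "t < 0" using \<open>t \<noteq> 0\<close> by simp
    have "(c 0 - c t) /\<^sub>R (0 - t) \<in> W"
      by (rule mean_value_convex[OF W \<open>t < 0\<close> lim]) (use False in auto)
    then show ?thesis by (simp add: c_def scaleR_diff_right)
  qed
qed

lemma eventually_between:
  assumes "\<And>\<sigma>. (\<And>t. \<bar>\<sigma> t\<bar> \<le> \<bar>t\<bar>) \<Longrightarrow> \<forall>\<^sub>F t in F. P t (\<sigma> t)"
  shows "\<forall>\<^sub>F t::real in F. \<forall>s::real. \<bar>s\<bar> \<le> \<bar>t\<bar> \<longrightarrow> P t s"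
proof -
  \<comment> \<open>For each t this picks a counterexample s if there is one and 0 otherwise, so if
    P holds along this single function then it holds on the whole segment.\<close>
  define \<sigma> where "\<sigma> t = (if \<exists>s. \<bar>s\<bar> \<le> \<bar>t\<bar> \<and> \<not> P t s then SOME s. \<bar>s\<bar> \<le> \<bar>t\<bar> \<and> \<not> P t s else 0)" for t
  have \<sigma>: "\<bar>\<sigma> t\<bar> \<le> \<bar>t\<bar> \<and> ((\<exists>s. \<bar>s\<bar> \<le> \<bar>t\<bar> \<and> \<not> P t s) \<longrightarrow> \<not> P t (\<sigma> t))" for t
  proof (cases "\<exists>s. \<bar>s\<bar> \<le> \<bar>t\<bar> \<and> \<not> P t s")
    case True
    from someI_ex[OF this] True show ?thesis by (simp add: \<sigma>_def)
  next
    case False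
    then have "\<sigma> t = 0" unfolding \<sigma>_def by (rule if_not_P)
    with False show ?thesis by auto
  qed
  from assms[of \<sigma>] \<sigma> have "\<forall>\<^sub>F t in F. P t (\<sigma> t)" by blast
  then show ?thesis by eventually_elim (use \<sigma> in blast)
qed

lemma tendsto_zero_between:
  assumes "\<And>t. \<bar>\<sigma> t\<bar> \<le> \<bar>t::real\<bar>"
  shows "(\<sigma> \<longlongrightarrow> (0::real)) (at 0)"
  by (rule tendsto_rabs_zero_cancel, rule tendsto_sandwich[where f = "\<lambda>_. 0" and h = abs])
     (use assms in \<open>auto intro!: tendsto_eq_intros\<close>)

text \<open>Testing along all functions \<open>\<sigma>\<close> with \<open>\<bar>\<sigma> t\<bar> \<le> \<bar>t\<bar>\<close> expresses uniformity over the segment of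
  length \<open>t\<close> by limits along one-parameter curves only.\<close>

lemma slope_tendsto:
  fixes h :: "real \<Rightarrow> 'e::locally_convex_space \<Rightarrow> 'f::locally_convex_space"
  assumes dd: "\<And>\<sigma>. (\<And>t. \<bar>\<sigma> t\<bar> \<le> \<bar>t\<bar>) \<Longrightarrow>
      \<forall>\<^sub>F t in at 0. has_dir_deriv (h t) (y t + \<sigma> t *\<^sub>R q t) (q t) (D t (\<sigma> t))"
    and lim: "\<And>\<sigma>. (\<And>t. \<bar>\<sigma> t\<bar> \<le> \<bar>t\<bar>) \<Longrightarrow> ((\<lambda>t. D t (\<sigma> t)) \<longlongrightarrow> w) (at 0)"
  shows "((\<lambda>t. (h t (y t + t *\<^sub>R q t) - h t (y t)) /\<^sub>R t) \<longlongrightarrow> w) (at 0)"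
proof (rule tendsto_locally_convexI)
  fix W assume W: "open W" "convex W" "w \<in> W"
  have "\<forall>\<^sub>F t in at 0. \<forall>s. \<bar>s\<bar> \<le> \<bar>t\<bar> \<longrightarrow> has_dir_deriv (h t) (y t + s *\<^sub>R q t) (q t) (D t s) \<and> D t s \<in> W"
  proof (rule eventually_between)
    fix \<sigma> :: "real \<Rightarrow> real" assume \<sigma>: "\<And>t. \<bar>\<sigma> t\<bar> \<le> \<bar>t\<bar>"
    show "\<forall>\<^sub>F t in at 0. has_dir_deriv (h t) (y t + \<sigma> t *\<^sub>R q t) (q t) (D t (\<sigma> t)) \<and> D t (\<sigma> t) \<in> W"
      using dd[of \<sigma>, OF \<sigma>] topological_tendstoD[OF lim[of \<sigma>, OF \<sigma>] W(1,3)]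
      by eventually_elim simp
  qed
  moreover have "\<forall>\<^sub>F t::real in at 0. t \<noteq> 0"
    by (auto simp: eventually_at_filter)
  ultimately show "\<forall>\<^sub>F t in at 0. (h t (y t + t *\<^sub>R q t) - h t (y t)) /\<^sub>R t \<in> W"
  proof eventually_elim
    case (elim t)
    then show ?case by (intro mean_value_dir[OF W(1,2), where D = "D t"]) simp_all
  qed
qed

lemma has_dir_deriv_scaleR:
  assumes "has_dir_deriv f x v w"
  shows "has_dir_deriv (\<lambda>x. c *\<^sub>R f x) x v (c *\<^sub>R w)"
  using lc_tendsto_scaleR[OF tendsto_const[of c] assms[unfolded has_dir_deriv_def]]
  unfolding has_dir_deriv_def by (simp add: scaleR_diff_right mult.commute)

lemma has_dir_deriv_shift:
  assumes "has_dir_deriv f (x + a) v w"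
  shows "has_dir_deriv (\<lambda>x. f (x + a)) x v w"
  using assms unfolding has_dir_deriv_def by (simp add: algebra_simps)

section \<open>Smooth maps: locality, joint continuity and moving difference quotients\<close>

lemma mb_smooth_on_cong:
  assumes "open S" "\<And>y. y \<in> S \<Longrightarrow> f y = g y"
  shows "mb_smooth_on S f \<longleftrightarrow> mb_smooth_on S g"
proof -
  have *: "iter_deriv k f v y = iter_deriv k g v y" if "y \<in> S" for k v y
    by (rule iter_deriv_cong[OF assms that])
  show ?thesis
    unfolding mb_smooth_on_def
    by (intro all_cong1 conj_cong ball_cong refl ex_cong1 has_dir_deriv_cong[OF assms(1)]
        continuous_on_cong) (auto simp: *)
qed

lemma mb_smooth_on_subset: "mb_smooth_on S f \<Longrightarrow> T \<subseteq> S \<Longrightarrow> mb_smooth_on T f"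
  unfolding mb_smooth_on_def by (blast intro: continuous_on_subset)

text \<open>\<open>iter_deriv k g v\<close> does not look at \<open>v k\<close>, so this entry can
  be overwritten by the new direction q. In this form the derivative is available for any q,
  independently of v.\<close>

lemma mb_smooth_on_iter_deriv:
  assumes "mb_smooth_on V g" "y \<in> V"
  shows "has_dir_deriv (iter_deriv k g v) y q (iter_deriv (Suc k) g (v(k := q)) y)"
proof -
  obtain w where w: "has_dir_deriv (iter_deriv k g (v(k := q))) y q w"
    using assms unfolding mb_smooth_on_def by (metis fun_upd_same)
  have "iter_deriv k g (v(k := q)) = iter_deriv k g v"
    by (rule iter_deriv_cong_dirs) simp
  with w show ?thesis by (simp add: dir_deriv_eqI)
qed

lemma mb_smooth_on_dir_deriv:
  assumes "mb_smooth_on V g" "y \<in> V"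
  shows "has_dir_deriv g y q (dir_deriv g y q)"
  using mb_smooth_on_iter_deriv[OF assms, of 0 undefined q] by simp

lemma mb_smooth_on_tendsto_nhds:
  fixes g :: "'a::locally_convex_space \<Rightarrow> 'b::locally_convex_space"
  assumes "mb_smooth_on V g" "open V" "y \<in> V"
  shows "((\<lambda>(x, v). iter_deriv k g v x) \<longlongrightarrow> iter_deriv k g w y) (nhds (y, w))"
proof -
  have in_V: "(y, w) \<in> V \<times> UNIV" using assms(3) by simp
  have "open (V \<times> (UNIV :: (nat \<Rightarrow> 'a) set))" by (intro open_Times assms(2) open_UNIV)
  then have at: "at (y, w) within V \<times> UNIV = at (y, w)" by (rule at_within_open[OF in_V])
  have "continuous_on (V \<times> UNIV) (\<lambda>(x, v). iter_deriv k g v x)"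
    using assms(1) unfolding mb_smooth_on_def by blast
  from bspec[OF this[unfolded continuous_on_def] in_V]
  have "((\<lambda>(x, v). iter_deriv k g v x) \<longlongrightarrow> (\<lambda>(x, v). iter_deriv k g v x) (y, w)) (at (y, w))"
    by (simp only: at)
  then show ?thesis
    unfolding tendsto_at_iff_tendsto_nhds by simp
qed

lemma mb_smooth_on_local:
  fixes f :: "'a::locally_convex_space \<Rightarrow> 'b::locally_convex_space"
  assumes "\<And>x. x \<in> S \<Longrightarrow> \<exists>T. open T \<and> x \<in> T \<and> mb_smooth_on T f"
  shows "mb_smooth_on S f"
  unfolding mb_smooth_on_def
proof (intro allI conjI ballI)
  fix k v x assume "x \<in> S"
  then show "\<exists>w. has_dir_deriv (iter_deriv k f v) x (v k) w"
    using assms mb_smooth_on_iter_deriv by blast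
next
  fix k
  show "continuous_on (S \<times> UNIV) (\<lambda>(x, v). iter_deriv k f v x)"
    unfolding continuous_on_def
  proof
    fix p assume "p \<in> S \<times> (UNIV :: (nat \<Rightarrow> 'a) set)"
    then obtain T where "open T" "fst p \<in> T" "mb_smooth_on T f" using assms[of "fst p"] by auto
    then have "((\<lambda>(x, v). iter_deriv k f v x) \<longlongrightarrow> (\<lambda>(x, v). iter_deriv k f v x) p) (nhds p)"
      using mb_smooth_on_tendsto_nhds[of T f "fst p" k "snd p"] by (simp add: case_prod_beta)
    then show "((\<lambda>(x, v). iter_deriv k f v x) \<longlongrightarrow> (\<lambda>(x, v). iter_deriv k f v x) p) (at p within S \<times> UNIV)"
      by (rule tendsto_mono[OF at_within_le_nhds])
  qed
qed

lemma iter_deriv_tendsto: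
  assumes "mb_smooth_on V g" "open V" "y \<in> V" "(Y \<longlongrightarrow> y) F"
    and W: "\<And>i. i < k \<Longrightarrow> ((\<lambda>t. W t i) \<longlongrightarrow> w i) F"
  shows "((\<lambda>t. iter_deriv k g (W t) (Y t)) \<longlongrightarrow> iter_deriv k g w y) F"
proof -
  \<comment> \<open>Entries from k on are frozen at w: nothing is known about their convergence, and
    the k-th derivative ignores them.\<close>
  define W' where "W' t i = (if i < k then W t i else w i)" for t i
  have "(W' \<longlongrightarrow> w) F"
    unfolding tendsto_fun_iff
  proof
    fix i show "((\<lambda>t. W' t i) \<longlongrightarrow> w i) F"
      using W[of i] by (cases "i < k") (simp_all add: W'_def)
  qed
  then have "((\<lambda>t. (Y t, W' t)) \<longlongrightarrow> (y, w)) F"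
    by (rule tendsto_Pair[OF assms(4)])
  from filterlim_compose[OF mb_smooth_on_tendsto_nhds[OF assms(1-3)] this]
  have "((\<lambda>t. iter_deriv k g (W' t) (Y t)) \<longlongrightarrow> iter_deriv k g w y) F" by simp
  moreover have "iter_deriv k g (W' t) = iter_deriv k g (W t)" for t
    by (rule iter_deriv_cong_dirs) (simp add: W'_def)
  ultimately show ?thesis by simp
qed

text \<open>The workhorse of the calculus: base point, increment direction and the k earlier
  directions may all vary with t. By the mean value theorem the quotient is controlled by values of
  the next derivative on the segment, and joint continuity makes these converge. Taking for Q a
  difference quotient of an inner function yields chain rules.\<close>

lemma iter_deriv_slope:
  assumes g: "mb_smooth_on V g" "open V" "y \<in> V" and Y: "(Y \<longlongrightarrow> y) (at 0)"
    and Q: "(Q \<longlongrightarrow> q) (at 0)" and W: "\<And>i. i < k \<Longrightarrow> ((\<lambda>t. W t i) \<longlongrightarrow> w i) (at 0)"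
  shows "((\<lambda>t. (iter_deriv k g (W t) (Y t + t *\<^sub>R Q t) - iter_deriv k g (W t) (Y t)) /\<^sub>R t)
    \<longlongrightarrow> iter_deriv (Suc k) g (w(k := q)) y) (at 0)"
proof (rule slope_tendsto[where D = "\<lambda>t s. iter_deriv (Suc k) g ((W t)(k := Q t)) (Y t + s *\<^sub>R Q t)"])
  fix \<sigma> :: "real \<Rightarrow> real" assume "\<And>t. \<bar>\<sigma> t\<bar> \<le> \<bar>t\<bar>"
  then have "(\<sigma> \<longlongrightarrow> 0) (at 0)" by (rule tendsto_zero_between)
  from tendsto_add[OF Y lc_tendsto_scaleR[OF this Q]]
  have lim: "((\<lambda>t. Y t + \<sigma> t *\<^sub>R Q t) \<longlongrightarrow> y) (at 0)" by simp
  from topological_tendstoD[OF lim g(2,3)]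
  show "\<forall>\<^sub>F t in at 0. has_dir_deriv (iter_deriv k g (W t)) (Y t + \<sigma> t *\<^sub>R Q t) (Q t)
      (iter_deriv (Suc k) g ((W t)(k := Q t)) (Y t + \<sigma> t *\<^sub>R Q t))"
    by eventually_elim (rule mb_smooth_on_iter_deriv[OF g(1)])
  show "((\<lambda>t. iter_deriv (Suc k) g ((W t)(k := Q t)) (Y t + \<sigma> t *\<^sub>R Q t))
      \<longlongrightarrow> iter_deriv (Suc k) g (w(k := q)) y) (at 0)"
    by (rule iter_deriv_tendsto[OF g lim]) (use Q W in auto)
qed

lemma eventually_at_zero_nonzero: "\<forall>\<^sub>F t::real in at 0. t \<noteq> 0"
  by (auto simp: eventually_at_filter)

text \<open>Case k = 0 of \<open>iter_deriv_slope\<close> with Q t the difference quotient of f; for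
  t \<noteq> 0 the point f x + t Q t is exactly f (x + t u).\<close>

lemma has_dir_deriv_chain:
  assumes f: "has_dir_deriv f x u w" and g: "mb_smooth_on V g" "open V" "f x \<in> V"
  shows "has_dir_deriv (\<lambda>x. g (f x)) x u (dir_deriv g (f x) w)"
proof -
  have "((\<lambda>t. (iter_deriv 0 g undefined (f x + t *\<^sub>R ((f (x + t *\<^sub>R u) - f x) /\<^sub>R t)) -
      iter_deriv 0 g undefined (f x)) /\<^sub>R t)
    \<longlongrightarrow> iter_deriv (Suc 0) g (undefined(0 := w)) (f x)) (at 0)"
    by (rule iter_deriv_slope[OF g tendsto_const f[unfolded has_dir_deriv_def]]) simp
  then have "((\<lambda>t. (g (f x + t *\<^sub>R ((f (x + t *\<^sub>R u) - f x) /\<^sub>R t)) - g (f x)) /\<^sub>R t)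
    \<longlongrightarrow> dir_deriv g (f x) w) (at 0)"
    by (simp only: iter_deriv.simps fun_upd_same)
  then show ?thesis
    unfolding has_dir_deriv_def
    by (rule Lim_transform_eventually)
       (use eventually_at_zero_nonzero in \<open>eventually_elim, simp\<close>)
qed

lemma dir_deriv_chain:
  assumes "has_dir_deriv f x u w" "mb_smooth_on V g" "open V" "f x \<in> V"
  shows "dir_deriv (\<lambda>x. g (f x)) x u = dir_deriv g (f x) w"
  by (rule dir_deriv_eqI[OF has_dir_deriv_chain[OF assms]])

section \<open>Multilinearity and symmetry of higher derivatives\<close>

text \<open>In the last direction the increment t (a + b) is made in two stages, through y + t a. In
  an earlier direction the identity holds on the open set V one order lower and can be
  differentiated.\<close>

lemma iter_deriv_add:
  assumes g: "mb_smooth_on V g" "open V" and "y \<in> V" "i < k"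
  shows "iter_deriv k g (v(i := a + b)) y = iter_deriv k g (v(i := a)) y + iter_deriv k g (v(i := b)) y"
  using assms(3,4)
proof (induction k arbitrary: y)
  case (Suc k)
  show ?case
  proof (cases "i = k")
    case True
    have ya: "((\<lambda>t. y + t *\<^sub>R a) \<longlongrightarrow> y + 0 *\<^sub>R a) (at 0)"
      by (intro tendsto_add tendsto_const lc_tendsto_scaleR tendsto_ident_at)
    \<comment> \<open>The second stage starts at the moving point y + t a, which is why a quotient
      with variable base point is needed.\<close>
    have "((\<lambda>t. (iter_deriv k g v ((y + t *\<^sub>R a) + t *\<^sub>R b) - iter_deriv k g v (y + t *\<^sub>R a)) /\<^sub>R t)
       \<longlongrightarrow> iter_deriv (Suc k) g (v(k := b)) y) (at 0)"
      by (rule iter_deriv_slope[OF g Suc.prems(1)]) (use ya in auto)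
    from tendsto_add[OF mb_smooth_on_iter_deriv[OF g(1) Suc.prems(1), of k v a, unfolded has_dir_deriv_def] this]
    have "has_dir_deriv (iter_deriv k g v) y (a + b)
       (iter_deriv (Suc k) g (v(k := a)) y + iter_deriv (Suc k) g (v(k := b)) y)"
      unfolding has_dir_deriv_def by (simp add: algebra_simps)
    with has_dir_deriv_unique mb_smooth_on_iter_deriv[OF g(1) Suc.prems(1)] True
    show ?thesis by blast
  next
    case False
    then have "i < k" using Suc.prems(2) by simp
    have D: "has_dir_deriv (iter_deriv k g (v(i := c))) y (v k) (iter_deriv (Suc k) g (v(i := c)) y)" for c
    proof -
      have "(v(i := c))(k := v k) = v(i := c)" using False by auto
      then show ?thesis
        using mb_smooth_on_iter_deriv[OF g(1) Suc.prems(1), of k "v(i := c)" "v k"] by argo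
    qed
    have "has_dir_deriv (iter_deriv k g (v(i := a + b))) y (v k)
       (iter_deriv (Suc k) g (v(i := a)) y + iter_deriv (Suc k) g (v(i := b)) y)"
      by (subst has_dir_deriv_cong[OF g(2) Suc.prems(1) Suc.IH[OF _ \<open>i < k\<close>]])
         (auto simp del: iter_deriv.simps intro: has_dir_deriv_add D)
    with has_dir_deriv_unique D show ?thesis by blast
  qed
qed simp

lemma iter_deriv_scaleR:
  assumes g: "mb_smooth_on V g" "open V" and "y \<in> V" "i < k"
  shows "iter_deriv k g (v(i := c *\<^sub>R a)) y = c *\<^sub>R iter_deriv k g (v(i := a)) y"
  using assms(3,4)
proof (induction k arbitrary: y)
  case (Suc k)
  show ?case
  proof (cases "i = k")
    case True
    have "has_dir_deriv (iter_deriv k g v) y (c *\<^sub>R a) (c *\<^sub>R iter_deriv (Suc k) g (v(k := a)) y)"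
      by (intro has_dir_deriv_scaleR_dir mb_smooth_on_iter_deriv[OF g(1) Suc.prems(1)])
    with has_dir_deriv_unique mb_smooth_on_iter_deriv[OF g(1) Suc.prems(1)] True
    show ?thesis by blast
  next
    case False
    then have "i < k" using Suc.prems(2) by simp
    have D: "has_dir_deriv (iter_deriv k g (v(i := c))) y (v k) (iter_deriv (Suc k) g (v(i := c)) y)" for c
    proof -
      have "(v(i := c))(k := v k) = v(i := c)" using False by auto
      then show ?thesis
        using mb_smooth_on_iter_deriv[OF g(1) Suc.prems(1), of k "v(i := c)" "v k"] by argo
    qed
    have "has_dir_deriv (iter_deriv k g (v(i := c *\<^sub>R a))) y (v k) (c *\<^sub>R iter_deriv (Suc k) g (v(i := a)) y)"
      by (subst has_dir_deriv_cong[OF g(2) Suc.prems(1) Suc.IH[OF _ \<open>i < k\<close>]])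
         (auto simp del: iter_deriv.simps intro: has_dir_deriv_scaleR D)
    with has_dir_deriv_unique D show ?thesis by blast
  qed
qed simp

lemma iter_deriv_diff:
  assumes g: "mb_smooth_on V g" "open V" and "y \<in> V" "i < k"
  shows "iter_deriv k g (v(i := a - b)) y = iter_deriv k g (v(i := a)) y - iter_deriv k g (v(i := b)) y"
  using iter_deriv_add[OF assms, of v a "(-1) *\<^sub>R b"] iter_deriv_scaleR[OF assms, of v "-1" b] by simp

lemma dir_deriv_add:
  assumes "mb_smooth_on V g" "open V" "y \<in> V"
  shows "dir_deriv g y (a + b) = dir_deriv g y a + dir_deriv g y b"
  using iter_deriv_add[OF assms, of 0 "Suc 0" undefined a b] by simp

lemma dir_deriv_scaleR:
  assumes "mb_smooth_on V g" "open V" "y \<in> V"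
  shows "dir_deriv g y (c *\<^sub>R a) = c *\<^sub>R dir_deriv g y a"
  using iter_deriv_scaleR[OF assms, of 0 "Suc 0" undefined c a] by simp

lemma dir_deriv_diff:
  assumes "mb_smooth_on V g" "open V" "y \<in> V"
  shows "dir_deriv g y (a - b) = dir_deriv g y a - dir_deriv g y b"
  using iter_deriv_diff[OF assms, of 0 "Suc 0" undefined a b] by simp

text \<open>The second difference is symmetric in a and b, while its limit is written with a
  differentiated first; comparing the two orders gives the symmetry of second derivatives.\<close>

lemma second_difference_tendsto:
  assumes g: "mb_smooth_on V g" "open V" "y \<in> V"
  shows "((\<lambda>t. (g (y + t *\<^sub>R a + t *\<^sub>R b) - g (y + t *\<^sub>R a) - g (y + t *\<^sub>R b) + g y) /\<^sub>R t /\<^sub>R t)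
    \<longlongrightarrow> dir_deriv (\<lambda>x. dir_deriv g x a) y b) (at 0)"
proof -
  \<comment> \<open>The second difference over t squared is the slope in direction a of this first
    quotient in direction b. Its derivative along a is a slope of the first derivative of g, which
    \<open>iter_deriv_slope\<close> controls.\<close>
  define h where "h t z = (g (z + t *\<^sub>R b) - g z) /\<^sub>R t" for t z
  have "((\<lambda>t. (h t (y + t *\<^sub>R a) - h t y) /\<^sub>R t) \<longlongrightarrow> dir_deriv (\<lambda>x. dir_deriv g x a) y b) (at 0)"
  proof (rule slope_tendsto[where D = "\<lambda>t s. (dir_deriv g (y + s *\<^sub>R a + t *\<^sub>R b) a - dir_deriv g (y + s *\<^sub>R a) a) /\<^sub>R t"])
    fix \<sigma> :: "real \<Rightarrow> real" assume "\<And>t. \<bar>\<sigma> t\<bar> \<le> \<bar>t\<bar>"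
    then have \<sigma>: "(\<sigma> \<longlongrightarrow> 0) (at 0)" by (rule tendsto_zero_between)
    have "((\<lambda>t. y + \<sigma> t *\<^sub>R a) \<longlongrightarrow> y + 0 *\<^sub>R a) (at 0)"
      by (intro tendsto_add tendsto_const lc_tendsto_scaleR \<sigma>)
    then have lim: "((\<lambda>t. y + \<sigma> t *\<^sub>R a) \<longlongrightarrow> y) (at 0)" by simp
    have "((\<lambda>t. (y + \<sigma> t *\<^sub>R a) + t *\<^sub>R b) \<longlongrightarrow> y + 0 *\<^sub>R b) (at 0)"
      by (intro tendsto_add tendsto_const lc_tendsto_scaleR lim tendsto_ident_at)
    then have lim': "((\<lambda>t. y + \<sigma> t *\<^sub>R a + t *\<^sub>R b) \<longlongrightarrow> y) (at 0)" by simp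
    show "\<forall>\<^sub>F t in at 0. has_dir_deriv (h t) (y + \<sigma> t *\<^sub>R a) a
      ((dir_deriv g (y + \<sigma> t *\<^sub>R a + t *\<^sub>R b) a - dir_deriv g (y + \<sigma> t *\<^sub>R a) a) /\<^sub>R t)"
      using topological_tendstoD[OF lim g(2,3)] topological_tendstoD[OF lim' g(2,3)]
    proof eventually_elim
      case (elim t)
      have "has_dir_deriv (\<lambda>z. g (z + t *\<^sub>R b) + (-1) *\<^sub>R g z) (y + \<sigma> t *\<^sub>R a) a
         (dir_deriv g (y + \<sigma> t *\<^sub>R a + t *\<^sub>R b) a + (-1) *\<^sub>R dir_deriv g (y + \<sigma> t *\<^sub>R a) a)"
        by (intro has_dir_deriv_add has_dir_deriv_shift has_dir_deriv_scaleR
            mb_smooth_on_dir_deriv[OF g(1)] elim)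
      from has_dir_deriv_scaleR[OF this, of "inverse t"] show ?case by (simp add: h_def[abs_def])
    qed
    have "((\<lambda>t. (iter_deriv (Suc 0) g (\<lambda>_. a) ((y + \<sigma> t *\<^sub>R a) + t *\<^sub>R b) -
        iter_deriv (Suc 0) g (\<lambda>_. a) (y + \<sigma> t *\<^sub>R a)) /\<^sub>R t)
      \<longlongrightarrow> iter_deriv (Suc (Suc 0)) g ((\<lambda>_. a)(Suc 0 := b)) y) (at 0)"
      by (rule iter_deriv_slope[OF g lim]) auto
    then show "((\<lambda>t. (dir_deriv g (y + \<sigma> t *\<^sub>R a + t *\<^sub>R b) a - dir_deriv g (y + \<sigma> t *\<^sub>R a) a) /\<^sub>R t)
      \<longlongrightarrow> dir_deriv (\<lambda>x. dir_deriv g x a) y b) (at 0)" by simp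
  qed
  then show ?thesis by (simp add: h_def algebra_simps)
qed

lemma dir_deriv_commute:
  assumes "mb_smooth_on V g" "open V" "y \<in> V"
  shows "dir_deriv (\<lambda>x. dir_deriv g x a) y b = dir_deriv (\<lambda>x. dir_deriv g x b) y a"
proof (rule tendsto_unique[OF _ second_difference_tendsto[OF assms]])
  show "((\<lambda>t. (g (y + t *\<^sub>R a + t *\<^sub>R b) - g (y + t *\<^sub>R a) - g (y + t *\<^sub>R b) + g y) /\<^sub>R t /\<^sub>R t)
    \<longlongrightarrow> dir_deriv (\<lambda>x. dir_deriv g x b) y a) (at 0)"
    using second_difference_tendsto[OF assms, of b a] by (simp add: algebra_simps)
qed simp

text \<open>Product and chain rule together: the k-th derivative is k-linear in the directions, so
  changing the base point contributes one term and changing each direction contributes one more.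
  With inner map the identity it differentiates a field of directions; with f general it drives the
  higher chain rule.\<close>

lemma has_dir_deriv_iter_deriv_compose:
  fixes f :: "'e::locally_convex_space \<Rightarrow> 'f::locally_convex_space"
    and g :: "'f \<Rightarrow> 'h::locally_convex_space"
  assumes g: "mb_smooth_on V g" "open V" "f x \<in> V" and f: "has_dir_deriv f x u df"
    and W: "\<And>i. i < k \<Longrightarrow> has_dir_deriv (\<lambda>x. W x i) x u (dW i)"
  shows "has_dir_deriv (\<lambda>x. iter_deriv k g (W x) (f x)) x u
    (iter_deriv (Suc k) g ((W x)(k := df)) (f x) + (\<Sum>i<k. iter_deriv k g ((W x)(i := dW i)) (f x)))"
proof -
  define Q where "Q t = (f (x + t *\<^sub>R u) - f x) /\<^sub>R t" for t
  define U where "U t = W (x + t *\<^sub>R u)" for t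
  \<comment> \<open>Directions below j are already those at x + t u, the others still those at x.
    Consecutive values of j differ in one entry, so multilinearity applies to each step and the
    steps telescope.\<close>
  define mix where "mix t j i = (if i < j then U t i else W x i)" for t and j i :: nat
  have U: "((\<lambda>t. U t i) \<longlongrightarrow> W x i) (at 0)" if "i < k" for i
    unfolding U_def by (rule has_dir_deriv_tendsto[OF W[OF that]])
  have A: "((\<lambda>t. (iter_deriv k g (U t) (f x + t *\<^sub>R Q t) - iter_deriv k g (U t) (f x)) /\<^sub>R t)
    \<longlongrightarrow> iter_deriv (Suc k) g ((W x)(k := df)) (f x)) (at 0)"
    by (rule iter_deriv_slope[OF g tendsto_const _ U])
       (use f in \<open>simp_all add: Q_def has_dir_deriv_def\<close>)
  have B: "((\<lambda>t. (iter_deriv k g (mix t (Suc i)) (f x) - iter_deriv k g (mix t i) (f x)) /\<^sub>R t)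
    \<longlongrightarrow> iter_deriv k g ((W x)(i := dW i)) (f x)) (at 0)" if i: "i < k" for i
  proof -
    have "mix t (Suc i) = (mix t i)(i := U t i)" "mix t i = (mix t i)(i := W x i)" for t
      by (auto simp: mix_def fun_eq_iff)
    then have "(iter_deriv k g (mix t (Suc i)) (f x) - iter_deriv k g (mix t i) (f x)) /\<^sub>R t =
        iter_deriv k g ((mix t i)(i := (U t i - W x i) /\<^sub>R t)) (f x)" for t
      using iter_deriv_diff[OF g i] iter_deriv_scaleR[OF g i] by metis
    moreover have "((\<lambda>t. iter_deriv k g ((mix t i)(i := (U t i - W x i) /\<^sub>R t)) (f x))
      \<longlongrightarrow> iter_deriv k g ((W x)(i := dW i)) (f x)) (at 0)"
    proof (rule iter_deriv_tendsto[OF g tendsto_const])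
      fix j assume "j < k"
      then show "((\<lambda>t. ((mix t i)(i := (U t i - W x i) /\<^sub>R t)) j) \<longlongrightarrow> ((W x)(i := dW i)) j) (at 0)"
        using W[OF i] U[of j] by (cases "j < i") (auto simp: mix_def has_dir_deriv_def U_def)
    qed
    ultimately show ?thesis by simp
  qed
  have "((\<lambda>t. (iter_deriv k g (U t) (f x + t *\<^sub>R Q t) - iter_deriv k g (U t) (f x)) /\<^sub>R t +
      (\<Sum>i<k. (iter_deriv k g (mix t (Suc i)) (f x) - iter_deriv k g (mix t i) (f x)) /\<^sub>R t))
    \<longlongrightarrow> iter_deriv (Suc k) g ((W x)(k := df)) (f x) +
      (\<Sum>i<k. iter_deriv k g ((W x)(i := dW i)) (f x))) (at 0)"
    by (intro tendsto_add A tendsto_sum B) simp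
  then show ?thesis
    unfolding has_dir_deriv_def
  proof (rule Lim_transform_eventually)
    show "\<forall>\<^sub>F t in at 0. (iter_deriv k g (U t) (f x + t *\<^sub>R Q t) - iter_deriv k g (U t) (f x)) /\<^sub>R t +
        (\<Sum>i<k. (iter_deriv k g (mix t (Suc i)) (f x) - iter_deriv k g (mix t i) (f x)) /\<^sub>R t) =
        (iter_deriv k g (W (x + t *\<^sub>R u)) (f (x + t *\<^sub>R u)) - iter_deriv k g (W x) (f x)) /\<^sub>R t"
      using eventually_at_zero_nonzero
    proof eventually_elim
      case (elim t)
      have "(\<Sum>i<k. (iter_deriv k g (mix t (Suc i)) (f x) - iter_deriv k g (mix t i) (f x)) /\<^sub>R t) =
          (iter_deriv k g (mix t k) (f x) - iter_deriv k g (mix t 0) (f x)) /\<^sub>R t"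
        using sum_lessThan_telescope[of "\<lambda>i. iter_deriv k g (mix t i) (f x)" k]
        by (simp only: scaleR_sum_right[symmetric])
      moreover have "iter_deriv k g (mix t k) = iter_deriv k g (U t)"
        by (rule iter_deriv_cong_dirs) (simp add: mix_def)
      moreover have "mix t 0 = W x" by (simp add: mix_def fun_eq_iff)
      moreover have "f x + t *\<^sub>R Q t = f (x + t *\<^sub>R u)" using elim by (simp add: Q_def)
      ultimately show ?case
        by (simp add: U_def flip: scaleR_add_right)
    qed
  qed
qed

section \<open>Composition of smooth maps\<close>

text \<open>Each term of the \<open>k\<close>-th derivative of \<open>g \<circ> f\<close> (Faa di Bruno) is encoded by a list \<open>bs\<close> of
  blocks partitioning \<open>{0..<k}\<close>: the block \<open>bs ! i\<close> lists the directions in which the \<open>i\<close>-th inner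
  factor is differentiated. A further derivative either opens a new block or enlarges an old one.\<close>

definition chain_term ::
    "('f::locally_convex_space \<Rightarrow> 'h::locally_convex_space) \<Rightarrow> ('e::locally_convex_space \<Rightarrow> 'f) \<Rightarrow>
     nat list list \<Rightarrow> (nat \<Rightarrow> 'e) \<Rightarrow> 'e \<Rightarrow> 'h" where
  "chain_term g f bs v x =
     iter_deriv (length bs) g (\<lambda>i. iter_deriv (length (bs ! i)) f (\<lambda>l. v (bs ! i ! l)) x) (f x)"

definition chain_step :: "nat \<Rightarrow> nat list list \<Rightarrow> nat list list list" where
  "chain_step k bs = (bs @ [[k]]) # map (\<lambda>i. bs[i := bs ! i @ [k]]) [0..<length bs]"

primrec chain_terms :: "nat \<Rightarrow> nat list list list" where
  "chain_terms 0 = [[]]"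
| "chain_terms (Suc k) = concat (map (chain_step k) (chain_terms k))"

lemma has_dir_deriv_chain_term:
  assumes f: "mb_smooth_on U f" and g: "mb_smooth_on V g" "open V" and x: "x \<in> U" "f x \<in> V"
  shows "has_dir_deriv (chain_term g f bs v) x (v k) (\<Sum>bs'\<leftarrow>chain_step k bs. chain_term g f bs' v x)"
proof -
  define n where "n = length bs"
  define W where "W x i = iter_deriv (length (bs ! i)) f (\<lambda>l. v (bs ! i ! l)) x" for x i
  define dW where "dW i = iter_deriv (length (bs ! i @ [k])) f (\<lambda>l. v ((bs ! i @ [k]) ! l)) x" for i
  have dW: "has_dir_deriv (\<lambda>x. W x i) x (v k) (dW i)" for i
  proof -
    have "iter_deriv (Suc (length (bs ! i))) f ((\<lambda>l. v (bs ! i ! l))(length (bs ! i) := v k)) =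
        iter_deriv (length (bs ! i @ [k])) f (\<lambda>l. v ((bs ! i @ [k]) ! l))"
      by (simp only: length_append_singleton) (rule iter_deriv_cong_dirs, auto simp: nth_append)
    then show ?thesis
      unfolding W_def dW_def using mb_smooth_on_iter_deriv[OF f x(1)] by metis
  qed
  have "has_dir_deriv (\<lambda>x. iter_deriv n g (W x) (f x)) x (v k)
    (iter_deriv (Suc n) g ((W x)(n := dir_deriv f x (v k))) (f x) +
     (\<Sum>i<n. iter_deriv n g ((W x)(i := dW i)) (f x)))"
    by (rule has_dir_deriv_iter_deriv_compose[OF g x(2) mb_smooth_on_dir_deriv[OF f x(1)] dW])
  moreover have "(\<lambda>x. iter_deriv n g (W x) (f x)) = chain_term g f bs v"
  proof
    have "W x = (\<lambda>i. iter_deriv (length (bs ! i)) f (\<lambda>l. v (bs ! i ! l)) x)" for x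
      by (simp add: W_def fun_eq_iff)
    then show "iter_deriv n g (W x) (f x) = chain_term g f bs v x" for x
      by (simp add: chain_term_def n_def)
  qed
  moreover have "iter_deriv (Suc n) g ((W x)(n := dir_deriv f x (v k))) (f x) =
      chain_term g f (bs @ [[k]]) v x"
  proof -
    have "iter_deriv (Suc n) g ((W x)(n := dir_deriv f x (v k))) =
        iter_deriv (Suc n) g (\<lambda>i. iter_deriv (length ((bs @ [[k]]) ! i)) f (\<lambda>l. v ((bs @ [[k]]) ! i ! l)) x)"
      by (rule iter_deriv_cong_dirs) (auto simp: nth_append W_def n_def)
    then show ?thesis by (simp add: chain_term_def n_def del: iter_deriv.simps)
  qed
  moreover have "iter_deriv n g ((W x)(i := dW i)) (f x) = chain_term g f (bs[i := bs ! i @ [k]]) v x"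
    if "i < n" for i
  proof -
    have "iter_deriv n g ((W x)(i := dW i)) =
        iter_deriv n g (\<lambda>j. iter_deriv (length (bs[i := bs ! i @ [k]] ! j)) f
          (\<lambda>l. v (bs[i := bs ! i @ [k]] ! j ! l)) x)"
      by (rule iter_deriv_cong_dirs) (use that in \<open>auto simp: W_def dW_def n_def nth_list_update\<close>)
    then show ?thesis by (simp add: chain_term_def n_def)
  qed
  ultimately show ?thesis
    by (simp add: chain_step_def n_def comp_def interv_sum_list_conv_sum_set_nat atLeast0LessThan)
qed

lemma iter_deriv_compose:
  assumes U: "open U" and f: "mb_smooth_on U f" and g: "mb_smooth_on V g" "open V"
    and fU: "f ` U \<subseteq> V" and "x \<in> U"
  shows "iter_deriv k (g \<circ> f) v x = (\<Sum>bs\<leftarrow>chain_terms k. chain_term g f bs v x)"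
  using \<open>x \<in> U\<close>
proof (induction k arbitrary: x)
  case (Suc k)
  have "has_dir_deriv (\<lambda>x. \<Sum>bs\<leftarrow>chain_terms k. chain_term g f bs v x) x (v k)
      (\<Sum>bs\<leftarrow>chain_terms k. \<Sum>bs'\<leftarrow>chain_step k bs. chain_term g f bs' v x)"
    by (rule has_dir_deriv_sum_list has_dir_deriv_chain_term[OF f g])+ (use Suc.prems fU in auto)
  then have "has_dir_deriv (iter_deriv k (g \<circ> f) v) x (v k)
      (\<Sum>bs\<leftarrow>chain_terms k. \<Sum>bs'\<leftarrow>chain_step k bs. chain_term g f bs' v x)"
    by (subst has_dir_deriv_cong[OF U Suc.prems Suc.IH])
  moreover have "(\<Sum>bs\<leftarrow>L. \<Sum>bs'\<leftarrow>chain_step k bs. chain_term g f bs' v x) =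
      (\<Sum>bs\<leftarrow>concat (map (chain_step k) L). chain_term g f bs v x)" for L
    by (induction L) auto
  ultimately show ?case by (simp only: iter_deriv.simps chain_terms.simps dir_deriv_eqI)
qed (simp add: chain_term_def)

text \<open>The explicit sum over blocks gives joint continuity: each summand nests jointly
  continuous derivatives of f inside one of g.\<close>

lemma mb_smooth_on_compose:
  fixes f :: "'e::locally_convex_space \<Rightarrow> 'f::locally_convex_space"
    and g :: "'f \<Rightarrow> 'h::locally_convex_space"
  assumes U: "open U" and f: "mb_smooth_on U f" and g: "mb_smooth_on V g" "open V"
    and fU: "f ` U \<subseteq> V"
  shows "mb_smooth_on U (g \<circ> f)"
  unfolding mb_smooth_on_def
proof (intro allI conjI ballI)
  fix k v x assume "x \<in> U"
  have "has_dir_deriv (\<lambda>x. \<Sum>bs\<leftarrow>chain_terms k. chain_term g f bs v x) x (v k)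
      (\<Sum>bs\<leftarrow>chain_terms k. \<Sum>bs'\<leftarrow>chain_step k bs. chain_term g f bs' v x)"
    by (rule has_dir_deriv_sum_list has_dir_deriv_chain_term[OF f g])+ (use \<open>x \<in> U\<close> fU in auto)
  then show "\<exists>w. has_dir_deriv (iter_deriv k (g \<circ> f) v) x (v k) w"
    by (subst has_dir_deriv_cong[OF U \<open>x \<in> U\<close> iter_deriv_compose[OF assms]]) auto
next
  fix k
  have lim: "((\<lambda>p. chain_term g f bs (snd p) (fst p)) \<longlongrightarrow> chain_term g f bs (snd p) (fst p))
      (at p within U \<times> UNIV)" if "p \<in> U \<times> UNIV" for p bs
  proof -
    let ?F = "at p within U \<times> UNIV"
    have x: "fst p \<in> U" "f (fst p) \<in> V" using that fU by auto
    have F: "(fst \<longlongrightarrow> fst p) ?F" "((\<lambda>p. snd p j) \<longlongrightarrow> snd p j) ?F" for j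
      using tendsto_snd[OF tendsto_ident_at, of p "U \<times> UNIV"]
      by (auto intro: tendsto_fst tendsto_ident_at simp: tendsto_fun_iff)
    have "((\<lambda>p. iter_deriv 0 f (snd p) (fst p)) \<longlongrightarrow> iter_deriv 0 f (snd p) (fst p)) ?F"
      by (rule iter_deriv_tendsto[OF f U x(1) F(1)]) simp
    then have fF: "((\<lambda>p. f (fst p)) \<longlongrightarrow> f (fst p)) ?F" by simp
    show ?thesis
      unfolding chain_term_def
      by (intro iter_deriv_tendsto[OF g x(2) fF] iter_deriv_tendsto[OF f U x(1) F(1)] F)
  qed
  have "((\<lambda>p. \<Sum>bs\<leftarrow>L. chain_term g f bs (snd p) (fst p)) \<longlongrightarrow> (\<Sum>bs\<leftarrow>L. chain_term g f bs (snd p) (fst p)))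
      (at p within U \<times> UNIV)" if "p \<in> U \<times> UNIV" for p and L :: "nat list list list"
    by (induction L) (auto intro: tendsto_add lim[OF that])
  then have "continuous_on (U \<times> UNIV) (\<lambda>p. \<Sum>bs\<leftarrow>chain_terms k. chain_term g f bs (snd p) (fst p))"
    unfolding continuous_on_def by blast
  then show "continuous_on (U \<times> UNIV) (\<lambda>(x, v). iter_deriv k (g \<circ> f) v x)"
    by (rule continuous_on_cong[THEN iffD1, rotated -1])
       (auto simp: iter_deriv_compose[OF assms])
qed

section \<open>Smoothness of linear images, slices and directional derivatives\<close>

lemma iter_deriv_bounded_linear:
  fixes L :: "'f::real_normed_vector \<Rightarrow> 'h::real_normed_vector"
  assumes "bounded_linear L" "open S" "mb_smooth_on S f" "x \<in> S"
  shows "iter_deriv k (\<lambda>x. L (f x)) v x = L (iter_deriv k f v x)"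
  using assms(4)
proof (induction k arbitrary: x)
  case (Suc k)
  have "has_dir_deriv (\<lambda>x. L (iter_deriv k f v x)) x (v k) (L (iter_deriv (Suc k) f (v(k := v k)) x))"
    by (intro has_dir_deriv_compose_linear[OF assms(1)] mb_smooth_on_iter_deriv[OF assms(3) Suc.prems])
  then have "has_dir_deriv (iter_deriv k (\<lambda>x. L (f x)) v) x (v k) (L (iter_deriv (Suc k) f v x))"
    by (subst has_dir_deriv_cong[OF assms(2) Suc.prems Suc.IH]) simp_all
  then show ?case by (simp add: dir_deriv_eqI)
qed simp

lemma mb_smooth_on_bounded_linear:
  fixes L :: "'f::real_normed_vector \<Rightarrow> 'h::real_normed_vector"
  assumes L: "bounded_linear L" and S: "open S" and f: "mb_smooth_on S f"
  shows "mb_smooth_on S (\<lambda>x. L (f x))"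
  unfolding mb_smooth_on_def
proof (intro allI conjI ballI)
  fix k v x assume "x \<in> S"
  have "has_dir_deriv (\<lambda>x. L (iter_deriv k f v x)) x (v k) (L (iter_deriv (Suc k) f (v(k := v k)) x))"
    by (intro has_dir_deriv_compose_linear[OF assms(1)] mb_smooth_on_iter_deriv[OF f \<open>x \<in> S\<close>])
  then show "\<exists>w. has_dir_deriv (iter_deriv k (\<lambda>x. L (f x)) v) x (v k) w"
    by (subst has_dir_deriv_cong[OF S \<open>x \<in> S\<close> iter_deriv_bounded_linear[OF assms]]) auto
next
  fix k
  have "continuous_on (S \<times> UNIV) (\<lambda>p. L ((\<lambda>(x, v). iter_deriv k f v x) p))"
    using f unfolding mb_smooth_on_def by (intro bounded_linear.continuous_on[OF L]) blast
  then show "continuous_on (S \<times> UNIV) (\<lambda>(x, v). iter_deriv k (\<lambda>x. L (f x)) v x)"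
    by (rule continuous_on_cong[THEN iffD1, rotated -1])
       (auto simp: iter_deriv_bounded_linear[OF assms])
qed

lemma has_dir_deriv_Pair_right: "has_dir_deriv (\<lambda>z. m (y, z)) z v w \<longleftrightarrow> has_dir_deriv m (y, z) (0, v) w"
  by (simp add: has_dir_deriv_def)

lemma has_dir_deriv_Pair_left: "has_dir_deriv (\<lambda>y. m (y, z)) y v w \<longleftrightarrow> has_dir_deriv m (y, z) (v, 0) w"
  by (simp add: has_dir_deriv_def)

lemma iter_deriv_Pair_right: "iter_deriv k (\<lambda>z. m (y, z)) v = (\<lambda>z. iter_deriv k m (\<lambda>i. (0, v i)) (y, z))"
proof (induction k)
  case (Suc k)
  have "has_dir_deriv (\<lambda>z. iter_deriv k m (\<lambda>i. (0, v i)) (y, z)) z (v k) =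
      has_dir_deriv (iter_deriv k m (\<lambda>i. (0, v i))) (y, z) (0, v k)" for z
    by (rule ext) (rule has_dir_deriv_Pair_right)
  then show ?case by (simp add: Suc.IH dir_deriv_def)
qed simp

lemma iter_deriv_Pair_left: "iter_deriv k (\<lambda>y. m (y, z)) v = (\<lambda>y. iter_deriv k m (\<lambda>i. (v i, 0)) (y, z))"
proof (induction k)
  case (Suc k)
  have "has_dir_deriv (\<lambda>y. iter_deriv k m (\<lambda>i. (v i, 0)) (y, z)) y (v k) =
      has_dir_deriv (iter_deriv k m (\<lambda>i. (v i, 0))) (y, z) (v k, 0)" for y
    by (rule ext) (rule has_dir_deriv_Pair_left)
  then show ?case by (simp add: Suc.IH dir_deriv_def)
qed simp

text \<open>Freezing a variable replaces each direction v by (0, v). Applied to multiplication in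
  charts, this slice gives left translations; the slice in the other variable gives left-invariant
  fields.\<close>

lemma mb_smooth_on_Pair_right:
  assumes m: "mb_smooth_on S m" and S: "open S" and T: "\<And>z. z \<in> T \<Longrightarrow> (y, z) \<in> S"
  shows "mb_smooth_on T (\<lambda>z. m (y, z))"
  unfolding mb_smooth_on_def iter_deriv_Pair_right
proof (intro allI conjI ballI)
  fix k v z assume "z \<in> T"
  show "\<exists>w. has_dir_deriv (\<lambda>z. iter_deriv k m (\<lambda>i. (0, v i)) (y, z)) z (v k) w"
    unfolding has_dir_deriv_Pair_right
    using mb_smooth_on_iter_deriv[OF m T[OF \<open>z \<in> T\<close>]] by blast
next
  fix k
  show "continuous_on (T \<times> UNIV) (\<lambda>(z, v). iter_deriv k m (\<lambda>i. (0, v i)) (y, z))"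
    unfolding continuous_on_def case_prod_beta
  proof
    fix p assume p: "p \<in> T \<times> (UNIV :: (nat \<Rightarrow> 'b) set)"
    have F: "(fst \<longlongrightarrow> fst p) (at p within T \<times> UNIV)" "((\<lambda>p. snd p j) \<longlongrightarrow> snd p j) (at p within T \<times> UNIV)" for j
      using tendsto_snd[OF tendsto_ident_at, of p "T \<times> UNIV"]
      by (auto intro: tendsto_fst tendsto_ident_at simp: tendsto_fun_iff)
    show "((\<lambda>p. iter_deriv k m (\<lambda>i. (0, snd p i)) (y, fst p)) \<longlongrightarrow>
        iter_deriv k m (\<lambda>i. (0, snd p i)) (y, fst p)) (at p within T \<times> UNIV)"
      by (intro iter_deriv_tendsto[OF m S] tendsto_Pair tendsto_const F T) (use p in auto)
  qed
qed

lemma mb_smooth_on_Pair_left: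
  assumes m: "mb_smooth_on S m" and S: "open S" and T: "\<And>y. y \<in> T \<Longrightarrow> (y, z) \<in> S"
  shows "mb_smooth_on T (\<lambda>y. m (y, z))"
  unfolding mb_smooth_on_def iter_deriv_Pair_left
proof (intro allI conjI ballI)
  fix k v y assume "y \<in> T"
  show "\<exists>w. has_dir_deriv (\<lambda>y. iter_deriv k m (\<lambda>i. (v i, 0)) (y, z)) y (v k) w"
    unfolding has_dir_deriv_Pair_left
    using mb_smooth_on_iter_deriv[OF m T[OF \<open>y \<in> T\<close>]] by blast
next
  fix k
  show "continuous_on (T \<times> UNIV) (\<lambda>(y, v). iter_deriv k m (\<lambda>i. (v i, 0)) (y, z))"
    unfolding continuous_on_def case_prod_beta
  proof
    fix p assume p: "p \<in> T \<times> (UNIV :: (nat \<Rightarrow> 'a) set)"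
    have F: "(fst \<longlongrightarrow> fst p) (at p within T \<times> UNIV)" "((\<lambda>p. snd p j) \<longlongrightarrow> snd p j) (at p within T \<times> UNIV)" for j
      using tendsto_snd[OF tendsto_ident_at, of p "T \<times> UNIV"]
      by (auto intro: tendsto_fst tendsto_ident_at simp: tendsto_fun_iff)
    show "((\<lambda>p. iter_deriv k m (\<lambda>i. (snd p i, 0)) (fst p, z)) \<longlongrightarrow>
        iter_deriv k m (\<lambda>i. (snd p i, 0)) (fst p, z)) (at p within T \<times> UNIV)"
      by (intro iter_deriv_tendsto[OF m S] tendsto_Pair tendsto_const F T) (use p in auto)
  qed
qed

lemma iter_deriv_Suc_left: "iter_deriv (Suc k) g v = iter_deriv k (\<lambda>x. dir_deriv g x (v 0)) (\<lambda>i. v (Suc i))"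
  by (induction k) auto

text \<open>The k-th derivative of this map along v is the derivative of g of order k + 1 along the
  shifted sequence with a put in front, \<open>case_nat a v\<close>.\<close>

lemma mb_smooth_on_dir_deriv_const:
  assumes g: "mb_smooth_on V g" and V: "open V"
  shows "mb_smooth_on V (\<lambda>x. dir_deriv g x a)"
proof -
  have eq: "iter_deriv k (\<lambda>x. dir_deriv g x a) v = iter_deriv (Suc k) g (case_nat a v)" for k v
    by (simp add: iter_deriv_Suc_left del: iter_deriv.simps)
  show ?thesis
    unfolding mb_smooth_on_def eq
  proof (intro allI conjI ballI)
    fix k v x assume "x \<in> V"
    then show "\<exists>w. has_dir_deriv (iter_deriv (Suc k) g (case_nat a v)) x (v k) w"
      using mb_smooth_on_iter_deriv[OF g] by blast
  next
    fix k
    show "continuous_on (V \<times> UNIV) (\<lambda>(x, v). iter_deriv (Suc k) g (case_nat a v) x)"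
      unfolding continuous_on_def case_prod_beta
    proof
      fix p assume p: "p \<in> V \<times> (UNIV :: (nat \<Rightarrow> 'a) set)"
      have F: "(fst \<longlongrightarrow> fst p) (at p within V \<times> UNIV)" "((\<lambda>p. snd p j) \<longlongrightarrow> snd p j) (at p within V \<times> UNIV)" for j
        using tendsto_snd[OF tendsto_ident_at, of p "V \<times> UNIV"]
        by (auto intro: tendsto_fst tendsto_ident_at simp: tendsto_fun_iff)
      show "((\<lambda>p. iter_deriv (Suc k) g (case_nat a (snd p)) (fst p)) \<longlongrightarrow>
          iter_deriv (Suc k) g (case_nat a (snd p)) (fst p)) (at p within V \<times> UNIV)"
      proof (rule iter_deriv_tendsto[OF g V _ F(1)])
        fix i show "((\<lambda>p. case_nat a (snd p) i) \<longlongrightarrow> case_nat a (snd p) i) (at p within V \<times> UNIV)"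
          by (cases i) (simp_all add: F)
      qed (use p in auto)
    qed
  qed
qed

section \<open>Holomorphic functions and the argument\<close>

lemma has_field_derivative_imp_has_dir_deriv:
  fixes f :: "complex \<Rightarrow> complex"
  assumes "(f has_field_derivative D) (at z)"
  shows "has_dir_deriv f z v (D * v)"
proof (cases "v = 0")
  case True then show ?thesis by (simp add: has_dir_deriv_zero)
next
  case False
  have "filterlim (\<lambda>t::real. t *\<^sub>R v) (at 0) (at 0)"
    using False by (auto simp: filterlim_at eventually_at_filter intro!: tendsto_eq_intros)
  from filterlim_compose[OF assms[unfolded DERIV_def] this]
  have "((\<lambda>t. (f (z + t *\<^sub>R v) - f z) / (t *\<^sub>R v) * v) \<longlongrightarrow> D * v) (at 0)"
    by (intro tendsto_mult tendsto_const)
  moreover have "a / (t *\<^sub>R v) * v = a /\<^sub>R t" for a t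
    using False by (cases "t = 0") (auto simp: scaleR_conv_of_real field_simps)
  ultimately show ?thesis
    unfolding has_dir_deriv_def by simp
qed

text \<open>Complex linearity of the derivative gives a closed form: the k-th derivative along v is
  the k-th complex derivative times the product of the first k directions.\<close>

lemma mb_smooth_on_holomorphic:
  fixes D :: "nat \<Rightarrow> complex \<Rightarrow> complex"
  assumes S: "open S" and D: "\<And>k z. z \<in> S \<Longrightarrow> (D k has_field_derivative D (Suc k) z) (at z)"
  shows "mb_smooth_on S (D 0)"
proof -
  have der: "has_dir_deriv (\<lambda>z. D k z * (\<Prod>i<k. v i)) z (v k) (D (Suc k) z * (\<Prod>i<Suc k. v i))"
    if "z \<in> S" for k v z
  proof -
    have "((\<lambda>z. D k z * (\<Prod>i<k. v i)) has_field_derivative D (Suc k) z * (\<Prod>i<k. v i)) (at z)"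
      by (intro DERIV_cmult_right D that)
    from has_field_derivative_imp_has_dir_deriv[OF this] show ?thesis by (simp add: mult.assoc)
  qed
  have eq: "iter_deriv k (D 0) v z = D k z * (\<Prod>i<k. v i)" if "z \<in> S" for k v z
    using that
  proof (induction k arbitrary: z)
    case (Suc k)
    have "has_dir_deriv (iter_deriv k (D 0) v) z (v k) (D (Suc k) z * (\<Prod>i<Suc k. v i))"
      by (subst has_dir_deriv_cong[OF S Suc.prems Suc.IH]) (use der Suc.prems in auto)
    then show ?case by (simp only: iter_deriv.simps dir_deriv_eqI)
  qed simp
  show ?thesis
    unfolding mb_smooth_on_def
  proof (intro allI conjI ballI)
    fix k v z assume z: "z \<in> S"
    show "\<exists>w. has_dir_deriv (iter_deriv k (D 0) v) z (v k) w"
      by (subst has_dir_deriv_cong[OF S z eq]) (use der z in auto)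
  next
    fix k
    have "continuous_on S (D k)"
      unfolding continuous_on_eq_continuous_at[OF S] using D DERIV_isCont by blast
    then have "continuous_on (S \<times> UNIV) (\<lambda>p :: complex \<times> (nat \<Rightarrow> complex). D k (fst p))"
      by (rule continuous_on_compose2[OF _ continuous_on_fst[OF continuous_on_id]]) auto
    moreover have "continuous_on (S \<times> UNIV) (\<lambda>p :: complex \<times> (nat \<Rightarrow> complex). \<Prod>i<k. snd p i)"
      by (rule continuous_on_prod[where f = "\<lambda>i p. snd p i"])
         (rule continuous_on_product_then_coordinatewise[OF continuous_on_snd[OF continuous_on_id]])
    ultimately have "continuous_on (S \<times> UNIV) (\<lambda>p. D k (fst p) * (\<Prod>i<k. snd p i))"
      by (rule continuous_on_mult)
    then show "continuous_on (S \<times> UNIV) (\<lambda>(z, v). iter_deriv k (D 0) v z)"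
      by (rule continuous_on_cong[THEN iffD1, rotated -1]) (auto simp: eq)
  qed
qed

lemma mb_smooth_on_Arg: "mb_smooth_on (- \<real>\<^sub>\<le>\<^sub>0) Arg"
proof -
  \<comment> \<open>The derivatives of \<open>Ln\<close>: order 0 is \<open>Ln\<close> itself and
    order k + 1 is (-1)^k k! z^(-k-1).\<close>
  define D :: "nat \<Rightarrow> complex \<Rightarrow> complex" where
    "D = rec_nat Ln (\<lambda>k _ z. (- 1) ^ k * fact k * inverse z ^ Suc k)"
  have op: "open (- \<real>\<^sub>\<le>\<^sub>0 :: complex set)" by (simp add: open_Compl)
  have "mb_smooth_on (- \<real>\<^sub>\<le>\<^sub>0) (D 0)"
  proof (rule mb_smooth_on_holomorphic[OF op])
    fix k and z :: complex assume z: "z \<in> - \<real>\<^sub>\<le>\<^sub>0"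
    then have "z \<noteq> 0" by auto
    show "(D k has_field_derivative D (Suc k) z) (at z)"
    proof (cases k)
      case 0
      then show ?thesis using z by (auto simp: D_def inverse_eq_divide intro!: derivative_eq_intros)
    next
      case (Suc j)
      have "((\<lambda>z. (- 1) ^ j * fact j * inverse z ^ Suc j) has_field_derivative
          (- 1) ^ Suc j * fact (Suc j) * inverse z ^ Suc (Suc j)) (at z)"
        by (rule DERIV_cong[OF DERIV_cmult[OF DERIV_power[OF DERIV_inverse[OF \<open>z \<noteq> 0\<close>]]]])
           (simp add: algebra_simps)
      then show ?thesis using Suc by (simp add: D_def)
    qed
  qed
  then have "mb_smooth_on (- \<real>\<^sub>\<le>\<^sub>0) (\<lambda>z. Im (D 0 z))"
    by (rule mb_smooth_on_bounded_linear[OF bounded_linear_Im op])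
  moreover have "Im (D 0 z) = Arg z" if "z \<in> - \<real>\<^sub>\<le>\<^sub>0" for z
  proof -
    have "z \<noteq> 0" using that by auto
    then show ?thesis by (simp add: D_def Arg_eq_Im_Ln)
  qed
  ultimately show ?thesis
    using mb_smooth_on_cong[OF op, of "\<lambda>z. Im (D 0 z)" Arg] by simp
qed

section \<open>Charts and tangent maps\<close>

text \<open>Differentiating y \<mapsto> d\<phi>(y)(Z y) gives a second derivative of \<phi> plus
  d\<phi> applied to the derivative of Z. In the difference the second derivatives cancel by
  symmetry. The identity says that d\<phi> carries the coordinate bracket to the commutator of the
  fields acting on \<phi>.\<close>

lemma dir_deriv_commutator:
  assumes \<phi>: "mb_smooth_on V \<phi>" "open V" "y \<in> V"
    and X: "has_dir_deriv X y (Y y) dX" and Y: "has_dir_deriv Y y (X y) dY"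
  shows "dir_deriv \<phi> y (dY - dX) =
    dir_deriv (\<lambda>y. dir_deriv \<phi> y (Y y)) y (X y) - dir_deriv (\<lambda>y. dir_deriv \<phi> y (X y)) y (Y y)"
proof -
  have id: "has_dir_deriv (\<lambda>y. y) y u u" for u
    unfolding has_dir_deriv_def
    by (rule Lim_transform_eventually[OF tendsto_const])
       (use eventually_at_zero_nonzero in \<open>eventually_elim, simp\<close>)
  have *: "dir_deriv (\<lambda>y. dir_deriv \<phi> y (Z y)) y u =
      dir_deriv (\<lambda>x. dir_deriv \<phi> x (Z y)) y u + dir_deriv \<phi> y dZ"
    if "has_dir_deriv Z y u dZ" for Z u dZ
  proof -
    have "has_dir_deriv (\<lambda>y. iter_deriv (Suc 0) \<phi> (\<lambda>_. Z y) y) y u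
      (iter_deriv (Suc (Suc 0)) \<phi> ((\<lambda>_. Z y)(Suc 0 := u)) y +
       (\<Sum>i<Suc 0. iter_deriv (Suc 0) \<phi> ((\<lambda>_. Z y)(i := dZ)) y))"
      by (rule has_dir_deriv_iter_deriv_compose[OF \<phi> id that])
    then show ?thesis by (simp add: dir_deriv_eqI)
  qed
  show ?thesis
    using *[OF X] *[OF Y] dir_deriv_commute[OF \<phi>, of "Y y" "X y"] dir_deriv_diff[OF \<phi>, of dY dX]
    by simp
qed

section \<open>Charts, their inverses and chart changes\<close>

lemma is_chart_subset: "is_chart X c \<Longrightarrow> fst c \<subseteq> topspace X"
  unfolding is_chart_def by (blast dest: openin_subset)

lemma is_chart_inj_on: "is_chart X c \<Longrightarrow> inj_on (snd c) (fst c)"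
  using is_chart_subset[of X c] homeomorphic_imp_injective_map
  unfolding is_chart_def by (fastforce simp: Int_absorb1)

lemma chart_inv_left: "is_chart X c \<Longrightarrow> x \<in> fst c \<Longrightarrow> chart_inv c (snd c x) = x"
  unfolding chart_inv_def by (simp add: is_chart_inj_on inv_into_f_f)

lemma chart_inv_right: "y \<in> snd c ` fst c \<Longrightarrow> snd c (chart_inv c y) = y"
  unfolding chart_inv_def by (rule f_inv_into_f)

lemma chart_inv_in: "y \<in> snd c ` fst c \<Longrightarrow> chart_inv c y \<in> fst c"
  unfolding chart_inv_def by (rule inv_into_into)

lemma is_chart_open_image:
  assumes "is_chart X c" "openin X U" "U \<subseteq> fst c"
  shows "open (snd c ` U)"
proof -
  have "openin (subtopology X (fst c)) U"
    using assms(2,3) by (auto simp: openin_subtopology)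
  then have "openin (top_of_set (snd c ` fst c)) (snd c ` U)"
    using assms(1) homeomorphic_imp_open_map unfolding is_chart_def open_map_def by blast
  then show ?thesis
    using assms(1) unfolding is_chart_def by (auto simp: openin_open_eq)
qed

lemma is_chart_image_Collect:
  assumes "is_chart X c"
  shows "snd c ` {x \<in> fst c. P x} = {y \<in> snd c ` fst c. P (chart_inv c y)}"
  using chart_inv_left[OF assms] chart_inv_right[of _ c] chart_inv_in[of _ c] by (force simp: image_iff)

context lc_manifold
begin

lemma open_chart_image: "c \<in> atlas M \<Longrightarrow> open (snd c ` fst c)"
  using charts unfolding is_chart_def by blast

lemma ex_chart_at: "p \<in> topspace (mtop M) \<Longrightarrow> \<exists>c. c \<in> charts_at M p"
  using cover unfolding charts_at_def by blast

lemma charts_atD: "c \<in> charts_at M p \<Longrightarrow> c \<in> atlas M \<and> p \<in> fst c \<and> p \<in> topspace (mtop M)"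
  using is_chart_subset charts unfolding charts_at_def by blast

lemma chart_inv_chart: "c \<in> charts_at M p \<Longrightarrow> chart_inv c (snd c p) = p"
  by (auto simp: charts_at_def intro: chart_inv_left[OF charts])

lemma chart_in_image: "c \<in> charts_at M p \<Longrightarrow> snd c p \<in> snd c ` fst c"
  by (simp add: charts_at_def)

lemma charts_at_chart_inv: "c \<in> atlas M \<Longrightarrow> y \<in> snd c ` fst c \<Longrightarrow> c \<in> charts_at M (chart_inv c y)"
  by (simp add: charts_at_def chart_inv_in)

lemma open_transition: 
  assumes "c \<in> atlas M" "d \<in> atlas M"
  shows "open (snd c ` (fst c \<inter> fst d))"
proof (rule is_chart_open_image[OF charts[OF assms(1)]])
  show "openin (mtop M) (fst c \<inter> fst d)"
    using charts[OF assms(1)] charts[OF assms(2)] by (simp add: is_chart_def openin_Int)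
qed simp

lemma transition_eq:
  assumes "c \<in> atlas M" "y \<in> snd c ` (fst c \<inter> fst d)" "d \<in> atlas M"
  shows "chart_inv c y \<in> fst c \<inter> fst d" "chart_inv d (snd d (chart_inv c y)) = chart_inv c y"
  using assms(2) chart_inv_left[OF charts[OF assms(1)]] chart_inv_left[OF charts[OF assms(3)]] by auto

lemma open_preimage_chart:
  assumes "continuous_map (mtop M) Z f" "openin Z W" "c \<in> atlas M"
  shows "open (snd c ` {x \<in> fst c. f x \<in> W})"
proof (rule is_chart_open_image[OF charts[OF assms(3)]])
  have "openin (mtop M) (fst c)" using charts[OF assms(3)] by (simp add: is_chart_def)
  moreover have "openin (mtop M) {x \<in> topspace (mtop M). f x \<in> W}"
    by (rule openin_continuous_map_preimage[OF assms(1,2)])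
  moreover have "{x \<in> fst c. f x \<in> W} = fst c \<inter> {x \<in> topspace (mtop M). f x \<in> W}"
    using is_chart_subset[OF charts[OF assms(3)]] by blast
  ultimately show "openin (mtop M) {x \<in> fst c. f x \<in> W}" by auto
qed auto

end

section \<open>Tangent vectors and the chain rule on manifolds\<close>

lemma tangent_space_transition:
  "\<xi> \<in> tangent_space M p \<Longrightarrow> c \<in> charts_at M p \<Longrightarrow> d \<in> charts_at M p \<Longrightarrow>
    \<xi> d = dir_deriv (snd d \<circ> chart_inv c) (snd c p) (\<xi> c)"
  unfolding tangent_space_def by blast

lemma tangent_space_outside: "\<xi> \<in> tangent_space M p \<Longrightarrow> c \<notin> charts_at M p \<Longrightarrow> \<xi> c = 0"
  unfolding tangent_space_def by blast

lemma tangent_spaceI: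
  assumes "\<And>c d. c \<in> charts_at M p \<Longrightarrow> d \<in> charts_at M p \<Longrightarrow>
      \<xi> d = dir_deriv (snd d \<circ> chart_inv c) (snd c p) (\<xi> c)"
    and "\<And>c. c \<notin> charts_at M p \<Longrightarrow> \<xi> c = 0"
  shows "\<xi> \<in> tangent_space M p"
  using assms unfolding tangent_space_def by blast

text \<open>A common local form of the two notions of smoothness, into a manifold (composed with a
  target chart) and into a vector space. One chart and one neighbourhood are enough for evaluating
  derivatives at p.\<close>

definition chart_smooth_at :: "('a, 'e::locally_convex_space) chart \<Rightarrow> ('a \<Rightarrow> 'f::locally_convex_space) \<Rightarrow> 'a \<Rightarrow> bool" where
  "chart_smooth_at c f p \<longleftrightarrow> (\<exists>S. open S \<and> snd c p \<in> S \<and> mb_smooth_on S (f \<circ> chart_inv c))"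

lemma smooth_map_chart_smooth_at:
  assumes "lc_manifold M" "lc_manifold N" "smooth_map M N f"
    and c: "c \<in> charts_at M p" and d: "d \<in> charts_at N (f p)"
  shows "chart_smooth_at c (snd d \<circ> f) p"
proof -
  interpret M: lc_manifold M by fact
  interpret N: lc_manifold N by fact
  have "open (snd c ` {x \<in> fst c. f x \<in> fst d})"
    using assms(3) c d N.charts[of d]
    by (intro M.open_preimage_chart) (auto simp: smooth_map_def charts_at_def is_chart_def)
  moreover have "mb_smooth_on (snd c ` {x \<in> fst c. f x \<in> fst d}) (snd d \<circ> f \<circ> chart_inv c)"
    using assms(3) c d by (auto simp: smooth_map_def charts_at_def)
  ultimately show ?thesis
    using c d unfolding chart_smooth_at_def by (fastforce simp: charts_at_def)
qed

lemma smooth_map_vector_mfd_iff: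
  "smooth_map M vector_mfd f \<longleftrightarrow> continuous_map (mtop M) euclidean f \<and>
     (\<forall>c\<in>atlas M. mb_smooth_on (snd c ` fst c) (f \<circ> chart_inv c))"
  by (simp add: smooth_map_def vector_mfd_def)

lemma (in lc_manifold) smooth_map_vector_chart_smooth_at:
  assumes "smooth_map M vector_mfd f" "c \<in> charts_at M p"
  shows "chart_smooth_at c f p"
  using assms open_chart_image charts_atD[OF assms(2)]
  unfolding smooth_map_vector_mfd_iff chart_smooth_at_def by (meson imageI)

text \<open>Near each point F \<circ> f passes through one chart d of N, as the composite of F
  \<circ> d^-1 with d \<circ> f \<circ> c^-1; the open sets on which this works are then patched. It
  restricts the orbit map to a subgroup whose topology may be finer.\<close>

lemma smooth_map_compose_vector:
  assumes "lc_manifold M" "lc_manifold N" "smooth_map M N f" "smooth_map N vector_mfd F"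
  shows "smooth_map M vector_mfd (F \<circ> f)"
  unfolding smooth_map_vector_mfd_iff
proof
  interpret M: lc_manifold M by fact
  interpret N: lc_manifold N by fact
  have f: "continuous_map (mtop M) (mtop N) f" using assms(3) by (simp add: smooth_map_def)
  then show "continuous_map (mtop M) euclidean (F \<circ> f)"
    using assms(4) by (auto simp: smooth_map_vector_mfd_iff intro: continuous_map_compose)
  show "\<forall>c\<in>atlas M. mb_smooth_on (snd c ` fst c) (F \<circ> f \<circ> chart_inv c)"
  proof
    fix c assume c: "c \<in> atlas M"
    show "mb_smooth_on (snd c ` fst c) (F \<circ> f \<circ> chart_inv c)"
    proof (rule mb_smooth_on_local)
      fix y assume y: "y \<in> snd c ` fst c"
      have "f (chart_inv c y) \<in> topspace (mtop N)"
        using M.charts_at_chart_inv[OF c y] M.charts_atD f by (meson continuous_map_image_subset_topspace image_subset_iff)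
      then obtain d where d: "d \<in> charts_at N (f (chart_inv c y))" using N.ex_chart_at by blast
      then have d': "d \<in> atlas N" "f (chart_inv c y) \<in> fst d" by (auto simp: charts_at_def)
      define U where "U = snd c ` {x \<in> fst c. f x \<in> fst d}"
      have U_eq: "U = {y \<in> snd c ` fst c. f (chart_inv c y) \<in> fst d}"
        unfolding U_def by (rule is_chart_image_Collect[OF M.charts[OF c]])
      have U: "open U"
        unfolding U_def using N.charts[OF d'(1)] by (intro M.open_preimage_chart[OF f _ c]) (simp add: is_chart_def)
      have "mb_smooth_on U ((F \<circ> chart_inv d) \<circ> (snd d \<circ> f \<circ> chart_inv c))"
      proof (rule mb_smooth_on_compose[OF U _ _ N.open_chart_image[OF d'(1)]])
        show "mb_smooth_on U (snd d \<circ> f \<circ> chart_inv c)"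
          using assms(3) c d'(1) by (simp add: smooth_map_def U_def)
        show "mb_smooth_on (snd d ` fst d) (F \<circ> chart_inv d)"
          using assms(4) d'(1) by (simp add: smooth_map_vector_mfd_iff)
        show "(snd d \<circ> f \<circ> chart_inv c) ` U \<subseteq> snd d ` fst d" by (auto simp: U_eq)
      qed
      moreover have "((F \<circ> chart_inv d) \<circ> (snd d \<circ> f \<circ> chart_inv c)) z = (F \<circ> f \<circ> chart_inv c) z"
        if "z \<in> U" for z
        using that by (simp add: U_eq chart_inv_left[OF N.charts[OF d'(1)]])
      ultimately have "mb_smooth_on U (F \<circ> f \<circ> chart_inv c)"
        using mb_smooth_on_cong[OF U, of "(F \<circ> chart_inv d) \<circ> (snd d \<circ> f \<circ> chart_inv c)"] by blast
      moreover have "y \<in> U" using y d'(2) by (simp add: U_eq)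
      ultimately show "\<exists>T. open T \<and> y \<in> T \<and> mb_smooth_on T (F \<circ> f \<circ> chart_inv c)" using U by blast
    qed
  qed
qed

context lc_manifold
begin

text \<open>Chain rule through the chart change from d to c, which sends the component of \<xi> at d
  to the one at c because \<xi> is a tangent vector.\<close>

lemma has_dir_deriv_chart_change:
  assumes c: "c \<in> charts_at M p" and d: "d \<in> charts_at M p"
    and f: "chart_smooth_at c f p" and \<xi>: "\<xi> \<in> tangent_space M p"
  shows "has_dir_deriv (f \<circ> chart_inv d) (snd d p) (\<xi> d) (dir_deriv (f \<circ> chart_inv c) (snd c p) (\<xi> c))"
proof -
  let ?T = "snd d ` (fst d \<inter> fst c)"
  let ?\<tau> = "snd c \<circ> chart_inv d"
  have T: "open ?T" "snd d p \<in> ?T"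
    using c d open_transition by (auto simp: charts_at_def)
  obtain S where S: "open S" "snd c p \<in> S" "mb_smooth_on S (f \<circ> chart_inv c)"
    using f unfolding chart_smooth_at_def by blast
  have p: "?\<tau> (snd d p) = snd c p" using chart_inv_chart[OF d] by simp
  have "dir_deriv ?\<tau> (snd d p) (\<xi> d) = \<xi> c" by (rule tangent_space_transition[OF \<xi> d c, symmetric])
  moreover have "mb_smooth_on ?T ?\<tau>" using c d compatible by (auto simp: charts_at_def)
  ultimately have "has_dir_deriv ?\<tau> (snd d p) (\<xi> d) (\<xi> c)"
    using mb_smooth_on_dir_deriv T(2) by metis
  from has_dir_deriv_chain[OF this S(3,1)] S(2) p
  have "has_dir_deriv (\<lambda>y. (f \<circ> chart_inv c) (?\<tau> y)) (snd d p) (\<xi> d)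
    (dir_deriv (f \<circ> chart_inv c) (snd c p) (\<xi> c))" by simp
  then show ?thesis
  proof (subst has_dir_deriv_cong[OF T])
    fix y assume "y \<in> ?T"
    then show "(f \<circ> chart_inv d) y = (f \<circ> chart_inv c) (?\<tau> y)"
      using transition_eq[of d y c] c d by (simp add: charts_at_def)
  qed
qed

text \<open>All charts give the same value, so the definite description in
  \<open>tangent_deriv\<close> is met and may be computed in any one of them.\<close>

lemma tangent_deriv_eq:
  assumes "c \<in> charts_at M p" "chart_smooth_at c f p" "\<xi> \<in> tangent_space M p"
  shows "tangent_deriv M f p \<xi> = dir_deriv (f \<circ> chart_inv c) (snd c p) (\<xi> c)"
proof -
  have "dir_deriv (f \<circ> chart_inv d) (snd d p) (\<xi> d) = dir_deriv (f \<circ> chart_inv c) (snd c p) (\<xi> c)"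
    if "d \<in> charts_at M p" for d
    using has_dir_deriv_chart_change[OF assms(1) that assms(2,3)] by (rule dir_deriv_eqI)
  then show ?thesis
    unfolding tangent_deriv_def using assms(1) by (intro the_equality) metis+
qed

lemma zero_in_tangent_space: "(\<lambda>_. 0) \<in> tangent_space M p"
  by (rule tangent_spaceI) (simp_all add: dir_deriv_eqI[OF has_dir_deriv_zero])

lemma transition_smooth:
  assumes "c \<in> charts_at M p" "d \<in> charts_at M p"
  shows "mb_smooth_on (snd c ` (fst c \<inter> fst d)) (snd d \<circ> chart_inv c)"
    "open (snd c ` (fst c \<inter> fst d))" "snd c p \<in> snd c ` (fst c \<inter> fst d)"
  using assms compatible open_transition unfolding charts_at_def by auto

lemma add_in_tangent_space:
  "\<xi> \<in> tangent_space M p \<Longrightarrow> \<eta> \<in> tangent_space M p \<Longrightarrow> (\<lambda>c. \<xi> c + \<eta> c) \<in> tangent_space M p"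
proof (rule tangent_spaceI)
  fix c d assume \<xi>: "\<xi> \<in> tangent_space M p" and \<eta>: "\<eta> \<in> tangent_space M p"
    and cd: "c \<in> charts_at M p" "d \<in> charts_at M p"
  show "\<xi> d + \<eta> d = dir_deriv (snd d \<circ> chart_inv c) (snd c p) (\<xi> c + \<eta> c)"
    by (simp only: dir_deriv_add[OF transition_smooth[OF cd]]
        tangent_space_transition[OF \<xi> cd, symmetric] tangent_space_transition[OF \<eta> cd, symmetric])
qed (simp add: tangent_space_outside)

lemma scaleR_in_tangent_space:
  "\<xi> \<in> tangent_space M p \<Longrightarrow> (\<lambda>c. r *\<^sub>R \<xi> c) \<in> tangent_space M p"
proof (rule tangent_spaceI)
  fix c d assume \<xi>: "\<xi> \<in> tangent_space M p" and cd: "c \<in> charts_at M p" "d \<in> charts_at M p"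
  show "r *\<^sub>R \<xi> d = dir_deriv (snd d \<circ> chart_inv c) (snd c p) (r *\<^sub>R \<xi> c)"
    by (simp only: dir_deriv_scaleR[OF transition_smooth[OF cd]] tangent_space_transition[OF \<xi> cd, symmetric])
qed (simp add: tangent_space_outside)

lemma tangent_deriv_add:
  assumes "c \<in> charts_at M p" "chart_smooth_at c f p" "\<xi> \<in> tangent_space M p" "\<eta> \<in> tangent_space M p"
  shows "tangent_deriv M f p (\<lambda>c. \<xi> c + \<eta> c) = tangent_deriv M f p \<xi> + tangent_deriv M f p \<eta>"
proof -
  obtain S where "open S" "snd c p \<in> S" "mb_smooth_on S (f \<circ> chart_inv c)"
    using assms(2) unfolding chart_smooth_at_def by blast
  then show ?thesis
    by (simp only: tangent_deriv_eq[OF assms(1,2)] assms(3,4) add_in_tangent_space dir_deriv_add)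
qed

lemma tangent_deriv_scaleR:
  assumes "c \<in> charts_at M p" "chart_smooth_at c f p" "\<xi> \<in> tangent_space M p"
  shows "tangent_deriv M f p (\<lambda>c. r *\<^sub>R \<xi> c) = r *\<^sub>R tangent_deriv M f p \<xi>"
proof -
  obtain S where "open S" "snd c p \<in> S" "mb_smooth_on S (f \<circ> chart_inv c)"
    using assms(2) unfolding chart_smooth_at_def by blast
  then show ?thesis
    by (simp only: tangent_deriv_eq[OF assms(1,2)] assms(3) scaleR_in_tangent_space dir_deriv_scaleR)
qed

end

text \<open>The chain rule, asserting existence of the derivative as well as its value. F is later a
  target coordinate, which makes \<open>tangent_map\<close> well behaved, or an orbit map.\<close>

lemma tangent_deriv_compose:
  assumes "lc_manifold M" "lc_manifold N" "smooth_map M N f"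
    and c: "c \<in> charts_at M p" and d: "d \<in> charts_at N (f p)" and F: "chart_smooth_at d F (f p)"
    and \<xi>: "\<xi> \<in> tangent_space M p"
  shows "has_dir_deriv (F \<circ> f \<circ> chart_inv c) (snd c p) (\<xi> c)
    (dir_deriv (F \<circ> chart_inv d) (snd d (f p)) (tangent_map M N f p \<xi> d))"
proof -
  interpret M: lc_manifold M by fact
  interpret N: lc_manifold N by fact
  have cs: "chart_smooth_at c (snd d \<circ> f) p" by (rule smooth_map_chart_smooth_at[OF assms(1-5)])
  then obtain S where S: "open S" "snd c p \<in> S" "mb_smooth_on S (snd d \<circ> f \<circ> chart_inv c)"
    unfolding chart_smooth_at_def by blast
  obtain R where R: "open R" "snd d (f p) \<in> R" "mb_smooth_on R (F \<circ> chart_inv d)"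
    using F unfolding chart_smooth_at_def by blast
  have tm: "tangent_map M N f p \<xi> d = dir_deriv (snd d \<circ> f \<circ> chart_inv c) (snd c p) (\<xi> c)"
    using d M.tangent_deriv_eq[OF c cs \<xi>] by (simp add: tangent_map_def)
  have p: "(snd d \<circ> f \<circ> chart_inv c) (snd c p) = snd d (f p)" using M.chart_inv_chart[OF c] by simp
  have 1: "has_dir_deriv (\<lambda>y. (F \<circ> chart_inv d) ((snd d \<circ> f \<circ> chart_inv c) y)) (snd c p) (\<xi> c)
    (dir_deriv (F \<circ> chart_inv d) (snd d (f p)) (tangent_map M N f p \<xi> d))"
    using has_dir_deriv_chain[OF mb_smooth_on_dir_deriv[OF S(3,2)] R(3,1)] R(2) p tm by simp
  have cd: "c \<in> atlas M" "d \<in> atlas N" using c d by (auto simp: charts_at_def)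
  let ?U = "snd c ` {x \<in> fst c. f x \<in> fst d}"
  have U: "open ?U"
    using assms(3) N.charts[OF cd(2)]
    by (intro M.open_preimage_chart[OF _ _ cd(1)]) (auto simp: smooth_map_def is_chart_def)
  have pU: "snd c p \<in> ?U" using c d by (auto simp: charts_at_def)
  have "(F \<circ> f \<circ> chart_inv c) y = (F \<circ> chart_inv d) ((snd d \<circ> f \<circ> chart_inv c) y)" if "y \<in> ?U" for y
    using that chart_inv_left[OF N.charts[OF cd(2)]]
    unfolding is_chart_image_Collect[OF M.charts[OF cd(1)]] by simp
  with 1 show ?thesis by (subst has_dir_deriv_cong[OF U pU])
qed

lemma tangent_map_in_tangent_space:
  assumes "lc_manifold M" "lc_manifold N" "smooth_map M N f"
    and p: "p \<in> topspace (mtop M)" and \<xi>: "\<xi> \<in> tangent_space M p"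
  shows "tangent_map M N f p \<xi> \<in> tangent_space N (f p)"
proof -
  interpret M: lc_manifold M by fact
  interpret N: lc_manifold N by fact
  obtain c where c: "c \<in> charts_at M p" using M.ex_chart_at[OF p] by blast
  show ?thesis
  proof (rule tangent_spaceI)
    fix d d' assume d: "d \<in> charts_at N (f p)" "d' \<in> charts_at N (f p)"
    \<comment> \<open>The transformation rule between d and d' is the chain rule with the coordinate
      function of d' as outer map.\<close>
    have "chart_smooth_at d (snd d') (f p)"
      using N.transition_smooth[OF d] unfolding chart_smooth_at_def by blast
    from tangent_deriv_compose[OF assms(1-3) c d(1) this \<xi>]
    have "dir_deriv (snd d' \<circ> f \<circ> chart_inv c) (snd c p) (\<xi> c) =
        dir_deriv (snd d' \<circ> chart_inv d) (snd d (f p)) (tangent_map M N f p \<xi> d)"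
      by (rule dir_deriv_eqI)
    moreover have "tangent_map M N f p \<xi> d' = dir_deriv (snd d' \<circ> f \<circ> chart_inv c) (snd c p) (\<xi> c)"
      using d(2) M.tangent_deriv_eq[OF c smooth_map_chart_smooth_at[OF assms(1-3) c d(2)] \<xi>]
      by (simp add: tangent_map_def)
    ultimately show "tangent_map M N f p \<xi> d' =
        dir_deriv (snd d' \<circ> chart_inv d) (snd d (f p)) (tangent_map M N f p \<xi> d)" by simp
  qed (simp add: tangent_map_def)
qed

text \<open>Chart independence of the coordinate bracket: \<open>dir_deriv_commutator\<close> for
  the chart change turns the transformed bracket into iterated derivatives of the components in the
  new chart.\<close>

lemma (in lc_manifold) field_bracket_in_tangent_space:
  assumes X: "\<And>p. p \<in> topspace (mtop M) \<Longrightarrow> X p \<in> tangent_space M p"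
    "\<And>c. c \<in> atlas M \<Longrightarrow> mb_smooth_on (snd c ` fst c) (\<lambda>y. X (chart_inv c y) c)"
    and Y: "\<And>p. p \<in> topspace (mtop M) \<Longrightarrow> Y p \<in> tangent_space M p"
    "\<And>c. c \<in> atlas M \<Longrightarrow> mb_smooth_on (snd c ` fst c) (\<lambda>y. Y (chart_inv c y) c)"
  shows "field_bracket M X Y p \<in> tangent_space M p"
proof (rule tangent_spaceI)
  fix c d assume c: "c \<in> charts_at M p" and d: "d \<in> charts_at M p"
  have cd: "c \<in> atlas M" "d \<in> atlas M" using c d by (auto simp: charts_at_def)
  let ?\<phi> = "snd d \<circ> chart_inv c" and ?U = "snd c ` (fst c \<inter> fst d)"
  have p: "p \<in> topspace (mtop M)" using charts_atD[OF c] by simp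
  note U = transition_smooth[OF c d]
  have \<phi>p: "?\<phi> (snd c p) = snd d p" using chart_inv_chart[OF c] by simp
  \<comment> \<open>Tangency at every point near p, not only at p, relates the components of a field
    in the two charts as functions, so the relation can be differentiated.\<close>
  have push: "Z (chart_inv d (?\<phi> y)) d = dir_deriv ?\<phi> y (Z (chart_inv c y) c)"
    if "\<And>p. p \<in> topspace (mtop M) \<Longrightarrow> Z p \<in> tangent_space M p" "y \<in> ?U" for Z y
  proof -
    have q: "chart_inv c y \<in> fst c \<inter> fst d" "chart_inv d (?\<phi> y) = chart_inv c y"
      using transition_eq[OF cd(1) that(2) cd(2)] by auto
    then have "c \<in> charts_at M (chart_inv c y)" "d \<in> charts_at M (chart_inv c y)"
      using cd by (auto simp: charts_at_def)
    moreover from this have "Z (chart_inv c y) \<in> tangent_space M (chart_inv c y)"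
      using charts_atD that(1) by blast
    moreover have "snd c (chart_inv c y) = y" using that(2) by (intro chart_inv_right) auto
    ultimately show ?thesis using q(2) tangent_space_transition by metis
  qed
  have der: "dir_deriv (\<lambda>y. dir_deriv ?\<phi> y (Z (chart_inv c y) c)) (snd c p) (W p c) =
      dir_deriv (\<lambda>y. Z (chart_inv d y) d) (snd d p) (W p d)"
    if Z: "\<And>p. p \<in> topspace (mtop M) \<Longrightarrow> Z p \<in> tangent_space M p"
      "\<And>c. c \<in> atlas M \<Longrightarrow> mb_smooth_on (snd c ` fst c) (\<lambda>y. Z (chart_inv c y) c)"
      and W: "W p \<in> tangent_space M p" for Z W
  proof -
    have "dir_deriv (\<lambda>y. dir_deriv ?\<phi> y (Z (chart_inv c y) c)) (snd c p) (W p c) =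
        dir_deriv (\<lambda>y. Z (chart_inv d (?\<phi> y)) d) (snd c p) (W p c)"
      by (rule dir_deriv_cong[OF U(2,3)]) (simp add: push[OF Z(1), symmetric])
    also have "\<dots> = dir_deriv (\<lambda>y. Z (chart_inv d y) d) (?\<phi> (snd c p)) (dir_deriv ?\<phi> (snd c p) (W p c))"
      by (rule dir_deriv_chain[OF mb_smooth_on_dir_deriv[OF U(1,3)] Z(2)[OF cd(2)] open_chart_image[OF cd(2)]])
         (use \<phi>p chart_in_image[OF d] in simp)
    also have "dir_deriv ?\<phi> (snd c p) (W p c) = W p d"
      by (rule tangent_space_transition[OF W c d, symmetric])
    finally show ?thesis by (simp only: \<phi>p)
  qed
  have pc: "chart_inv c (snd c p) = p" by (rule chart_inv_chart[OF c])
  let ?X = "\<lambda>y. X (chart_inv c y) c" and ?Y = "\<lambda>y. Y (chart_inv c y) c"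
  have "dir_deriv ?\<phi> (snd c p) (dir_deriv ?Y (snd c p) (X p c) - dir_deriv ?X (snd c p) (Y p c)) =
      dir_deriv (\<lambda>y. dir_deriv ?\<phi> y (?Y y)) (snd c p) (?X (snd c p)) -
      dir_deriv (\<lambda>y. dir_deriv ?\<phi> y (?X y)) (snd c p) (?Y (snd c p))"
    by (rule dir_deriv_commutator[OF U])
       (simp_all only: pc mb_smooth_on_dir_deriv[OF X(2)[OF cd(1)] chart_in_image[OF c]]
         mb_smooth_on_dir_deriv[OF Y(2)[OF cd(1)] chart_in_image[OF c]])
  also have "\<dots> = field_bracket M X Y p d"
    using d by (simp only: pc der[where Z = X and W = X, OF X X(1)[OF p]] der[where Z = Y and W = Y, OF Y Y(1)[OF p]] der[where Z = X and W = Y, OF X Y(1)[OF p]]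
       der[where Z = Y and W = X, OF Y X(1)[OF p]] field_bracket_def if_True)
  finally show "field_bracket M X Y p d = dir_deriv ?\<phi> (snd c p) (field_bracket M X Y p c)"
    using c by (simp add: field_bracket_def)
qed (simp add: field_bracket_def)

section \<open>Left-invariant vector fields\<close>

lemma dir_deriv_Pair_right: "dir_deriv (\<lambda>z. m (y, z)) z v = dir_deriv m (y, z) (0, v)"
  by (simp add: dir_deriv_def has_dir_deriv_Pair_right)

lemma is_chart_open_image_prod:
  assumes c: "is_chart X c" and d: "is_chart Y d"
    and U: "openin (prod_topology X Y) U" "U \<subseteq> fst c \<times> fst d"
  shows "open (map_prod (snd c) (snd d) ` U)"
proof (subst open_subopen, rule ballI)
  fix q assume "q \<in> map_prod (snd c) (snd d) ` U"
  then obtain a b where ab: "(a, b) \<in> U" "q = (snd c a, snd d b)" by auto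
  obtain A B where AB: "openin X A" "openin Y B" "a \<in> A" "b \<in> B" "A \<times> B \<subseteq> U"
    using U(1) ab(1) unfolding openin_prod_topology_alt by meson
  then have "A \<subseteq> fst c" "B \<subseteq> fst d" using U(2) by blast+
  then have "open (snd c ` A \<times> snd d ` B)"
    using is_chart_open_image[OF c] is_chart_open_image[OF d] AB by (intro open_Times) auto
  moreover have "snd c ` A \<times> snd d ` B = map_prod (snd c) (snd d) ` (A \<times> B)"
    by (simp add: map_prod_surj_on)
  ultimately show "\<exists>T. open T \<and> q \<in> T \<and> T \<subseteq> map_prod (snd c) (snd d) ` U"
    using AB(3-5) ab(2) by (intro exI[of _ "snd c ` A \<times> snd d ` B"]) auto
qed

text \<open>Group multiplication in coordinates. The two factors are inverted separately, in place
  of the inverse of the product chart, with which this agrees on \<open>chart_mult_dom\<close>;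
  slices in one factor are then direct.\<close>

definition chart_mult ::
    "'a monoid \<Rightarrow> ('a, 'e) chart \<Rightarrow> ('a, 'e) chart \<Rightarrow> ('a, 'e) chart \<Rightarrow> 'e \<times> 'e \<Rightarrow> 'e" where
  "chart_mult G c d e = (\<lambda>(y, z). snd e (chart_inv c y \<otimes>\<^bsub>G\<^esub> chart_inv d z))"

definition chart_mult_dom ::
    "'a monoid \<Rightarrow> ('a, 'e) chart \<Rightarrow> ('a, 'e) chart \<Rightarrow> ('a, 'e) chart \<Rightarrow> ('e \<times> 'e) set" where
  "chart_mult_dom G c d e =
     {(y, z). y \<in> snd c ` fst c \<and> z \<in> snd d ` fst d \<and> chart_inv c y \<otimes>\<^bsub>G\<^esub> chart_inv d z \<in> fst e}"

context lie_group
begin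

lemma chart_mult_smooth:
  assumes "c \<in> atlas M" "d \<in> atlas M" "e \<in> atlas M"
  shows "mb_smooth_on (chart_mult_dom G c d e) (chart_mult G c d e)" "open (chart_mult_dom G c d e)"
proof -
  define pc where "pc = (fst c \<times> fst d, map_prod (snd c) (snd d))"
  define m where "m = (\<lambda>(x, y). x \<otimes> y)"
  define U where "U = {p \<in> fst c \<times> fst d. m p \<in> fst e}"
  note cd = charts[OF assms(1)] charts[OF assms(2)]
  have pc: "pc \<in> atlas (prod_mfd M M)"
    using assms(1,2) by (simp add: prod_mfd_def pc_def del: split_paired_Ex) blast
  have img: "map_prod (snd c) (snd d) ` U = chart_mult_dom G c d e"
  proof (intro equalityI subsetI)
    fix q assume "q \<in> map_prod (snd c) (snd d) ` U"
    then show "q \<in> chart_mult_dom G c d e"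
      by (auto simp: U_def m_def chart_mult_dom_def chart_inv_left[OF cd(1)] chart_inv_left[OF cd(2)])
  next
    fix q assume q: "q \<in> chart_mult_dom G c d e"
    then have "q = map_prod (snd c) (snd d) (chart_inv c (fst q), chart_inv d (snd q))"
      by (auto simp: chart_mult_dom_def chart_inv_left[OF cd(1)] chart_inv_left[OF cd(2)])
    moreover have "(chart_inv c (fst q), chart_inv d (snd q)) \<in> U"
      using q by (auto simp: chart_mult_dom_def U_def m_def chart_inv_left[OF cd(1)] chart_inv_left[OF cd(2)])
    ultimately show "q \<in> map_prod (snd c) (snd d) ` U" by blast
  qed
  have smooth: "smooth_map (prod_mfd M M) M m"
    using smooth_mult by (simp add: m_def)
  have "openin (prod_topology (mtop M) (mtop M)) U"
  proof -
    have "openin (mtop (prod_mfd M M)) {p \<in> topspace (mtop (prod_mfd M M)). m p \<in> fst e}"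
      using smooth charts[OF assms(3)]
      by (intro openin_continuous_map_preimage) (auto simp: smooth_map_def is_chart_def)
    moreover have "openin (prod_topology (mtop M) (mtop M)) (fst c \<times> fst d)"
      using cd by (simp add: is_chart_def openin_prod_Times_iff)
    moreover have "U = (fst c \<times> fst d) \<inter> {p \<in> topspace (mtop (prod_mfd M M)). m p \<in> fst e}"
      using is_chart_subset[OF cd(1)] is_chart_subset[OF cd(2)] by (auto simp: U_def prod_mfd_def)
    ultimately show ?thesis by (simp add: prod_mfd_def openin_Int)
  qed
  from is_chart_open_image_prod[OF cd this] show "open (chart_mult_dom G c d e)"
    unfolding img by (auto simp: U_def)
  moreover have "mb_smooth_on (chart_mult_dom G c d e) (snd e \<circ> m \<circ> chart_inv pc)"
  proof -
    have "mb_smooth_on (snd pc ` {x \<in> fst pc. m x \<in> fst e}) (snd e \<circ> m \<circ> chart_inv pc)"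
      using smooth pc assms(3) unfolding smooth_map_def by blast
    moreover have "snd pc ` {x \<in> fst pc. m x \<in> fst e} = chart_mult_dom G c d e"
      using img by (simp add: pc_def U_def)
    ultimately show ?thesis by argo
  qed
  moreover have "(snd e \<circ> m \<circ> chart_inv pc) q = chart_mult G c d e q" if q: "q \<in> chart_mult_dom G c d e" for q
  proof -
    obtain a b where ab: "q = (snd c a, snd d b)" "a \<in> fst c" "b \<in> fst d"
      using q unfolding chart_mult_dom_def by blast
    have "inj_on (map_prod (snd c) (snd d)) (fst c \<times> fst d)"
      using is_chart_inj_on[OF cd(1)] is_chart_inj_on[OF cd(2)] by (rule map_prod_inj_on)
    then have "inv_into (fst c \<times> fst d) (map_prod (snd c) (snd d)) (map_prod (snd c) (snd d) (a, b)) = (a, b)"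
      using ab by (intro inv_into_f_f) auto
    then have "chart_inv pc q = (a, b)" by (simp add: chart_inv_def pc_def ab(1))
    then show ?thesis
      using ab by (simp add: m_def chart_mult_def
          chart_inv_left[OF cd(1)] chart_inv_left[OF cd(2)])
  qed
  ultimately show "mb_smooth_on (chart_mult_dom G c d e) (chart_mult G c d e)"
    using mb_smooth_on_cong by blast
qed

text \<open>In coordinates left translation by g is multiplication with the first argument frozen at
  the coordinate of g.\<close>

lemma smooth_left_mult:
  assumes g: "g \<in> carrier G"
  shows "smooth_map M M (\<lambda>h. g \<otimes> h)"
  unfolding smooth_map_def
proof (intro conjI ballI)
  have "continuous_map (prod_topology (mtop M) (mtop M)) (mtop M) (\<lambda>(x, y). x \<otimes> y)"
    using smooth_mult by (simp add: smooth_map_def prod_mfd_def)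
  moreover have "continuous_map (mtop M) (prod_topology (mtop M) (mtop M)) (\<lambda>h. (g, h))"
    using g by (simp add: continuous_map_paired topspace_carrier)
  ultimately have "continuous_map (mtop M) (mtop M) ((\<lambda>(x, y). x \<otimes> y) \<circ> (\<lambda>h. (g, h)))"
    by (rule continuous_map_compose[rotated])
  then show "continuous_map (mtop M) (mtop M) (\<lambda>h. g \<otimes> h)" by (simp add: comp_def)
next
  fix c e assume ce: "c \<in> atlas M" "e \<in> atlas M"
  obtain b where b: "b \<in> charts_at M g" using ex_chart_at[of g] g topspace_carrier by blast
  then have bM: "b \<in> atlas M" by (simp add: charts_at_def)
  note bg = chart_inv_chart[OF b] chart_in_image[OF b]
  have "mb_smooth_on (snd c ` {x \<in> fst c. g \<otimes> x \<in> fst e}) (\<lambda>z. chart_mult G b c e (snd b g, z))"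
    by (rule mb_smooth_on_Pair_right[OF chart_mult_smooth[OF bM ce]])
       (auto simp: chart_mult_dom_def bg is_chart_image_Collect[OF charts[OF ce(1)]])
  then show "mb_smooth_on (snd c ` {x \<in> fst c. g \<otimes> x \<in> fst e}) (snd e \<circ> (\<lambda>h. g \<otimes> h) \<circ> chart_inv c)"
    by (simp add: chart_mult_def bg comp_def)
qed

lemma left_inv_field_in_tangent_space:
  assumes "\<xi> \<in> tangent_space M \<one>" "g \<in> carrier G"
  shows "left_inv_field G M \<xi> g \<in> tangent_space M g"
  using tangent_map_in_tangent_space[OF lc_manifold_axioms lc_manifold_axioms smooth_left_mult[OF assms(2)], of \<one> \<xi>]
    assms by (simp add: left_inv_field_def topspace_carrier)

text \<open>The component at y is the partial derivative of multiplication in the second factor at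
  the identity. The right side depends on y only through the base point, which makes the smoothness
  of the field visible.\<close>

lemma left_inv_field_chart:
  assumes \<xi>: "\<xi> \<in> tangent_space M \<one>" and c0: "c0 \<in> charts_at M \<one>"
    and c: "c \<in> atlas M" "y \<in> snd c ` fst c"
  shows "left_inv_field G M \<xi> (chart_inv c y) c =
    dir_deriv (chart_mult G c c0 c) (y, snd c0 \<one>) (0, \<xi> c0)"
proof -
  let ?g = "chart_inv c y"
  have cg: "c \<in> charts_at M ?g" by (rule charts_at_chart_inv[OF c])
  then have g: "?g \<in> carrier G" using charts_atD by (simp add: topspace_carrier)
  then have cg': "c \<in> charts_at M (?g \<otimes> \<one>)" using cg by simp
  have "left_inv_field G M \<xi> ?g c = tangent_deriv M (snd c \<circ> (\<lambda>h. ?g \<otimes> h)) \<one> \<xi>"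
    using cg' by (simp add: left_inv_field_def tangent_map_def)
  also have "\<dots> = dir_deriv (snd c \<circ> (\<lambda>h. ?g \<otimes> h) \<circ> chart_inv c0) (snd c0 \<one>) (\<xi> c0)"
    by (rule tangent_deriv_eq[OF c0 smooth_map_chart_smooth_at[OF lc_manifold_axioms lc_manifold_axioms
          smooth_left_mult[OF g] c0 cg'] \<xi>])
  also have "snd c \<circ> (\<lambda>h. ?g \<otimes> h) \<circ> chart_inv c0 = (\<lambda>z. chart_mult G c c0 c (y, z))"
    by (simp add: chart_mult_def comp_def)
  finally show ?thesis by (simp only: dir_deriv_Pair_right)
qed

text \<open>A directional derivative of multiplication in a constant direction is smooth, and the
  field is its slice over the identity in the second factor.\<close>

lemma left_inv_field_smooth:
  assumes \<xi>: "\<xi> \<in> tangent_space M \<one>" and c: "c \<in> atlas M"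
  shows "mb_smooth_on (snd c ` fst c) (\<lambda>y. left_inv_field G M \<xi> (chart_inv c y) c)"
proof -
  obtain c0 where c0: "c0 \<in> charts_at M \<one>" using ex_chart_at[of \<one>] one_closed topspace_carrier by blast
  then have "c0 \<in> atlas M" by (simp add: charts_at_def)
  note m = chart_mult_smooth[OF c this c]
  have "mb_smooth_on (snd c ` fst c) (\<lambda>y. dir_deriv (chart_mult G c c0 c) (y, snd c0 \<one>) (0, \<xi> c0))"
  proof (rule mb_smooth_on_Pair_left[OF mb_smooth_on_dir_deriv_const[OF m] m(2)])
    fix y assume y: "y \<in> snd c ` fst c"
    then have "chart_inv c y \<in> carrier G"
      using charts_atD[OF charts_at_chart_inv[OF c y]] by (simp add: topspace_carrier)
    then show "(y, snd c0 \<one>) \<in> chart_mult_dom G c c0 c"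
      using y chart_in_image[OF c0] chart_inv_chart[OF c0] chart_inv_in[OF y]
      by (simp add: chart_mult_dom_def)
  qed
  moreover have "mb_smooth_on (snd c ` fst c) (\<lambda>y. left_inv_field G M \<xi> (chart_inv c y) c) \<longleftrightarrow>
      mb_smooth_on (snd c ` fst c) (\<lambda>y. dir_deriv (chart_mult G c c0 c) (y, snd c0 \<one>) (0, \<xi> c0))"
    by (rule mb_smooth_on_cong[OF open_chart_image[OF c]]) (rule left_inv_field_chart[OF \<xi> c0 c])
  ultimately show ?thesis by simp
qed

lemma lbracket_in_tangent_space:
  assumes "\<xi> \<in> tangent_space M \<one>" "\<eta> \<in> tangent_space M \<one>"
  shows "lbracket (lie_algebra G M) \<xi> \<eta> \<in> tangent_space M \<one>"
  using assms left_inv_field_in_tangent_space left_inv_field_smooth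
  by (auto simp: lie_algebra_def topspace_carrier intro!: field_bracket_in_tangent_space)

end

section \<open>Orbits of unitary representations\<close>

lemma scaleC_scaleR: "scaleC a (r *\<^sub>R x) = r *\<^sub>R scaleC a (x :: 'h::complex_hilbert)"
  by (simp add: scaleC_scaleC mult.commute flip: scaleC_of_real)

lemma scaleC_one [simp]: "scaleC 1 x = (x :: 'h::complex_hilbert)"
  using scaleC_of_real[of 1 x] by simp

lemma scaleC_zero_left [simp]: "scaleC 0 x = (0 :: 'h::complex_hilbert)"
  using scaleC_of_real[of 0 x] by simp

lemma cinner_scaleR_right: "cinner x (r *\<^sub>R y) = r *\<^sub>R cinner x (y :: 'h::complex_hilbert)"
  by (simp add: cinner_scaleC_right scaleR_conv_of_real flip: scaleC_of_real)

lemma cinner_scaleC_left: "cinner (scaleC a x) y = cnj a * cinner x (y :: 'h::complex_hilbert)"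
  by (metis cinner_commute cinner_scaleC_right complex_cnj_mult)

lemma cinner_add_left: "cinner (x + y) z = cinner x z + cinner y (z :: 'h::complex_hilbert)"
  by (metis cinner_commute cinner_add_right complex_cnj_add)

lemma norm_scaleC: "norm (scaleC a x) = cmod a * norm (x :: 'h::complex_hilbert)"
proof -
  have "complex_of_real ((norm (scaleC a x))\<^sup>2) = cnj a * a * complex_of_real ((norm x)\<^sup>2)"
    unfolding cinner_self[symmetric] by (simp add: cinner_scaleC_left cinner_scaleC_right)
  also have "\<dots> = complex_of_real ((cmod a * norm x)\<^sup>2)"
    by (simp add: power_mult_distrib mult.commute[of "cnj a"] flip: complex_norm_square)
  finally have "(norm (scaleC a x))\<^sup>2 = (cmod a * norm x)\<^sup>2"
    unfolding of_real_eq_iff .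
  then show ?thesis by (simp add: power2_eq_iff_nonneg)
qed

lemma bounded_linear_scaleC: "bounded_linear (scaleC a :: 'h::complex_hilbert \<Rightarrow> 'h)"
  by (rule bounded_linear_intro[where K = "cmod a"])
     (simp_all add: scaleC_add_right scaleC_scaleR norm_scaleC mult.commute)

lemma norm_add_cinner:
  "(norm (x + y))\<^sup>2 = (norm x)\<^sup>2 + (norm y)\<^sup>2 + 2 * Re (cinner x (y :: 'h::complex_hilbert))"
proof -
  have "complex_of_real ((norm (x + y))\<^sup>2) =
      complex_of_real ((norm x)\<^sup>2) + complex_of_real ((norm y)\<^sup>2) + (cinner x y + cnj (cinner x y))"
    unfolding cinner_self[symmetric]
    by (simp add: cinner_add_left cinner_add_right cinner_commute[of y x])
  also have "\<dots> = complex_of_real ((norm x)\<^sup>2 + (norm y)\<^sup>2 + 2 * Re (cinner x y))"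
    by (simp add: complex_add_cnj)
  finally show ?thesis unfolding of_real_eq_iff .
qed

text \<open>The class axioms for \<open>cinner\<close> are algebraic; this bound is what makes
  \<open>cinner x\<close> a bounded linear map.\<close>

lemma cinner_Cauchy_Schwarz: "cmod (cinner x y) \<le> norm x * norm (y :: 'h::complex_hilbert)"
proof (cases "cinner x y = 0")
  case False
  \<comment> \<open>Rotating x by this phase makes the inner product real and equal to its
    modulus.\<close>
  define a where "a = sgn (cinner x y)"
  have a: "cmod a = 1" using False by (simp add: a_def norm_sgn)
  have le: "Re (cinner u v) \<le> (norm u)\<^sup>2 / 2 + (norm v)\<^sup>2 / 2" for u v :: 'h
  proof -
    have "0 \<le> (norm (scaleC (- 1) u + v))\<^sup>2" by simp
    then show ?thesis
      unfolding norm_add_cinner by (simp add: norm_scaleC cinner_scaleC_left)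
  qed
  have Re: "Re (cinner (scaleC a u) v) = Re (cnj a * cinner u v)" for u v :: 'h
    by (simp add: cinner_scaleC_left)
  have "cnj a * cinner x y = cmod (cinner x y)"
    using False by (simp add: a_def sgn_eq field_simps complex_norm_square[symmetric] power2_eq_square)
  then have *: "cmod (cinner x y) = Re (cinner (scaleC a x) y)" by (simp add: Re)
  have "x \<noteq> 0" "y \<noteq> 0"
    using False cinner_scaleC_right[of x 0 y] cinner_scaleC_left[of 0 y y] cinner_scaleC_left[of 0 x y] by auto
  then have n: "norm x > 0" "norm y > 0" by simp_all
  \<comment> \<open>Scaling x by r and y by 1/r keeps the inner product and makes the two norms
    equal, so that the bound by half the sum of squares becomes the product of the norms.\<close>
  define r where "r = sqrt (norm y / norm x)"
  have r: "r > 0" using n by (simp add: r_def)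
  have r2: "r\<^sup>2 = norm y / norm x" using n by (simp add: r_def)
  have "Re (cinner (r *\<^sub>R scaleC a x) (inverse r *\<^sub>R y)) = Re (cinner (scaleC a x) y)"
    using r by (simp add: cinner_scaleC_right cinner_scaleC_left power2_eq_square flip: scaleC_of_real)
  with le[of "r *\<^sub>R scaleC a x" "inverse r *\<^sub>R y"] *
  have "cmod (cinner x y) \<le> (r * norm x)\<^sup>2 / 2 + (inverse r * norm y)\<^sup>2 / 2"
    using r by (simp add: norm_scaleC a)
  also have "\<dots> = r\<^sup>2 * (norm x)\<^sup>2 / 2 + inverse (r\<^sup>2) * (norm y)\<^sup>2 / 2"
    by (simp add: power_mult_distrib power_inverse)
  also have "\<dots> = norm x * norm y"
    unfolding r2 using n by (simp add: field_simps power2_eq_square)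
  finally show ?thesis .
qed simp

lemma bounded_linear_cinner: "bounded_linear (cinner (x :: 'h::complex_hilbert))"
  by (rule bounded_linear_intro[where K = "norm x"])
     (simp_all add: cinner_add_right cinner_scaleR_right mult.commute[of _ "norm x"] cinner_Cauchy_Schwarz)

lemma unitary_norm: "unitary U \<Longrightarrow> norm (U x) = norm x"
proof -
  assume "unitary U"
  then have "complex_of_real ((norm (U x))\<^sup>2) = complex_of_real ((norm x)\<^sup>2)"
    unfolding cinner_self[symmetric] by (simp add: unitary_def)
  then show ?thesis unfolding of_real_eq_iff by simp
qed

lemma unitary_bounded_linear: "unitary U \<Longrightarrow> bounded_linear U"
  by (rule bounded_linear_intro[where K = 1])
     (simp_all add: unitary_norm, simp_all add: unitary_def flip: scaleC_of_real)

lemma ray_eqD: "ray x = ray y \<Longrightarrow> \<exists>a. x = scaleC a y"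
proof -
  assume "ray x = ray y"
  moreover have "scaleC 1 x \<in> ray x" unfolding ray_def by (rule rangeI)
  ultimately show ?thesis by (auto simp: ray_def)
qed

section \<open>The orbit of a single smooth vector\<close>

text \<open>Isolates what the argument uses of the central extension: a unitary action of a Lie
  group in which the orbit map of one nonzero vector is smooth. Continuity of the action on other
  vectors is not part of the data.\<close>

locale unitary_orbit = lie_group G M
  for G :: "'a monoid" (structure) and M :: "('a, 'e::locally_convex_space) mfd" +
  fixes R :: "'a \<Rightarrow> 'h::complex_hilbert \<Rightarrow> 'h" and \<psi> :: 'h
  assumes unitary: "x \<in> carrier G \<Longrightarrow> unitary (R x)"
    and R_mult: "x \<in> carrier G \<Longrightarrow> y \<in> carrier G \<Longrightarrow> R (x \<otimes> y) v = R x (R y v)"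
    and R_one: "R \<one> v = v"
    and smooth_orbit: "smooth_map M vector_mfd (\<lambda>x. R x \<psi>)"
    and nonzero: "\<psi> \<noteq> 0"
begin

definition derived :: "(('a, 'e) chart \<Rightarrow> 'e) \<Rightarrow> 'h" where
  "derived \<xi> = tangent_deriv M (\<lambda>x. R x \<psi>) \<one> \<xi>"

lemma one_in_topspace: "\<one> \<in> topspace (mtop M)"
  by (simp add: topspace_carrier)

lemma orbit_smooth_at: "c \<in> charts_at M p \<Longrightarrow> chart_smooth_at c (\<lambda>x. R x \<psi>) p"
  by (rule smooth_map_vector_chart_smooth_at[OF smooth_orbit])

lemma orbit_chart_smooth: "c \<in> atlas M \<Longrightarrow> mb_smooth_on (snd c ` fst c) (\<lambda>y. R (chart_inv c y) \<psi>)"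
  using smooth_orbit by (simp add: smooth_map_vector_mfd_iff comp_def)

lemma derived_eq:
  "c \<in> charts_at M \<one> \<Longrightarrow> \<xi> \<in> tangent_space M \<one> \<Longrightarrow>
    derived \<xi> = dir_deriv (\<lambda>y. R (chart_inv c y) \<psi>) (snd c \<one>) (\<xi> c)"
  unfolding derived_def by (subst tangent_deriv_eq[OF _ orbit_smooth_at]) (auto simp: comp_def)

lemma derived_add:
  assumes "\<xi> \<in> tangent_space M \<one>" "\<eta> \<in> tangent_space M \<one>"
  shows "derived (\<lambda>c. \<xi> c + \<eta> c) = derived \<xi> + derived \<eta>"
  unfolding derived_def using ex_chart_at[OF one_in_topspace] tangent_deriv_add orbit_smooth_at assms by blast

lemma derived_scaleR:
  assumes "\<xi> \<in> tangent_space M \<one>"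
  shows "derived (\<lambda>c. r *\<^sub>R \<xi> c) = r *\<^sub>R derived \<xi>"
  unfolding derived_def using ex_chart_at[OF one_in_topspace] tangent_deriv_scaleR orbit_smooth_at assms by blast

text \<open>Both sides are the derivative at the identity of h \<mapsto> R (g h) \<psi>, with g the
  point of coordinate y: once through left translation followed by the orbit map, once through the
  orbit map followed by the bounded linear map R g.\<close>

lemma derived_left_inv_field:
  assumes \<xi>: "\<xi> \<in> tangent_space M \<one>" and c: "c \<in> atlas M" "y \<in> snd c ` fst c"
  shows "dir_deriv (\<lambda>y. R (chart_inv c y) \<psi>) y (left_inv_field G M \<xi> (chart_inv c y) c) =
    R (chart_inv c y) (derived \<xi>)"
proof -
  let ?g = "chart_inv c y"
  obtain b where b: "b \<in> charts_at M \<one>" using ex_chart_at[OF one_in_topspace] by blast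
  then have bM: "b \<in> atlas M" by (simp add: charts_at_def)
  have cg: "c \<in> charts_at M ?g" by (rule charts_at_chart_inv[OF c])
  then have g: "?g \<in> carrier G" using charts_atD by (simp add: topspace_carrier)
  then have g1: "?g \<otimes> \<one> = ?g" by simp
  then have cg': "c \<in> charts_at M (?g \<otimes> \<one>)" using cg by simp
  have "has_dir_deriv ((\<lambda>x. R x \<psi>) \<circ> (\<lambda>h. ?g \<otimes> h) \<circ> chart_inv b) (snd b \<one>) (\<xi> b)
    (dir_deriv ((\<lambda>x. R x \<psi>) \<circ> chart_inv c) (snd c (?g \<otimes> \<one>)) (tangent_map M M (\<lambda>h. ?g \<otimes> h) \<one> \<xi> c))"
    by (rule tangent_deriv_compose[OF lc_manifold_axioms lc_manifold_axioms smooth_left_mult[OF g]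
          b cg' orbit_smooth_at[OF cg'] \<xi>])
  then have 1: "has_dir_deriv ((\<lambda>x. R x \<psi>) \<circ> (\<lambda>h. ?g \<otimes> h) \<circ> chart_inv b) (snd b \<one>) (\<xi> b)
    (dir_deriv (\<lambda>y. R (chart_inv c y) \<psi>) y (left_inv_field G M \<xi> (chart_inv c y) c))"
    by (simp add: g1 chart_inv_right[OF c(2)] left_inv_field_def comp_def)
  have "has_dir_deriv (\<lambda>y. R ?g (R (chart_inv b y) \<psi>)) (snd b \<one>) (\<xi> b) (R ?g (derived \<xi>))"
    unfolding derived_eq[OF b \<xi>]
    by (rule has_dir_deriv_compose_linear[OF unitary_bounded_linear[OF unitary[OF g]]
          mb_smooth_on_dir_deriv[OF orbit_chart_smooth[OF bM] chart_in_image[OF b]]])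
  moreover have "((\<lambda>x. R x \<psi>) \<circ> (\<lambda>h. ?g \<otimes> h) \<circ> chart_inv b) z = R ?g (R (chart_inv b z) \<psi>)"
    if "z \<in> snd b ` fst b" for z
  proof -
    have "chart_inv b z \<in> carrier G"
      using charts_atD[OF charts_at_chart_inv[OF bM that]] by (simp add: topspace_carrier)
    then show ?thesis by (simp add: R_mult g)
  qed
  ultimately have "has_dir_deriv ((\<lambda>x. R x \<psi>) \<circ> (\<lambda>h. ?g \<otimes> h) \<circ> chart_inv b) (snd b \<one>) (\<xi> b) (R ?g (derived \<xi>))"
    by (subst has_dir_deriv_cong[OF open_chart_image[OF bM] chart_in_image[OF b]])
  from has_dir_deriv_unique[OF 1 this] show ?thesis .
qed

lemma derived_bracket_eq_0:
  assumes \<xi>: "\<xi> \<in> tangent_space M \<one>" "derived \<xi> = scaleC a \<psi>"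
    and \<eta>: "\<eta> \<in> tangent_space M \<one>" "derived \<eta> = scaleC b \<psi>"
  shows "derived (lbracket (lie_algebra G M) \<xi> \<eta>) = 0"
proof -
  obtain c where c: "c \<in> charts_at M \<one>" using ex_chart_at[OF one_in_topspace] by blast
  then have cM: "c \<in> atlas M" by (simp add: charts_at_def)
  let ?F = "\<lambda>y. R (chart_inv c y) \<psi>" and ?V = "snd c ` fst c"
  let ?L = "\<lambda>\<zeta> y. left_inv_field G M \<zeta> (chart_inv c y) c"
  note V = orbit_chart_smooth[OF cM] open_chart_image[OF cM] chart_in_image[OF c]
  \<comment> \<open>The eigenvalue equation holds on the whole chart image and not just at the
    identity, so it may be differentiated a second time.\<close>
  have along: "dir_deriv ?F y (?L \<zeta> y) = scaleC z (?F y)"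
    if "\<zeta> \<in> tangent_space M \<one>" "derived \<zeta> = scaleC z \<psi>" "y \<in> ?V" for \<zeta> z y
  proof -
    have "chart_inv c y \<in> carrier G"
      using charts_atD[OF charts_at_chart_inv[OF cM that(3)]] by (simp add: topspace_carrier)
    then show ?thesis
      using derived_left_inv_field[OF that(1) cM that(3)] that(2) unitary by (simp add: unitary_def)
  qed
  have second: "dir_deriv (\<lambda>y. dir_deriv ?F y (?L \<zeta> y)) (snd c \<one>) (?L \<zeta>' (snd c \<one>)) =
      scaleC z (scaleC z' \<psi>)"
    if \<zeta>: "\<zeta> \<in> tangent_space M \<one>" "derived \<zeta> = scaleC z \<psi>"
      and \<zeta>': "\<zeta>' \<in> tangent_space M \<one>" "derived \<zeta>' = scaleC z' \<psi>" for \<zeta> \<zeta>' z z'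
  proof -
    have "dir_deriv (\<lambda>y. dir_deriv ?F y (?L \<zeta> y)) (snd c \<one>) (?L \<zeta>' (snd c \<one>)) =
        dir_deriv (\<lambda>y. scaleC z (?F y)) (snd c \<one>) (?L \<zeta>' (snd c \<one>))"
      by (rule dir_deriv_cong[OF V(2,3) along[OF \<zeta>]])
    also have "\<dots> = scaleC z (dir_deriv ?F (snd c \<one>) (?L \<zeta>' (snd c \<one>)))"
      by (rule dir_deriv_eqI[OF has_dir_deriv_compose_linear[OF bounded_linear_scaleC
            mb_smooth_on_dir_deriv[OF V(1,3)]]])
    also have "dir_deriv ?F (snd c \<one>) (?L \<zeta>' (snd c \<one>)) = scaleC z' (?F (snd c \<one>))"
      by (rule along[OF \<zeta>' V(3)])
    also have "?F (snd c \<one>) = \<psi>"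
      by (simp only: chart_inv_chart[OF c] R_one)
    finally show ?thesis .
  qed
  have L: "mb_smooth_on ?V (?L \<zeta>)" if "\<zeta> \<in> tangent_space M \<one>" for \<zeta>
    by (rule left_inv_field_smooth[OF that cM])
  have "derived (lbracket (lie_algebra G M) \<xi> \<eta>) =
      dir_deriv ?F (snd c \<one>) (lbracket (lie_algebra G M) \<xi> \<eta> c)"
    by (rule derived_eq[OF c lbracket_in_tangent_space[OF \<xi>(1) \<eta>(1)]])
  also have "lbracket (lie_algebra G M) \<xi> \<eta> c =
      dir_deriv (?L \<eta>) (snd c \<one>) (?L \<xi> (snd c \<one>)) - dir_deriv (?L \<xi>) (snd c \<one>) (?L \<eta> (snd c \<one>))"
    using c by (simp add: lie_algebra_def field_bracket_def chart_inv_chart)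
  also have "dir_deriv ?F (snd c \<one>) \<dots> =
      dir_deriv (\<lambda>y. dir_deriv ?F y (?L \<eta> y)) (snd c \<one>) (?L \<xi> (snd c \<one>)) -
      dir_deriv (\<lambda>y. dir_deriv ?F y (?L \<xi> y)) (snd c \<one>) (?L \<eta> (snd c \<one>))"
    by (rule dir_deriv_commutator[OF V mb_smooth_on_dir_deriv[OF L[OF \<xi>(1)] V(3)]
          mb_smooth_on_dir_deriv[OF L[OF \<eta>(1)] V(3)]])
  also have "\<dots> = scaleC b (scaleC a \<psi>) - scaleC a (scaleC b \<psi>)"
    by (simp only: second[OF \<eta> \<xi>] second[OF \<xi> \<eta>])
  also have "\<dots> = 0" by (simp add: scaleC_scaleC mult.commute)
  finally show ?thesis .
qed

text \<open>With q the difference quotient of the orbit, equality of the norms of \<psi> + t q and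
  \<psi> forces Re <\<psi>, q> = - t |q|^2 / 2, which tends to 0. No derivative of the inner product
  in both arguments is taken.\<close>

lemma Re_cinner_derived:
  assumes \<xi>: "\<xi> \<in> tangent_space M \<one>"
  shows "Re (cinner \<psi> (derived \<xi>)) = 0"
proof -
  obtain c where c: "c \<in> charts_at M \<one>" using ex_chart_at[OF one_in_topspace] by blast
  then have cM: "c \<in> atlas M" by (simp add: charts_at_def)
  define F where "F y = R (chart_inv c y) \<psi>" for y
  define q where "q t = (F (snd c \<one> + t *\<^sub>R \<xi> c) - F (snd c \<one>)) /\<^sub>R t" for t
  have F1: "F (snd c \<one>) = \<psi>" by (simp add: F_def chart_inv_chart[OF c] R_one)
  have "has_dir_deriv F (snd c \<one>) (\<xi> c) (derived \<xi>)"
    unfolding derived_eq[OF c \<xi>] F_def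
    by (rule mb_smooth_on_dir_deriv[OF orbit_chart_smooth[OF cM] chart_in_image[OF c]])
  then have q: "(q \<longlongrightarrow> derived \<xi>) (at 0)"
    unfolding has_dir_deriv_def q_def .
  have "((\<lambda>t. Re (cinner \<psi> (q t))) \<longlongrightarrow> Re (cinner \<psi> (derived \<xi>))) (at 0)"
    by (intro tendsto_Re bounded_linear.tendsto[OF bounded_linear_cinner] q)
  moreover have "((\<lambda>t. Re (cinner \<psi> (q t))) \<longlongrightarrow> 0) (at 0)"
  proof (rule Lim_transform_eventually)
    have "((\<lambda>t. - t * (norm (q t))\<^sup>2 / 2) \<longlongrightarrow> - 0 * (norm (derived \<xi>))\<^sup>2 / 2) (at 0)"
      by (intro tendsto_intros q) simp
    then show "((\<lambda>t. - t * (norm (q t))\<^sup>2 / 2) \<longlongrightarrow> 0) (at 0)" by simp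
    show "\<forall>\<^sub>F t in at 0. - t * (norm (q t))\<^sup>2 / 2 = Re (cinner \<psi> (q t))"
      using eventually_at_zero_nonzero eventually_line[OF open_chart_image[OF cM] chart_in_image[OF c], of "\<xi> c"]
    proof eventually_elim
      case (elim t)
      have "chart_inv c (snd c \<one> + t *\<^sub>R \<xi> c) \<in> carrier G"
        using charts_atD[OF charts_at_chart_inv[OF cM elim(2)]] by (simp add: topspace_carrier)
      then have "norm (F (snd c \<one> + t *\<^sub>R \<xi> c)) = norm \<psi>"
        by (simp add: F_def unitary_norm[OF unitary])
      moreover have "F (snd c \<one> + t *\<^sub>R \<xi> c) = \<psi> + t *\<^sub>R q t"
        using elim(1) by (simp add: q_def F1)
      ultimately have "(norm \<psi>)\<^sup>2 = (norm (\<psi> + t *\<^sub>R q t))\<^sup>2" by simp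
      also have "\<dots> = (norm \<psi>)\<^sup>2 + t\<^sup>2 * (norm (q t))\<^sup>2 + 2 * (t * Re (cinner \<psi> (q t)))"
        unfolding norm_add_cinner by (simp add: cinner_scaleR_right power_mult_distrib)
      finally have "t * (t * (norm (q t))\<^sup>2 + 2 * Re (cinner \<psi> (q t))) = 0"
        by (simp add: algebra_simps power2_eq_square)
      then show ?case using elim(1) by simp
    qed
  qed
  ultimately show ?thesis by (rule tendsto_unique[rotated]) simp
qed

end

section \<open>Characters with values in the circle\<close>

text \<open>Agreement of F' with L \<circ> F is asked only on the points of the manifold: in the
  applications it rests on properties of group elements, such as linearity of R x.\<close>

lemma (in lc_manifold) smooth_map_bounded_linear:
  fixes L :: "'f::real_normed_vector \<Rightarrow> 'h::real_normed_vector"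
  assumes L: "bounded_linear L" and F: "smooth_map M vector_mfd F"
    and F': "\<And>x. x \<in> topspace (mtop M) \<Longrightarrow> F' x = L (F x)"
  shows "smooth_map M vector_mfd F'"
  unfolding smooth_map_vector_mfd_iff
proof (intro conjI ballI)
  have "continuous_map euclidean euclidean L"
    using bounded_linear.continuous_on[OF L continuous_on_id, of UNIV] by simp
  then have "continuous_map (mtop M) euclidean (L \<circ> F)"
    using F by (auto simp: smooth_map_vector_mfd_iff intro: continuous_map_compose)
  then show "continuous_map (mtop M) euclidean F'"
    by (rule continuous_map_eq) (simp add: F')
next
  fix c assume c: "c \<in> atlas M"
  have "mb_smooth_on (snd c ` fst c) (\<lambda>y. L ((F \<circ> chart_inv c) y))"
    using F c by (intro mb_smooth_on_bounded_linear[OF L open_chart_image[OF c]])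
      (simp add: smooth_map_vector_mfd_iff comp_def)
  moreover have "L ((F \<circ> chart_inv c) y) = (F' \<circ> chart_inv c) y" if "y \<in> snd c ` fst c" for y
    using charts_atD[OF charts_at_chart_inv[OF c that]] by (simp add: F')
  ultimately show "mb_smooth_on (snd c ` fst c) (F' \<circ> chart_inv c)"
    using mb_smooth_on_cong[OF open_chart_image[OF c], of "\<lambda>y. L ((F \<circ> chart_inv c) y)" "F' \<circ> chart_inv c"]
    by simp
qed

lemma unit_complex_not_nonpos:
  assumes "cmod z = 1" "z \<noteq> - 1"
  shows "z \<notin> \<real>\<^sub>\<le>\<^sub>0"
proof
  assume "z \<in> \<real>\<^sub>\<le>\<^sub>0"
  then obtain x where "z = complex_of_real x" "x \<le> 0" by (auto elim: nonpos_Reals_cases)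
  with assms show False by auto
qed

text \<open>The chart of the circle around w is the argument of z / w. On its domain this quotient
  has modulus 1 and differs from -1, hence avoids the nonpositive axis, off which \<open>Arg\<close>
  is smooth.\<close>

lemma (in lc_manifold) smooth_map_circle_mfd:
  assumes \<kappa>: "smooth_map M vector_mfd \<kappa>" and unit: "\<And>x. x \<in> topspace (mtop M) \<Longrightarrow> cmod (\<kappa> x) = 1"
  shows "smooth_map M circle_mfd \<kappa>"
  unfolding smooth_map_def
proof (intro conjI ballI)
  have cont: "continuous_map (mtop M) (top_of_set (sphere 0 1)) \<kappa>"
    using \<kappa> unit by (auto simp: smooth_map_vector_mfd_iff continuous_map_in_subtopology)
  then show "continuous_map (mtop M) (mtop circle_mfd) \<kappa>" by (simp add: circle_mfd_def)
  fix c :: "('a, 'e) chart" and d :: "(complex, real) chart"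
  assume c: "c \<in> atlas M" and "d \<in> atlas circle_mfd"
  then obtain w where w: "cmod w = 1" and d: "d = (sphere 0 1 - {- w}, \<lambda>z. Arg (z / w))"
    by (auto simp: circle_mfd_def)
  let ?U = "snd c ` {x \<in> fst c. \<kappa> x \<in> sphere 0 1 - {- w}}"
  have "openin (top_of_set (sphere 0 1)) (sphere 0 1 - {- w})"
    by (metis Diff_eq openin_open_Int open_Compl closed_singleton)
  then have U: "open ?U" by (rule open_preimage_chart[OF cont _ c])
  have "mb_smooth_on (snd c ` fst c) (\<lambda>y. (\<kappa> \<circ> chart_inv c) y / w)"
    using \<kappa> c by (intro mb_smooth_on_bounded_linear[OF bounded_linear_divide open_chart_image[OF c]])
      (simp add: smooth_map_vector_mfd_iff comp_def)
  then have "mb_smooth_on ?U (\<lambda>y. (\<kappa> \<circ> chart_inv c) y / w)"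
    by (rule mb_smooth_on_subset) auto
  moreover have "(\<lambda>y. (\<kappa> \<circ> chart_inv c) y / w) ` ?U \<subseteq> - \<real>\<^sub>\<le>\<^sub>0"
  proof (intro image_subsetI ComplI)
    fix y assume "y \<in> ?U"
    then have y: "cmod (\<kappa> (chart_inv c y)) = 1" "\<kappa> (chart_inv c y) \<noteq> - w"
      unfolding is_chart_image_Collect[OF charts[OF c]] by auto
    have "w \<noteq> 0" using w by auto
    then have "(\<kappa> \<circ> chart_inv c) y / w \<noteq> - 1" using y(2) by (simp add: field_simps)
    moreover have "cmod ((\<kappa> \<circ> chart_inv c) y / w) = 1" using y(1) w by (simp add: norm_divide)
    moreover assume "(\<kappa> \<circ> chart_inv c) y / w \<in> \<real>\<^sub>\<le>\<^sub>0"
    ultimately show False using unit_complex_not_nonpos by blast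
  qed
  ultimately have "mb_smooth_on ?U (Arg \<circ> (\<lambda>y. (\<kappa> \<circ> chart_inv c) y / w))"
    by (intro mb_smooth_on_compose[OF U _ mb_smooth_on_Arg]) (simp_all add: open_Compl)
  then show "mb_smooth_on (snd c ` {x \<in> fst c. \<kappa> x \<in> fst d}) (snd d \<circ> \<kappa> \<circ> chart_inv c)"
    by (simp add: d comp_def)
qed

context unitary_orbit
begin

text \<open>\<kappa> is a bounded linear functional of the orbit map, so its smoothness and
  derivative come from the orbit. The stabilizing property enters through the eigenvalue equation,
  which makes \<kappa> multiplicative and of modulus 1.\<close>

lemma character_of_stabilizing_subgroup:
  assumes H: "lie_subgroup G M H N" and stab: "\<And>h. h \<in> H \<Longrightarrow> ray (R h \<psi>) = ray \<psi>"
  shows "integrates_to_character G M (\<lambda>\<xi>. cinner \<psi> (derived \<xi>) / cinner \<psi> \<psi>) H N"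
proof -
  interpret N: lie_group "G\<lparr>carrier := H\<rparr>" N using H by (simp add: lie_subgroup_def)
  have sub: "subgroup H G" and incl: "smooth_map N M id" using H by (auto simp: lie_subgroup_def)
  have HG: "h \<in> carrier G" if "h \<in> H" for h using subgroup.subset[OF sub] that by blast
  have top: "topspace (mtop N) = H" using N.topspace_carrier by simp
  \<comment> \<open>Normalized so that L \<psi> = 1; applied to a multiple of \<psi> it returns the
    factor.\<close>
  define L where "L v = cinner \<psi> v / cinner \<psi> \<psi>" for v
  have n: "cinner \<psi> \<psi> \<noteq> 0" using nonzero by (simp add: cinner_self)
  have L: "bounded_linear L"
    unfolding L_def using bounded_linear_compose[OF bounded_linear_divide bounded_linear_cinner] .
  define \<kappa> where "\<kappa> h = L (R h \<psi>)" for h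
  have eigen: "R h \<psi> = scaleC (\<kappa> h) \<psi>" if h: "h \<in> H" for h
  proof -
    obtain a where "R h \<psi> = scaleC a \<psi>" using ray_eqD[OF stab[OF h]] by blast
    then show ?thesis using n by (simp add: \<kappa>_def L_def cinner_scaleC_right)
  qed
  have unit: "cmod (\<kappa> h) = 1" if "h \<in> H" for h
    using unitary_norm[OF unitary[OF HG[OF that]], of \<psi>] nonzero
    by (simp add: eigen[OF that] norm_scaleC)
  have mult: "\<kappa> (g \<otimes> h) = \<kappa> g * \<kappa> h" if "g \<in> H" "h \<in> H" for g h
  proof -
    have "R (g \<otimes> h) \<psi> = R g (scaleC (\<kappa> h) \<psi>)"
      using that by (simp add: R_mult HG eigen)
    also have "\<dots> = scaleC (\<kappa> h) (R g \<psi>)"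
      using unitary[OF HG[OF that(1)]] by (simp add: unitary_def)
    also have "\<dots> = scaleC (\<kappa> h * \<kappa> g) \<psi>" by (simp add: eigen[OF that(1)] scaleC_scaleC)
    finally show ?thesis using n by (simp add: \<kappa>_def L_def cinner_scaleC_right mult.commute)
  qed
  \<comment> \<open>N may carry a finer topology than H inherits, so smoothness on N is obtained by
    composing with the inclusion.\<close>
  have orbit: "smooth_map N vector_mfd ((\<lambda>x. R x \<psi>) \<circ> id)"
    by (rule smooth_map_compose_vector[OF N.lc_manifold_axioms lc_manifold_axioms incl smooth_orbit])
  have \<kappa>: "smooth_map N vector_mfd \<kappa>"
    by (rule N.smooth_map_bounded_linear[OF L orbit]) (simp add: \<kappa>_def)
  have "lie_group_hom (G\<lparr>carrier := H\<rparr>) N circle_group circle_mfd \<kappa>"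
    using N.smooth_map_circle_mfd[OF \<kappa>] unit mult
    by (auto simp: lie_group_hom_def hom_def circle_group_def top)
  moreover have "tangent_deriv N \<kappa> \<one> \<xi> = L (derived (tangent_map N M id \<one> \<xi>))"
    if \<xi>: "\<xi> \<in> tangent_space N \<one>" for \<xi>
  proof -
    have oneN: "\<one> \<in> topspace (mtop N)" using subgroup.one_closed[OF sub] by (simp add: top)
    obtain e where e: "e \<in> charts_at N \<one>" using N.ex_chart_at[OF oneN] by blast
    obtain d where d: "d \<in> charts_at M \<one>" using ex_chart_at[OF one_in_topspace] by blast
    have tm: "tangent_map N M id \<one> \<xi> \<in> tangent_space M \<one>"
      using tangent_map_in_tangent_space[OF N.lc_manifold_axioms lc_manifold_axioms incl oneN \<xi>] by simp
    \<comment> \<open>Chain rule along the inclusion: it moves the derivative from the tangent space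
      of N into that of M, where \<open>derived\<close> is defined.\<close>
    have "has_dir_deriv ((\<lambda>x. R x \<psi>) \<circ> id \<circ> chart_inv e) (snd e \<one>) (\<xi> e)
      (dir_deriv ((\<lambda>x. R x \<psi>) \<circ> chart_inv d) (snd d (id \<one>)) (tangent_map N M id \<one> \<xi> d))"
      by (rule tangent_deriv_compose[OF N.lc_manifold_axioms lc_manifold_axioms incl e _ _ \<xi>])
         (simp_all add: d orbit_smooth_at)
    then have "has_dir_deriv (\<lambda>y. R (chart_inv e y) \<psi>) (snd e \<one>) (\<xi> e) (derived (tangent_map N M id \<one> \<xi>))"
      by (simp add: derived_eq[OF d tm] comp_def)
    from has_dir_deriv_compose_linear[OF L this]
    have "dir_deriv (\<kappa> \<circ> chart_inv e) (snd e \<one>) (\<xi> e) = L (derived (tangent_map N M id \<one> \<xi>))"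
      by (simp add: dir_deriv_eqI \<kappa>_def comp_def)
    then show ?thesis
      by (simp add: N.tangent_deriv_eq[OF e N.smooth_map_vector_chart_smooth_at[OF \<kappa> e] \<xi>])
  qed
  ultimately show ?thesis
    unfolding integrates_to_character_def L_def by blast
qed

end

section \<open>The central extension and the stabilizer character\<close>

lemma sharp_group_unitary_orbit:
  fixes S :: "('g \<times> ('h::complex_hilbert \<Rightarrow> 'h), 'f::locally_convex_space) mfd"
  assumes S: "lie_group (sharp_group G \<rho>) S" and \<psi>: "\<psi> \<noteq> 0" "ray \<psi> \<in> projectivization (smooth_vectors S)"
  shows "unitary_orbit (sharp_group G \<rho>) S snd \<psi>"
proof -
  interpret S: lie_group "sharp_group G \<rho>" S by fact
  have unitary: "unitary (snd x)" if "x \<in> carrier (sharp_group G \<rho>)" for x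
    using that by (auto simp: sharp_group_def unitary_group_def)
  \<comment> \<open>Only the ray of \<psi> is known to be smooth. It contains a smooth vector
    \<phi>, and \<psi> is a scalar multiple of it.\<close>
  obtain \<phi> where \<phi>: "\<phi> \<in> smooth_vectors S" "ray \<psi> = ray \<phi>"
    using \<psi>(2) by (auto simp: projectivization_def)
  then obtain a where a: "\<psi> = scaleC a \<phi>" using ray_eqD by blast
  have "smooth_map S vector_mfd (\<lambda>x. snd x \<psi>)"
  proof (rule S.smooth_map_bounded_linear[OF bounded_linear_scaleC])
    show "smooth_map S vector_mfd (\<lambda>x. snd x \<phi>)" using \<phi>(1) by (simp add: smooth_vectors_def)
    fix x assume "x \<in> topspace (mtop S)"
    then show "snd x \<psi> = scaleC a (snd x \<phi>)"
      using unitary[of x] by (simp add: S.topspace_carrier a unitary_def)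
  qed
  then show ?thesis
    using \<psi>(1) unitary
    by unfold_locales (auto simp: sharp_group_def DirProd_def unitary_group_def)
qed

theorem proposition4p5:
  fixes G :: "'g monoid"
    and M :: "('g, 'e::locally_convex_space) mfd"
    and \<rho> :: "'g \<Rightarrow> ('h::complex_hilbert \<Rightarrow> 'h) set"
    and S :: "('g \<times> ('h \<Rightarrow> 'h), 'f::locally_convex_space) mfd"
    and \<psi> :: 'h
  assumes "lie_group G M"
    and "smooth_projective_rep G M \<rho>"
    and "sharp_structure G M \<rho> S"
    and "\<psi> \<noteq> 0"
    and "ray \<psi> \<in> projectivization (smooth_vectors S)"
  shows "(\<forall>\<xi>\<in>lcarrier (lie_algebra (sharp_group G \<rho>) S).
            - \<i> * momentum G \<rho> S \<psi> \<xi> \<in> lcarrier imaginary_lie_algebra) \<and>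
         lie_subalgebra (stabilizer_algebra G \<rho> S \<psi>) (lie_algebra (sharp_group G \<rho>) S) \<and>
         lie_algebra_character
           ((lie_algebra (sharp_group G \<rho>) S)\<lparr>lcarrier := stabilizer_algebra G \<rho> S \<psi>\<rparr>)
           (\<lambda>\<xi>. - \<i> * momentum G \<rho> S \<psi> \<xi>) \<and>
         (\<forall>H (N :: ('g \<times> ('h \<Rightarrow> 'h), 'k::locally_convex_space) mfd).
            lie_subgroup (sharp_group G \<rho>) S H N \<and> H \<subseteq> stabilizer_group G \<rho> \<psi> \<longrightarrow>
            integrates_to_character (sharp_group G \<rho>) S
              (\<lambda>\<xi>. - \<i> * momentum G \<rho> S \<psi> \<xi>) H N)"
proof -
  let ?L = "lie_algebra (sharp_group G \<rho>) S" and ?K = "stabilizer_algebra G \<rho> S \<psi>"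
  let ?f = "\<lambda>\<xi>. - \<i> * momentum G \<rho> S \<psi> \<xi>"
  have "lie_group (sharp_group G \<rho>) S" using assms(3) by (simp add: sharp_structure_def)
  then interpret unitary_orbit "sharp_group G \<rho>" S snd \<psi>
    using assms(4,5) by (rule sharp_group_unitary_orbit)
  \<comment> \<open>Since the inner product is linear in the second argument, the factor \<i> comes
    out and cancels against - \<i>.\<close>
  have f: "?f = (\<lambda>\<xi>. cinner \<psi> (derived \<xi>) / cinner \<psi> \<psi>)"
    by (simp add: momentum_def derived_rep_def derived_def cinner_scaleC_right fun_eq_iff flip: mult.assoc)
  have f_eq: "?f \<xi> = cinner \<psi> (derived \<xi>) / cinner \<psi> \<psi>" for \<xi>
    by (rule fun_cong[OF f])
  have carrier: "lcarrier ?L = tangent_space S \<one>\<^bsub>sharp_group G \<rho>\<^esub>"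
    by (simp add: lie_algebra_def)
  have K: "\<xi> \<in> ?K \<longleftrightarrow> \<xi> \<in> lcarrier ?L \<and> (\<exists>r::real. derived \<xi> = scaleC (\<i> * complex_of_real r) \<psi>)" for \<xi>
    by (simp add: stabilizer_algebra_def derived_rep_def derived_def)
  have KI: "\<xi> \<in> ?K" if "\<xi> \<in> lcarrier ?L" "derived \<xi> = scaleC (\<i> * complex_of_real r) \<psi>" for \<xi> r
    using that K by blast
  have imag: "\<forall>\<xi>\<in>lcarrier ?L. ?f \<xi> \<in> lcarrier imaginary_lie_algebra"
  proof
    fix \<xi> assume "\<xi> \<in> lcarrier ?L"
    then have "Re (cinner \<psi> (derived \<xi>)) = 0" unfolding carrier by (rule Re_cinner_derived)
    moreover have "?f \<xi> = cinner \<psi> (derived \<xi>) / complex_of_real ((norm \<psi>)\<^sup>2)"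
      unfolding cinner_self[symmetric] by (rule f_eq)
    ultimately have "Re (?f \<xi>) = 0" by (simp only: Re_divide_of_real)
    then show "?f \<xi> \<in> lcarrier imaginary_lie_algebra" by (simp add: imaginary_lie_algebra_def)
  qed
  have add: "ladd ?L \<xi> \<eta> \<in> ?K \<and> ?f (ladd ?L \<xi> \<eta>) = ?f \<xi> + ?f \<eta>" if "\<xi> \<in> ?K" "\<eta> \<in> ?K" for \<xi> \<eta>
  proof -
    obtain r s where rs: "derived \<xi> = scaleC (\<i> * complex_of_real r) \<psi>"
      "derived \<eta> = scaleC (\<i> * complex_of_real s) \<psi>" using \<open>\<xi> \<in> ?K\<close> \<open>\<eta> \<in> ?K\<close> K by blast
    have t: "\<xi> \<in> tangent_space S \<one>\<^bsub>sharp_group G \<rho>\<^esub>" "\<eta> \<in> tangent_space S \<one>\<^bsub>sharp_group G \<rho>\<^esub>"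
      using that K carrier by auto
    have l: "ladd ?L \<xi> \<eta> = (\<lambda>c. \<xi> c + \<eta> c)" by (simp add: lie_algebra_def)
    have d: "derived (ladd ?L \<xi> \<eta>) = derived \<xi> + derived \<eta>"
      unfolding l by (rule derived_add[OF t])
    have "ladd ?L \<xi> \<eta> \<in> ?K"
    proof (rule KI[where r = "r + s"])
      show "ladd ?L \<xi> \<eta> \<in> lcarrier ?L" unfolding l carrier by (rule add_in_tangent_space[OF t])
      show "derived (ladd ?L \<xi> \<eta>) = scaleC (\<i> * complex_of_real (r + s)) \<psi>"
        by (simp add: d rs distrib_left scaleC_add_left)
    qed
    then show ?thesis unfolding f_eq d by (simp add: cinner_add_right add_divide_distrib)
  qed
  have scale: "lscale ?L r \<xi> \<in> ?K \<and> ?f (lscale ?L r \<xi>) = r *\<^sub>R ?f \<xi>" if "\<xi> \<in> ?K" for r \<xi>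
  proof -
    obtain s where s: "derived \<xi> = scaleC (\<i> * complex_of_real s) \<psi>" using \<open>\<xi> \<in> ?K\<close> K by blast
    have t: "\<xi> \<in> tangent_space S \<one>\<^bsub>sharp_group G \<rho>\<^esub>" using that K carrier by auto
    have l: "lscale ?L r \<xi> = (\<lambda>c. r *\<^sub>R \<xi> c)" by (simp add: lie_algebra_def)
    have d: "derived (lscale ?L r \<xi>) = r *\<^sub>R derived \<xi>"
      unfolding l by (rule derived_scaleR[OF t])
    have "lscale ?L r \<xi> \<in> ?K"
    proof (rule KI[where r = "r * s"])
      show "lscale ?L r \<xi> \<in> lcarrier ?L" unfolding l carrier by (rule scaleR_in_tangent_space[OF t])
      show "derived (lscale ?L r \<xi>) = scaleC (\<i> * complex_of_real (r * s)) \<psi>"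
        by (simp add: d s scaleC_scaleC mult.left_commute flip: scaleC_of_real)
    qed
    then show ?thesis unfolding f_eq d by (simp add: cinner_scaleR_right scaleR_conv_of_real)
  qed
  have bracket: "lbracket ?L \<xi> \<eta> \<in> ?K \<and> ?f (lbracket ?L \<xi> \<eta>) = 0" if "\<xi> \<in> ?K" "\<eta> \<in> ?K" for \<xi> \<eta>
  proof -
    obtain r s where rs: "derived \<xi> = scaleC (\<i> * complex_of_real r) \<psi>"
      "derived \<eta> = scaleC (\<i> * complex_of_real s) \<psi>" using \<open>\<xi> \<in> ?K\<close> \<open>\<eta> \<in> ?K\<close> K by blast
    have t: "\<xi> \<in> tangent_space S \<one>\<^bsub>sharp_group G \<rho>\<^esub>" "\<eta> \<in> tangent_space S \<one>\<^bsub>sharp_group G \<rho>\<^esub>"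
      using that K carrier by auto
    have d: "derived (lbracket ?L \<xi> \<eta>) = 0"
      by (rule derived_bracket_eq_0[OF t(1) rs(1) t(2) rs(2)])
    have "lbracket ?L \<xi> \<eta> \<in> ?K"
    \<comment> \<open>The derived bracket annihilates \<psi>, so the bracket lies in the stabilizer
      algebra with eigenvalue 0, the value that a character must take on it.\<close>
    proof (rule KI[where r = 0])
      show "lbracket ?L \<xi> \<eta> \<in> lcarrier ?L" unfolding carrier by (rule lbracket_in_tangent_space[OF t])
    qed (simp add: d)
    moreover have "cinner \<psi> 0 = 0" using cinner_scaleR_right[of \<psi> 0 0] by simp
    ultimately show ?thesis unfolding f_eq d by simp
  qed
  \<comment> \<open>The zero vector witnesses nonemptiness, which \<open>lie_subalgebra\<close>
    demands.\<close>
  have "(\<lambda>_. 0) \<in> ?K"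
  proof (rule KI[where r = 0])
    show "(\<lambda>_. 0) \<in> lcarrier ?L" unfolding carrier by (rule zero_in_tangent_space)
    show "derived (\<lambda>_. 0) = scaleC (\<i> * complex_of_real 0) \<psi>"
      using derived_scaleR[OF zero_in_tangent_space, of 0] by simp
  qed
  moreover have "?K \<subseteq> lcarrier ?L" using K by blast
  ultimately have "lie_subalgebra ?K ?L"
    using add scale bracket unfolding lie_subalgebra_def by blast
  moreover have "lie_algebra_character (?L\<lparr>lcarrier := ?K\<rparr>) ?f"
    using add scale bracket imag K
    unfolding lie_algebra_character_def lie_algebra_hom_def
    by (auto simp: imaginary_lie_algebra_def)
  moreover have "integrates_to_character (sharp_group G \<rho>) S ?f H N"
    if "lie_subgroup (sharp_group G \<rho>) S H N" "H \<subseteq> stabilizer_group G \<rho> \<psi>"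
    for H and N :: "('g \<times> ('h \<Rightarrow> 'h), 'k) mfd"
    unfolding f
  proof (rule character_of_stabilizing_subgroup[OF that(1)])
    fix h assume "h \<in> H"
    then show "ray (snd h \<psi>) = ray \<psi>" using that(2) by (auto simp: stabilizer_group_def)
  qed
  ultimately show ?thesis using imag by blast
qed

end
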